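(* Let $\Bbbk$ be a field of characteristic zero, $q\in\Bbbk\setminus\{0\}$, $n$ a positive integer, and let $W_n$ be a classical Weyl group $W(A_n)=S_n$, $W(B_n)=W(C_n)$ or $W(D_n)$. Then the $q$-difference Noether problem for $W_n$ has a positive solution; namely, there is an isomorphism of $\Bbbk$-algebras $$\mathcal{F}_{q,n}^{W_n}\simeq\mathcal{F}_{\bar q,n},$$ where $$\bar q=\begin{cases}(q,q,\ldots,q),&\text{if }W_n=W(A_n)=S_n,\\ (q^2,q^2,\ldots,q^2),&\text{if }W_n=W(B_n)=W(C_n),\\ (q,q^2,q^2,\ldots,q^2),&\text{if }W_n=W(D_n).\end{cases}$$
   Context: For $p\in\Bbbk\setminus\{0\}$, $\mathcal{O}_p(\Bbbk^2)=\Bbbk\langle x,y\mid yx=p\,xy\rangle$. For $\bar q=(q_1,\ldots,q_n)\in(\Bbbk\setminus\{0\})^n$, $\mathcal{O}_{\bar q}(\Bbbk^{2n})=\mathcal{O}_{q_1}(\Bbbk^2)\otimes_\Bbbk\cdots\otimes_\Bbbk\mathcal{O}_{q_n}(\Bbbk^2)$, i.e. the algebra with generators $x_1,\ldots,x_n,y_1,\ldots,y_n$ and relations $y_ix_j=q_i^{\delta_{ij}}x_jy_i$, $[x_i,x_j]=[y_i,y_j]=0$. Its skew field of fractions is $\mathcal{F}_{\bar q,n}$. When $q_1=\cdots=q_n=q$ write $\mathcal{O}_q(\Bbbk^{2n})$ and $\mathcal{F}_{q,n}$. Conventions for the groups: $W(A_n)$ denotes $S_n$; $W(B_n)=W(C_n)=S_n\ltimes(\mathbb{Z}/2\mathbb{Z})^n$;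 $W(D_n)=S_n\ltimes\mathcal{E}_n$ with $\mathcal{E}_n=\{\alpha\in(\mathbb{Z}/2\mathbb{Z})^n\mid\alpha_1+\cdots+\alpha_n=0\}$. These act on $\mathcal{O}_q(\Bbbk^{2n})$, hence on $\mathcal{F}_{q,n}$, by $\Bbbk$-algebra automorphisms: $\zeta(x_i)=x_{\zeta(i)}$, $\zeta(y_i)=y_{\zeta(i)}$ for $\zeta\in S_n$, and $\alpha(x_i)=(-1)^{\alpha_i}x_i$, $\alpha(y_i)=(-1)^{\alpha_i}y_i$ for $\alpha\in(\mathbb{Z}/2\mathbb{Z})^n$. $\mathcal{F}_{q,n}^{W_n}$ is the skew subfield of $W_n$-invariants. The $q$-difference Noether problem for $W_n$ asks whether there exist $q_1,\ldots,q_n\in\{q^k\mid k\in\mathbb{Z}\}$ such that $\mathcal{F}_{q,n}^{W_n}\simeq\mathcal{F}_{\bar q,n}$ as $\Bbbk$-algebras, with $\bar q=(q_1,\ldots,q_n)$. *)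

theory Defs
  imports
    "HOL-Combinatorics.Permutations"
    "HOL-Library.Poly_Mapping"
    "HOL-Library.Z2"
    "HOL-Library.FuncSet"
    "HOL-Algebra.QuotRing"
begin

text \<open>
  The ground field is a type \<open>'k\<close> of class \<open>field_char_0\<close>, and the indices \<open>1, ..., n\<close> are the
  elements of a finite linearly ordered type \<open>'n\<close> with \<open>n = CARD('n)\<close>; the order only serves to
  say which index is the first one.
\<close>

subsection \<open>Free algebras\<close>

text \<open>
  Free monoid, written additively so that \<open>'a word \<Rightarrow>\<^sub>0 'k\<close> with the convolution product of
  \<open>Poly_Mapping\<close> is the free associative \<open>'k\<close>-algebra on \<open>'a\<close>.
\<close>

datatype 'a word = Word (letters: "'a list")

instantiation word :: (type) monoid_add
begin

definition zero_word :: "'a word" where "0 = Word []"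

definition plus_word :: "'a word \<Rightarrow> 'a word \<Rightarrow> 'a word"
  where "u + v = Word (letters u @ letters v)"

instance by standard (auto simp: zero_word_def plus_word_def)

end

datatype 'n gen = GenX 'n | GenY 'n

type_synonym ('n, 'k) free_alg = "'n gen word \<Rightarrow>\<^sub>0 'k"

definition const :: "'k \<Rightarrow> ('n, 'k::field) free_alg"
  where "const c = Poly_Mapping.single 0 c"

definition X :: "'n \<Rightarrow> ('n, 'k::field) free_alg"
  where "X i = Poly_Mapping.single (Word [GenX i]) 1"

definition Y :: "'n \<Rightarrow> ('n, 'k::field) free_alg"
  where "Y i = Poly_Mapping.single (Word [GenY i]) 1"

definition type_ring :: "'a::ring_1 ring"
  where "type_ring = \<lparr>carrier = UNIV, mult = (*), one = 1, zero = 0, add = (+)\<rparr>"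

lemma ring_type_ring: "ring (type_ring :: 'a::ring_1 ring)"
proof (rule ringI)
  show "abelian_group (type_ring :: 'a ring)"
    by (rule abelian_groupI)
      (auto simp: type_ring_def add.assoc add.commute intro: exI[of _ "- x" for x] left_minus)
  show "Group.monoid (type_ring :: 'a ring)"
    by (rule monoidI) (auto simp: type_ring_def mult.assoc)
qed (auto simp: type_ring_def distrib_left distrib_right)


subsection \<open>The quantum affine spaces\<close>

definition qspace_relations :: "('n \<Rightarrow> 'k) \<Rightarrow> ('n, 'k::field) free_alg set"
  where "qspace_relations qs =
    {Y i * X j - const (if i = j then qs i else 1) * (X j * Y i) | i j. True}
    \<union> {X i * X j - X j * X i | i j. True}
    \<union> {Y i * Y j - Y j * Y i | i j. True}"

definition qspace_ideal :: "('n \<Rightarrow> 'k) \<Rightarrow> ('n, 'k::field) free_alg set"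
  where "qspace_ideal qs = Idl\<^bsub>type_ring\<^esub> (qspace_relations qs)"

definition qspace :: "('n \<Rightarrow> 'k) \<Rightarrow> ('n, 'k::field) free_alg set ring"
  where "qspace qs = type_ring Quot (qspace_ideal qs)"

definition qclass :: "('n \<Rightarrow> 'k) \<Rightarrow> ('n, 'k::field) free_alg \<Rightarrow> ('n, 'k) free_alg set"
  where "qclass qs a = qspace_ideal qs +>\<^bsub>type_ring\<^esub> a"


subsection \<open>Skew fields of fractions\<close>

text \<open>
  Every element is a right fraction \<open>a s\<inverse>\<close>. This determines the skew field \<open>'f\<close> together with
  the embedding \<open>\<iota>\<close> up to a unique isomorphism. When the ring is a \<open>'k\<close>-algebra, \<open>'f\<close> is regarded as
  a \<open>'k\<close>-algebra through \<open>\<iota>\<close>.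
\<close>

definition skew_field_of_fractions :: "('a, 'm) ring_scheme \<Rightarrow> ('a \<Rightarrow> 'f::division_ring) \<Rightarrow> bool"
  where "skew_field_of_fractions A \<iota> \<longleftrightarrow>
    \<iota> \<in> ring_hom A type_ring \<and> inj_on \<iota> (carrier A) \<and>
    (\<forall>f. \<exists>a\<in>carrier A. \<exists>s\<in>carrier A - {\<zero>\<^bsub>A\<^esub>}. f = \<iota> a * inverse (\<iota> s))"


subsection \<open>Classical Weyl groups and their action\<close>

datatype classical_type = Type_A | Type_B | Type_C | Type_D

text \<open>
  The pair \<open>(\<zeta>, \<alpha>)\<close> stands for the product \<open>\<zeta>\<alpha>\<close> in the semidirect product, in which
  \<open>\<alpha>\<tau> = \<tau>(\<alpha> \<circ> \<tau>)\<close>.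
\<close>

definition weyl_group :: "classical_type \<Rightarrow> (('n::finite \<Rightarrow> 'n) \<times> ('n \<Rightarrow> bit)) monoid"
  where "weyl_group T =
    \<lparr>carrier = {\<zeta>. \<zeta> permutes UNIV} \<times>
       (case T of
          Type_A \<Rightarrow> {\<lambda>_. 0}
        | Type_B \<Rightarrow> UNIV
        | Type_C \<Rightarrow> UNIV
        | Type_D \<Rightarrow> {\<alpha>. (\<Sum>i\<in>UNIV. \<alpha> i) = 0}),
     mult = (\<lambda>(\<zeta>, \<alpha>) (\<tau>, \<beta>). (\<zeta> \<circ> \<tau>, \<lambda>i. \<alpha> (\<tau> i) + \<beta> i)),
     one = (id, \<lambda>_. 0)\<rparr>"

lemma sum_permutes_UNIV:
  fixes \<alpha> :: "'n::finite \<Rightarrow> bit"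
  assumes "\<tau> permutes UNIV"
  shows "(\<Sum>i\<in>UNIV. \<alpha> (\<tau> i)) = (\<Sum>i\<in>UNIV. \<alpha> i)"
  using sum.permute[OF assms, of \<alpha>] by (simp add: comp_def)

lemma group_weyl_group: "group (weyl_group T :: (('n::finite \<Rightarrow> 'n) \<times> ('n \<Rightarrow> bit)) monoid)"
proof (rule groupI)
  fix w assume w: "w \<in> carrier (weyl_group T :: (('n \<Rightarrow> 'n) \<times> ('n \<Rightarrow> bit)) monoid)"
  obtain \<zeta> \<alpha> where [simp]: "w = (\<zeta>, \<alpha>)" by (cases w)
  have \<zeta>: "\<zeta> permutes UNIV" using w by (simp add: weyl_group_def)
  have "(inv_into UNIV \<zeta>, \<alpha> \<circ> inv_into UNIV \<zeta>) \<in> carrier (weyl_group T)"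
    using w permutes_inv[OF \<zeta>] sum_permutes_UNIV[OF permutes_inv[OF \<zeta>], of \<alpha>]
    by (auto simp: weyl_group_def comp_def split: classical_type.splits)
  moreover have "(inv_into UNIV \<zeta>, \<alpha> \<circ> inv_into UNIV \<zeta>) \<otimes>\<^bsub>weyl_group T\<^esub> w = \<one>\<^bsub>weyl_group T\<^esub>"
    using permutes_inv_o[OF \<zeta>] permutes_inverses[OF \<zeta>] by (auto simp: weyl_group_def)
  ultimately show "\<exists>v\<in>carrier (weyl_group T). v \<otimes>\<^bsub>weyl_group T\<^esub> w = \<one>\<^bsub>weyl_group T\<^esub>" by blast
next
  fix v w :: "('n \<Rightarrow> 'n) \<times> ('n \<Rightarrow> bit)"
  assume "v \<in> carrier (weyl_group T)" "w \<in> carrier (weyl_group T)"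
  moreover obtain \<zeta> \<alpha> \<tau> \<beta> where [simp]: "v = (\<zeta>, \<alpha>)" "w = (\<tau>, \<beta>)" by (cases v, cases w)
  ultimately have p: "\<zeta> permutes UNIV" "\<tau> permutes UNIV" and
    d: "T = Type_D \<Longrightarrow> sum \<alpha> UNIV = 0 \<and> sum \<beta> UNIV = 0" and
    a: "T = Type_A \<Longrightarrow> \<alpha> = (\<lambda>_. 0) \<and> \<beta> = (\<lambda>_. 0)"
    by (auto simp: weyl_group_def)
  have "(\<Sum>i\<in>UNIV. \<alpha> (\<tau> i) + \<beta> i) = sum \<alpha> UNIV + sum \<beta> UNIV"
    unfolding sum.distrib sum_permutes_UNIV[OF p(2)] ..
  with d have "T = Type_D \<Longrightarrow> (\<Sum>i\<in>UNIV. \<alpha> (\<tau> i) + \<beta> i) = 0"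
    by (metis add_0)
  with a permutes_compose[OF p(2,1)] show "v \<otimes>\<^bsub>weyl_group T\<^esub> w \<in> carrier (weyl_group T)"
    by (cases T) (simp_all add: weyl_group_def)
next
  show "\<one>\<^bsub>weyl_group T\<^esub> \<in> carrier (weyl_group T :: (('n \<Rightarrow> 'n) \<times> ('n \<Rightarrow> bit)) monoid)"
    by (cases T) (simp_all add: weyl_group_def permutes_id)
next
  fix u v w :: "('n \<Rightarrow> 'n) \<times> ('n \<Rightarrow> bit)"
  show "u \<otimes>\<^bsub>weyl_group T\<^esub> v \<otimes>\<^bsub>weyl_group T\<^esub> w = u \<otimes>\<^bsub>weyl_group T\<^esub> (v \<otimes>\<^bsub>weyl_group T\<^esub> w)"
    unfolding weyl_group_def monoid.simps
    by (cases u, cases v, cases w) (simp only: case_prod_conv comp_assoc comp_apply add.assoc)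
next
  fix w :: "('n \<Rightarrow> 'n) \<times> ('n \<Rightarrow> bit)"
  show "\<one>\<^bsub>weyl_group T\<^esub> \<otimes>\<^bsub>weyl_group T\<^esub> w = w"
    unfolding weyl_group_def monoid.simps by (cases w) (simp only: case_prod_conv id_comp add_0)
qed

definition weyl_sign :: "('n \<Rightarrow> bit) \<Rightarrow> 'n \<Rightarrow> 'k::field"
  where "weyl_sign \<alpha> i = (if \<alpha> i = 0 then 1 else - 1)"

definition weyl_qspace ::
    "'k \<Rightarrow> ('n \<Rightarrow> 'n) \<times> ('n \<Rightarrow> bit) \<Rightarrow> ('n, 'k::field) free_alg set \<Rightarrow> ('n, 'k) free_alg set"
  where "weyl_qspace q = (\<lambda>(\<zeta>, \<alpha>). let A = qspace (\<lambda>_. q); cl = qclass (\<lambda>_. q) in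
    THE f. f \<in> ring_iso A A \<and> f \<in> extensional (carrier A) \<and>
      (\<forall>c. f (cl (const c)) = cl (const c)) \<and>
      (\<forall>i. f (cl (X i)) = cl (const (weyl_sign \<alpha> i) * X (\<zeta> i))) \<and>
      (\<forall>i. f (cl (Y i)) = cl (const (weyl_sign \<alpha> i) * Y (\<zeta> i))))"

definition weyl_frac ::
    "'k \<Rightarrow> (('n, 'k::field) free_alg set \<Rightarrow> 'f::division_ring) \<Rightarrow> ('n \<Rightarrow> 'n) \<times> ('n \<Rightarrow> bit) \<Rightarrow> 'f \<Rightarrow> 'f"
  where "weyl_frac q \<iota> w =
    (THE g. g \<in> ring_iso type_ring type_ring \<and>
      (\<forall>a\<in>carrier (qspace (\<lambda>_. q)). g (\<iota> a) = \<iota> (weyl_qspace q w a)))"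

definition weyl_invariants ::
    "classical_type \<Rightarrow> 'k \<Rightarrow> (('n::finite, 'k::field) free_alg set \<Rightarrow> 'f::division_ring) \<Rightarrow> 'f ring"
  where "weyl_invariants T q \<iota> =
    type_ring\<lparr>carrier := {f. \<forall>w\<in>carrier (weyl_group T). weyl_frac q \<iota> w f = f}\<rparr>"


subsection \<open>The parameters of the solution\<close>

definition noether_params :: "classical_type \<Rightarrow> 'k \<Rightarrow> 'n::{finite, linorder} \<Rightarrow> 'k::field"
  where "noether_params T q i = (case T of
      Type_A \<Rightarrow> q
    | Type_B \<Rightarrow> q\<^sup>2
    | Type_C \<Rightarrow> q\<^sup>2
    | Type_D \<Rightarrow> if i = Min UNIV then q else q\<^sup>2)"

end

theory Submission
  imports Defs Complex_Main "HOL-Library.Cardinality"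
begin


section \<open>Products of commuting elements and right evaluation\<close>

definition cprod :: "('i \<Rightarrow> 'a::monoid_mult) \<Rightarrow> 'i set \<Rightarrow> 'a"
  where "cprod f A = Finite_Set.fold (\<lambda>i a. f i * a) 1 A"

definition commuting :: "('i \<Rightarrow> 'a::monoid_mult) \<Rightarrow> 'i set \<Rightarrow> bool"
  where "commuting f A \<longleftrightarrow> (\<forall>i\<in>A. \<forall>j\<in>A. f i * f j = f j * f i)"

lemma commuting_subset: "commuting f A \<Longrightarrow> B \<subseteq> A \<Longrightarrow> commuting f B"
  unfolding commuting_def by blast

lemma cprod_empty [simp]: "cprod f {} = 1"
  by (simp add: cprod_def)

lemma cprod_insert:
  assumes "commuting f (insert i A)" "finite A" "i \<notin> A"
  shows "cprod f (insert i A) = f i * cprod f A"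
proof -
  interpret comp_fun_commute_on "insert i A" "\<lambda>j a. f j * a"
    using assms(1) by unfold_locales (auto simp: commuting_def fun_eq_iff simp flip: mult.assoc)
  show ?thesis
    unfolding cprod_def using assms by (intro fold_insert) auto
qed

lemma cprod_remove:
  assumes "commuting f A" "finite A" "i \<in> A"
  shows "cprod f A = f i * cprod f (A - {i})"
  using cprod_insert[of f i "A - {i}"] assms by (simp add: insert_absorb)

lemma cprod_commute:
  assumes "commuting f A" "finite A" "\<And>i. i \<in> A \<Longrightarrow> f i * b = b * f i"
  shows "cprod f A * b = b * cprod f A"
  using assms(2,1,3)
proof (induction A rule: finite_induct)
  case (insert i A)
  have "cprod f A * b = b * cprod f A"
    using insert.IH insert.prems commuting_subset[OF insert.prems(1)] by blast
  moreover have "f i * b = b * f i" using insert.prems by blast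
  ultimately have "f i * cprod f A * b = b * (f i * cprod f A)"
    by (metis mult.assoc)
  then show ?case
    using insert by (simp add: cprod_insert)
qed simp

lemma cprod_cong:
  assumes "commuting f A" "finite A" "\<And>i. i \<in> A \<Longrightarrow> f i = g i"
  shows "cprod f A = cprod g A"
  using assms(2,1,3)
proof (induction A rule: finite_induct)
  case (insert i A)
  have "commuting g (insert i A)"
    using insert.prems unfolding commuting_def by metis
  with insert commuting_subset[of f "insert i A" A] show ?case
    by (simp add: cprod_insert subset_insertI)
qed simp

lemma cprod_mult:
  assumes "commuting f A" "commuting g A" "finite A"
    and "\<And>i j. i \<in> A \<Longrightarrow> j \<in> A \<Longrightarrow> f i * g j = g j * f i"
  shows "cprod (\<lambda>i. f i * g i) A = cprod f A * cprod g A"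
  using assms(3,1,2,4)
proof (induction A rule: finite_induct)
  case (insert i A)
  have c: "commuting (\<lambda>i. f i * g i) (insert i A)"
    unfolding commuting_def
  proof (intro ballI)
    fix j k assume jk: "j \<in> insert i A" "k \<in> insert i A"
    have c: "f j * f k = f k * f j" "g j * g k = g k * g j"
      using insert.prems(1,2) jk unfolding commuting_def by blast+
    have "f j * g j * (f k * g k) = f j * (g j * f k) * g k" by (simp add: mult.assoc)
    also have "\<dots> = (f j * f k) * (g j * g k)"
      using insert.prems(3)[OF jk(2,1)] by (metis mult.assoc)
    also have "\<dots> = f k * (f j * g k) * g j"
      unfolding c by (simp add: mult.assoc)
    also have "\<dots> = f k * g k * (f j * g j)"
      using insert.prems(3)[OF jk] by (metis mult.assoc)
    finally show "f j * g j * (f k * g k) = f k * g k * (f j * g j)" .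
  qed
  have IH: "cprod (\<lambda>i. f i * g i) A = cprod f A * cprod g A"
    using insert.IH insert.prems commuting_subset[of _ "insert i A" A] by blast
  have e: "cprod f A * g i = g i * cprod f A"
    by (rule cprod_commute[OF commuting_subset[OF insert.prems(1)] insert.hyps(1)])
       (use insert.prems(3) in blast)+
  have "cprod (\<lambda>i. f i * g i) (insert i A) = f i * (g i * cprod f A) * cprod g A"
    using insert.hyps by (simp add: cprod_insert[OF c] IH mult.assoc)
  also have "\<dots> = (f i * cprod f A) * (g i * cprod g A)"
    unfolding e[symmetric] by (simp add: mult.assoc)
  finally show ?case
    by (simp only: cprod_insert[OF insert.prems(1) insert.hyps] cprod_insert[OF insert.prems(2) insert.hyps])
qed simp

lemma cprod_hom:
  assumes "commuting f A" "finite A" "g 1 = 1" "\<And>a b. g (a * b) = g a * g b"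
  shows "g (cprod f A) = cprod (\<lambda>i. g (f i)) A"
  using assms(2,1)
proof (induction A rule: finite_induct)
  case (insert i A)
  have "commuting (\<lambda>i. g (f i)) (insert i A)"
    using insert.prems unfolding commuting_def assms(4)[symmetric] by metis
  with insert commuting_subset[of f "insert i A" A] show ?case
    by (simp add: cprod_insert assms subset_insertI)
qed (simp add: assms)

lemma cprod_reindex:
  assumes "commuting f (h ` A)" "finite A" "inj_on h A"
  shows "cprod f (h ` A) = cprod (\<lambda>i. f (h i)) A"
  using assms(2,1,3)
proof (induction A rule: finite_induct)
  case (insert i A)
  have "commuting (\<lambda>i. f (h i)) (insert i A)"
    using insert.prems(1) unfolding commuting_def by blast
  moreover have "commuting f (h ` A)"
    by (rule commuting_subset[OF insert.prems(1)]) auto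
  ultimately show ?case
    using insert by (simp add: cprod_insert)
qed simp

lemma cprod_nonzero:
  fixes f :: "'i \<Rightarrow> 'a::division_ring"
  assumes "commuting f A" "finite A" "\<And>i. i \<in> A \<Longrightarrow> f i \<noteq> 0"
  shows "cprod f A \<noteq> 0"
  using assms(2,1,3)
proof (induction A rule: finite_induct)
  case (insert i A)
  with commuting_subset[of f "insert i A" A] show ?case
    by (simp add: cprod_insert subset_insertI)
qed simp

lemma cprod_closed:
  assumes "commuting f A" "finite A" "\<And>i. i \<in> A \<Longrightarrow> f i \<in> S" "1 \<in> S"
    "\<And>a b. a \<in> S \<Longrightarrow> b \<in> S \<Longrightarrow> a * b \<in> S"
  shows "cprod f A \<in> S"
  using assms(2,1,3)
proof (induction A rule: finite_induct)
  case (insert i A)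
  with commuting_subset[of f "insert i A" A] show ?case
    by (simp add: cprod_insert subset_insertI assms)
qed (simp add: assms)

definition reval :: "nat \<Rightarrow> (nat \<Rightarrow> 'a::ring_1) \<Rightarrow> 'a \<Rightarrow> 'a"
  where "reval n f a = (\<Sum>i<n. f i * a ^ i)"

lemma reval_0 [simp]: "reval 0 f a = 0"
  by (simp add: reval_def)

lemma reval_Suc: "reval (Suc n) f a = reval n f a + f n * a ^ n"
  by (simp add: reval_def)

lemma reval_shift: "reval (Suc n) f a = f 0 + reval n (\<lambda>i. f (Suc i)) a * a"
proof -
  have "reval (Suc n) f a = f 0 + (\<Sum>i<n. f (Suc i) * a ^ Suc i)"
    unfolding reval_def by (subst sum.lessThan_Suc_shift) simp
  also have "(\<Sum>i<n. f (Suc i) * a ^ Suc i) = reval n (\<lambda>i. f (Suc i)) a * a"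
    by (simp add: reval_def sum_distrib_right mult.assoc power_Suc2 del: power_Suc)
  finally show ?thesis .
qed

lemma reval_at_0: "0 < n \<Longrightarrow> reval n f 0 = f 0"
  by (cases n) (simp_all add: reval_shift)

lemma reval_cong: "(\<And>i. i < n \<Longrightarrow> f i = g i) \<Longrightarrow> reval n f a = reval n g a"
  by (simp add: reval_def)

lemma reval_add: "reval n (\<lambda>i. f i + g i) a = reval n f a + reval n g a"
  by (simp add: reval_def distrib_right sum.distrib)

lemma reval_diff: "reval n (\<lambda>i. f i - g i) a = reval n f a - reval n g a"
  by (simp add: reval_def left_diff_distrib sum_subtractf)

lemma reval_mult_left: "reval n (\<lambda>i. b * f i) a = b * reval n f a"
  by (simp add: reval_def sum_distrib_left mult.assoc)

lemma reval_mult_right: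
  assumes "a * b = b * a"
  shows "reval n (\<lambda>i. f i * b) a = reval n f a * b"
proof -
  have "a ^ i * b = b * a ^ i" for i
    using power_commuting_commutes[of a b i] assms by simp
  then show ?thesis
    by (simp add: reval_def sum_distrib_right mult.assoc)
qed

lemma reval_zero_ext: "reval (Suc n) (\<lambda>i. if i < n then f i else 0) a = reval n f a"
  by (simp add: reval_def)

definition additive_subgroup :: "'a::ab_group_add set \<Rightarrow> bool"
  where "additive_subgroup V \<longleftrightarrow> 0 \<in> V \<and> (\<forall>a\<in>V. \<forall>b\<in>V. a + b \<in> V) \<and> (\<forall>a\<in>V. - a \<in> V)"

lemma additive_subgroup_sum:
  assumes "additive_subgroup V" "\<And>i. i \<in> A \<Longrightarrow> f i \<in> V"
  shows "sum f A \<in> V"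
  using assms(2)
  by (induction A rule: infinite_finite_induct) (use assms(1) in \<open>auto simp: additive_subgroup_def\<close>)

lemma additive_subgroup_diff: "additive_subgroup V \<Longrightarrow> a \<in> V \<Longrightarrow> b \<in> V \<Longrightarrow> a - b \<in> V"
  unfolding additive_subgroup_def by (metis add_uminus_conv_diff)

text \<open>
  Synthetic division: the quotient of a polynomial by \<open>w - a\<close>.
\<close>

definition divided_diff :: "nat \<Rightarrow> (nat \<Rightarrow> 'a::ring_1) \<Rightarrow> 'a \<Rightarrow> nat \<Rightarrow> 'a"
  where "divided_diff n f a j = (\<Sum>i\<in>{j<..<n}. f i * a ^ (i - Suc j))"

lemma divided_diff:
  assumes "a * b = b * a"
  shows "reval n f b - reval n f a = reval (n - 1) (divided_diff n f a) b * (b - a)"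
proof (induction n)
  case 0
  then show ?case by simp
next
  case (Suc n)
  have p: "a ^ i * b ^ j = b ^ j * a ^ i" for i j
  proof -
    have "b * a ^ i = a ^ i * b"
      using power_commuting_commutes[of a b i] assms by simp
    then show ?thesis
      using power_commuting_commutes[of b "a ^ i" j] by simp
  qed
  have pb: "a ^ i * b = b * a ^ i" for i using p[of i 1] by simp
  have geo: "b ^ n - a ^ n = (\<Sum>j<n. a ^ (n - Suc j) * b ^ j) * (b - a)" for n
  proof (induction n)
    case (Suc n)
    have "(\<Sum>j<Suc n. a ^ (Suc n - Suc j) * b ^ j) = a * (\<Sum>j<n. a ^ (n - Suc j) * b ^ j) + b ^ n"
      by (auto simp: sum_distrib_left Suc_diff_Suc simp flip: mult.assoc power_Suc intro!: sum.cong)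
    then have "(\<Sum>j<Suc n. a ^ (Suc n - Suc j) * b ^ j) * (b - a) = a * (b ^ n - a ^ n) + b ^ n * (b - a)"
      by (simp add: distrib_right mult.assoc Suc.IH)
    also have "\<dots> = b ^ Suc n - a ^ Suc n"
      using p[of 1 n] by (simp add: algebra_simps power_commutes)
    finally show ?case by simp
  qed simp
  have d: "divided_diff (Suc n) f a j = divided_diff n f a j + (if j < n then f n * a ^ (n - Suc j) else 0)" for j
  proof (cases "j < n")
    case True
    then have "{j<..<Suc n} = insert n {j<..<n}" by auto
    then show ?thesis using True by (simp add: divided_diff_def add.commute)
  next
    case False
    then have "{j<..<Suc n} = {}" "{j<..<n} = {}" by auto
    then show ?thesis using False by (simp add: divided_diff_def)
  qed
  have z: "divided_diff n f a j = 0" if "j \<ge> n - 1" for j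
  proof -
    have "{j<..<n} = {}" using that by auto
    then show ?thesis by (simp add: divided_diff_def)
  qed
  have "reval n (divided_diff (Suc n) f a) b
      = reval n (divided_diff n f a) b + f n * (\<Sum>j<n. a ^ (n - Suc j) * b ^ j)"
    by (simp add: reval_def d distrib_right sum.distrib sum_distrib_left mult.assoc)
  also have "reval n (divided_diff n f a) b = reval (n - 1) (divided_diff n f a) b"
  proof (cases n)
    case (Suc m)
    then show ?thesis using z[of m] by (simp add: reval_Suc)
  qed simp
  finally have "reval n (divided_diff (Suc n) f a) b * (b - a)
      = (reval n f b - reval n f a) + f n * (b ^ n - a ^ n)"
    by (simp add: distrib_right mult.assoc Suc.IH geo[of n])
  then show ?case
    by (simp add: reval_Suc algebra_simps)
qed

lemma divided_diff_top: "divided_diff (Suc (Suc n)) f a n = f (Suc n)"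
proof -
  have "{n<..<Suc (Suc n)} = {Suc n}" by auto
  then show ?thesis by (simp add: divided_diff_def)
qed

text \<open>A polynomial with \<open>n\<close> coefficients and \<open>n\<close> distinct commuting right roots vanishes.\<close>

lemma reval_eq_0:
  fixes f :: "nat \<Rightarrow> 'a::division_ring"
  assumes "finite A" "card A = n" "\<And>a b. a \<in> A \<Longrightarrow> b \<in> A \<Longrightarrow> a * b = b * a"
    and "\<And>a. a \<in> A \<Longrightarrow> reval n f a = 0" "i < n"
  shows "f i = 0"
  using assms
proof (induction n arbitrary: A f i)
  case 0
  then show ?case by simp
next
  case (Suc n)
  obtain a where a: "a \<in> A" using Suc.prems by (metis card.empty equals0I nat.distinct(1))
  have r: "reval n (divided_diff (Suc n) f a) b = 0" if "b \<in> A - {a}" for b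
  proof -
    have "reval n (divided_diff (Suc n) f a) b * (b - a) = 0"
      using divided_diff[of a b "Suc n" f] Suc.prems a that by simp
    then show ?thesis using that by simp
  qed
  have g: "divided_diff (Suc n) f a j = 0" if "j < n" for j
    using Suc.IH[of "A - {a}"] Suc.prems a r that by auto
  have s: "f (Suc j) = 0" if "j < n" for j
  proof -
    have "divided_diff (Suc n) f a j = f (Suc j) + divided_diff (Suc n) f a (Suc j) * a"
    proof -
      have "{j<..<Suc n} = insert (Suc j) {Suc j<..<Suc n}" using that by auto
      then have "divided_diff (Suc n) f a j = f (Suc j) + (\<Sum>i\<in>{Suc j<..<Suc n}. f i * a ^ (i - Suc j))"
        by (simp add: divided_diff_def)
      also have "(\<Sum>i\<in>{Suc j<..<Suc n}. f i * a ^ (i - Suc j)) = divided_diff (Suc n) f a (Suc j) * a"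
        unfolding divided_diff_def sum_distrib_right mult.assoc
        by (rule sum.cong) (auto simp: Suc_diff_Suc simp flip: power_Suc2)
      finally show ?thesis .
    qed
    moreover have "divided_diff (Suc n) f a (Suc j) = 0"
    proof (cases "Suc j < n")
      case False
      then have "{Suc j<..<Suc n} = {}" by auto
      then show ?thesis by (simp add: divided_diff_def)
    qed (rule g)
    ultimately show ?thesis using g[OF that] by simp
  qed
  have "f 0 = 0"
  proof -
    have "reval (Suc n) f a = f 0"
      by (subst reval_shift) (simp add: reval_def s)
    then show ?thesis using Suc.prems(4)[OF a] by simp
  qed
  then show ?case using s Suc.prems(5) by (cases i) auto
qed

text \<open>The monic polynomial with given commuting roots.\<close>

lemma cprod_linear_coeffs:
  fixes X :: "'i \<Rightarrow> 'a::ring_1"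
  assumes "commuting X A" "finite A"
  shows "\<exists>p. (\<forall>a. (\<forall>i\<in>A. a * X i = X i * a) \<longrightarrow>
      cprod (\<lambda>i. a - X i) A = a ^ card A + reval (card A) p a) \<and>
    (\<forall>S j. additive_subgroup S \<longrightarrow> 1 \<in> S \<longrightarrow> (\<forall>a\<in>S. \<forall>b\<in>S. a * b \<in> S) \<longrightarrow> X ` A \<subseteq> S \<longrightarrow> p j \<in> S)"
  using assms(2,1)
proof (induction A rule: finite_induct)
  case empty
  show ?case by (rule exI[of _ "\<lambda>_. 0"]) (auto simp: additive_subgroup_def)
next
  case (insert k A)
  define n where "n = card A"
  obtain p where p: "\<And>a. \<forall>i\<in>A. a * X i = X i * a \<Longrightarrow> cprod (\<lambda>i. a - X i) A = a ^ n + reval n p a"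
    and pS: "\<And>S j. additive_subgroup S \<Longrightarrow> 1 \<in> S \<Longrightarrow> \<forall>a\<in>S. \<forall>b\<in>S. a * b \<in> S \<Longrightarrow> X ` A \<subseteq> S \<Longrightarrow> p j \<in> S"
    using insert.IH commuting_subset[OF insert.prems] unfolding n_def by blast
  define p' where "p' j = (if j = 0 then 0 else if j \<le> n then (if j = n then 1 else 0) * 0 + p (j - 1) else 0)
      - (if j < n then X k * p j else if j = n then X k else 0)" for j
  have n1: "card (insert k A) = Suc n" using insert by (simp add: n_def)
  have comm: "commuting (\<lambda>i. a - X i) (insert k A)" if "\<forall>i\<in>insert k A. a * X i = X i * a" for a
    unfolding commuting_def
  proof (intro ballI)
    fix i j assume "i \<in> insert k A" "j \<in> insert k A"
    then have "X i * X j = X j * X i" "a * X i = X i * a" "a * X j = X j * a"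
      using insert.prems that unfolding commuting_def by blast+
    then show "(a - X i) * (a - X j) = (a - X j) * (a - X i)"
      by (simp add: algebra_simps)
  qed
  have "cprod (\<lambda>i. a - X i) (insert k A) = a ^ Suc n + reval (Suc n) p' a"
    if a: "\<forall>i\<in>insert k A. a * X i = X i * a" for a
  proof -
    have pc: "p j * a = a * p j" for j
    proof -
      have "p j \<in> {b. b * a = a * b}"
        by (rule pS) (use a in \<open>auto simp: additive_subgroup_def algebra_simps\<close>, metis mult.assoc)
      then show ?thesis by simp
    qed
    have r: "reval n p a * a = a * reval n p a"
      by (simp add: reval_def sum_distrib_left sum_distrib_right mult.assoc power_commutes)
         (simp add: pc flip: mult.assoc)
    have e1: "reval (Suc n) (\<lambda>j. (if j = 0 then 0 else if j \<le> n then p (j - 1) else 0)) a = reval n p a * a"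
      by (simp add: reval_shift) (simp add: reval_def)
    have e2: "reval (Suc n) (\<lambda>j. if j < n then X k * p j else if j = n then X k else 0) a = X k * (reval n p a + a ^ n)"
      by (simp add: reval_def sum_distrib_left distrib_left mult.assoc)
    have "reval (Suc n) p' a = reval n p a * a - X k * (reval n p a + a ^ n)"
      unfolding e1[symmetric] e2[symmetric] reval_diff[symmetric] by (rule reval_cong) (simp add: p'_def)
    then have "(a - X k) * (a ^ n + reval n p a) = a ^ Suc n + reval (Suc n) p' a"
      by (simp add: algebra_simps r)
    then show ?thesis
      using insert.hyps p[of a] a by (subst cprod_insert[OF comm[OF a]]) auto
  qed
  moreover have "p' j \<in> S"
    if S: "additive_subgroup S" "1 \<in> S" "\<forall>a\<in>S. \<forall>b\<in>S. a * b \<in> S" "X ` insert k A \<subseteq> S" for S j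
  proof -
    have "p i \<in> S" for i using pS[of S i] S by auto
    moreover have "0 \<in> S" using S by (simp add: additive_subgroup_def)
    ultimately show ?thesis
      unfolding p'_def using S by (intro additive_subgroup_diff) auto
  qed
  ultimately show ?case unfolding n1 by blast
qed


section \<open>Algebras over a central field\<close>

locale kalgebra =
  fixes \<kappa> :: "'k::field \<Rightarrow> 'a::ring_1"
  assumes \<kappa>_add: "\<kappa> (c + d) = \<kappa> c + \<kappa> d"
    and \<kappa>_mult: "\<kappa> (c * d) = \<kappa> c * \<kappa> d"
    and \<kappa>_1 [simp]: "\<kappa> 1 = 1"
    and \<kappa>_central: "\<kappa> c * a = a * \<kappa> c"
begin

lemma \<kappa>_0 [simp]: "\<kappa> 0 = 0"
  using \<kappa>_add[of 0 0] by simp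

lemma \<kappa>_minus: "\<kappa> (- c) = - \<kappa> c"
  using \<kappa>_add[of c "- c"] by (simp add: eq_neg_iff_add_eq_0 add.commute)

lemma \<kappa>_diff: "\<kappa> (c - d) = \<kappa> c - \<kappa> d"
  using \<kappa>_add[of c "- d"] by (simp add: \<kappa>_minus)

lemma \<kappa>_power: "\<kappa> (c ^ n) = \<kappa> c ^ n"
  by (induction n) (simp_all add: \<kappa>_mult)

definition scale :: "'k \<Rightarrow> 'a \<Rightarrow> 'a" (infixr "\<odot>" 75)
  where "c \<odot> a = \<kappa> c * a"

sublocale module "(\<odot>)"
  by unfold_locales (simp_all add: scale_def distrib_left distrib_right \<kappa>_add \<kappa>_mult mult.assoc)

lemma mult_\<kappa>_right: "a * \<kappa> c = c \<odot> a"
  by (simp only: scale_def \<kappa>_central[of c a])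

lemma mult_scale_left: "(c \<odot> a) * b = c \<odot> (a * b)"
  by (simp add: scale_def mult.assoc)

lemma mult_scale_right: "a * (c \<odot> b) = c \<odot> (a * b)"
  by (metis scale_def \<kappa>_central mult.assoc)

lemmas scale_algebra = mult_scale_left mult_scale_right scale_left_distrib scale_right_distrib
  scale_left_diff_distrib scale_right_diff_distrib

definition subalg :: "'a set \<Rightarrow> bool"
  where "subalg B \<longleftrightarrow> range \<kappa> \<subseteq> B \<and> (\<forall>a\<in>B. \<forall>b\<in>B. a + b \<in> B \<and> a - b \<in> B \<and> a * b \<in> B)"

lemma subalgD:
  assumes "subalg B"
  shows "\<kappa> c \<in> B" "a \<in> B \<Longrightarrow> b \<in> B \<Longrightarrow> a + b \<in> B" "a \<in> B \<Longrightarrow> b \<in> B \<Longrightarrow> a - b \<in> B"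
    "a \<in> B \<Longrightarrow> b \<in> B \<Longrightarrow> a * b \<in> B" "a \<in> B \<Longrightarrow> c \<odot> a \<in> B" "1 \<in> B" "0 \<in> B" "a \<in> B \<Longrightarrow> - a \<in> B"
    "a \<in> B \<Longrightarrow> a ^ n \<in> B"
proof -
  show *: "\<kappa> c \<in> B" "a \<in> B \<Longrightarrow> b \<in> B \<Longrightarrow> a + b \<in> B" "a \<in> B \<Longrightarrow> b \<in> B \<Longrightarrow> a - b \<in> B"
    "a \<in> B \<Longrightarrow> b \<in> B \<Longrightarrow> a * b \<in> B" for a b c
    using assms by (auto simp: subalg_def)
  show "a \<in> B \<Longrightarrow> c \<odot> a \<in> B" using * by (simp add: scale_def)
  show 1: "1 \<in> B" using *(1)[of 1] by simp
  show "0 \<in> B" using *(1)[of 0] by simp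
  then show "a \<in> B \<Longrightarrow> - a \<in> B" using *(3)[of 0 a] by simp
  show "a \<in> B \<Longrightarrow> a ^ n \<in> B" by (induction n) (simp_all add: 1 *)
qed

lemma subalg_additive: "subalg B \<Longrightarrow> additive_subgroup B"
  using subalgD by (simp add: additive_subgroup_def)

end

locale skew_kalgebra = kalgebra \<kappa>
  for \<kappa> :: "'k::field_char_0 \<Rightarrow> 'f::division_ring"
begin

lemma \<kappa>_eq_0_iff [simp]: "\<kappa> c = 0 \<longleftrightarrow> c = 0"
proof
  assume "\<kappa> c = 0"
  then have "c \<noteq> 0 \<Longrightarrow> \<kappa> (c * inverse c) = 0" by (simp add: \<kappa>_mult del: right_inverse)
  then show "c = 0" by auto
qed simp

lemma scale_eq_0 [simp]: "c \<odot> a = 0 \<longleftrightarrow> c = 0 \<or> a = 0"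
  by (simp add: scale_def)

sublocale vector_space "(\<odot>)"
  by unfold_locales (simp_all add: scale_algebra)

definition divsub :: "'f set \<Rightarrow> bool"
  where "divsub D \<longleftrightarrow> subalg D \<and> (\<forall>a\<in>D. inverse a \<in> D)"

lemma divsubD:
  assumes "divsub D"
  shows "subalg D" "a \<in> D \<Longrightarrow> inverse a \<in> D"
  using assms by (auto simp: divsub_def)

lemma inverse_commutes:
  fixes a b :: 'f
  assumes "a * b = b * a"
  shows "inverse a * b = b * inverse a"
proof (cases "a = 0")
  case False
  have "inverse a * b = inverse a * (b * a) * inverse a"
    using False by (simp add: mult.assoc)
  also have "\<dots> = b * inverse a"
    using False by (simp flip: assms mult.assoc)
  finally show ?thesis .
qed simp

lemma divsub_centralizer: "divsub {a. \<forall>g\<in>G. g * a = a * g}"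
proof -
  have m: "g * (a * b) = (a * b) * g" if "g * a = a * g" "g * b = b * g" for a b g :: 'f
    using that by (metis mult.assoc)
  show ?thesis
    unfolding divsub_def subalg_def
    by (auto simp: \<kappa>_central[symmetric] algebra_simps m intro!: inverse_commutes[symmetric])
qed

subsection \<open>Polynomial functions of a central variable\<close>

definition lead :: "nat \<Rightarrow> 'f \<Rightarrow> ('k \<Rightarrow> 'f) \<Rightarrow> bool"
  where "lead n a f \<longleftrightarrow> (\<exists>g. \<forall>z. f z = z ^ n \<odot> a + reval n g (\<kappa> z))"

lemma leadI: "(\<And>z. f z = z ^ n \<odot> a + reval n g (\<kappa> z)) \<Longrightarrow> lead n a f"
  unfolding lead_def by blast

lemma scale_power_eq: "z ^ n \<odot> a = a * \<kappa> z ^ n"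
  by (simp add: \<kappa>_power[symmetric] mult_\<kappa>_right)

lemma lead_iff: "lead n a f \<longleftrightarrow> (\<exists>g. g n = a \<and> f = (\<lambda>z. reval (Suc n) g (\<kappa> z)))"
proof
  assume "lead n a f"
  then obtain g where g: "\<And>z. f z = z ^ n \<odot> a + reval n g (\<kappa> z)" unfolding lead_def by blast
  have "reval n (g(n := a)) x = reval n g x" for x by (rule reval_cong) simp
  then have "(g(n := a)) n = a \<and> f = (\<lambda>z. reval (Suc n) (g(n := a)) (\<kappa> z))"
    by (auto simp: reval_Suc g fun_eq_iff scale_power_eq)
  then show "\<exists>g. g n = a \<and> f = (\<lambda>z. reval (Suc n) g (\<kappa> z))" by blast
next
  assume "\<exists>g. g n = a \<and> f = (\<lambda>z. reval (Suc n) g (\<kappa> z))"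
  then show "lead n a f" unfolding lead_def by (auto simp: reval_Suc scale_power_eq)
qed

lemma lead_const: "lead 0 a (\<lambda>_. a)"
  by (auto simp: lead_def)

lemma lead_monic: "lead n 1 (\<lambda>z. \<kappa> z ^ n + reval n p (\<kappa> z))"
  by (auto simp: lead_def scale_power_eq)

lemma lead_reval: "lead n (f n) (\<lambda>z. reval (Suc n) f (\<kappa> z))"
  by (auto simp: lead_iff)

lemma leadE:
  assumes "lead n a f"
  obtains g where "f = (\<lambda>z. reval (Suc n) g (\<kappa> z))" "g n = a"
  using assms unfolding lead_iff by blast

lemma lead_add:
  assumes "lead n a f" "lead n b g"
  shows "lead n (a + b) (\<lambda>z. f z + g z)"
proof -
  obtain F where F: "f = (\<lambda>z. reval (Suc n) F (\<kappa> z))" "F n = a" using leadE[OF assms(1)] .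
  obtain G where G: "g = (\<lambda>z. reval (Suc n) G (\<kappa> z))" "G n = b" using leadE[OF assms(2)] .
  show ?thesis using lead_reval[of n "\<lambda>i. F i + G i"] by (simp add: reval_add F G)
qed

lemma lead_mult_left:
  assumes "lead n a f"
  shows "lead n (b * a) (\<lambda>z. b * f z)"
proof -
  obtain F where F: "f = (\<lambda>z. reval (Suc n) F (\<kappa> z))" "F n = a" using leadE[OF assms] .
  show ?thesis using lead_reval[of n "\<lambda>i. b * F i"] by (simp add: reval_mult_left F)
qed

lemma lead_diff:
  assumes "lead n a f" "lead n b g"
  shows "lead n (a - b) (\<lambda>z. f z - g z)"
  using lead_add[OF assms(1) lead_mult_left[OF assms(2), of "-1"]] by simp

lemma lead_scale: "lead n a f \<Longrightarrow> lead n (c \<odot> a) (\<lambda>z. c \<odot> f z)"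
  unfolding scale_def by (rule lead_mult_left)

lemma lead_mult_right:
  assumes "lead n a f"
  shows "lead n (a * b) (\<lambda>z. f z * b)"
proof -
  obtain F where F: "f = (\<lambda>z. reval (Suc n) F (\<kappa> z))" "F n = a" using leadE[OF assms] .
  show ?thesis using lead_reval[of n "\<lambda>i. F i * b"] by (simp add: reval_mult_right[OF \<kappa>_central] F)
qed

lemma lead_Suc:
  assumes "lead n a f"
  shows "lead (Suc n) 0 f"
proof -
  obtain F where F: "f = (\<lambda>z. reval (Suc n) F (\<kappa> z))" "F n = a" using leadE[OF assms] .
  show ?thesis using lead_reval[of "Suc n" "\<lambda>i. if i < Suc n then F i else 0"]
    unfolding reval_zero_ext F by simp
qed

lemma lead_times: 
  assumes "lead n a f" 
  shows "lead (Suc n) a (\<lambda>z. z \<odot> f z)"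
proof -
  obtain g where g: "g n = a" "f = (\<lambda>z. reval (Suc n) g (\<kappa> z))" using assms unfolding lead_iff by blast
  have "z \<odot> f z = reval (Suc (Suc n)) (case_nat 0 g) (\<kappa> z)" for z
    by (subst reval_shift) (simp add: g mult_\<kappa>_right)
  then show ?thesis unfolding lead_iff using g by (intro exI[of _ "case_nat 0 g"]) (auto simp: fun_eq_iff)
qed

text \<open>
  The values of a polynomial function at all but finitely many central points determine its
  coefficients \<open>k\<close>-linearly.
\<close>

lemma lead_mem:
  assumes "subspace V" "finite E" "lead n a f" "\<And>z. z \<notin> E \<Longrightarrow> f z \<in> V"
  shows "a \<in> V"
  using assms(2-)
proof (induction n arbitrary: f a E)
  case 0
  obtain z where "z \<notin> E" using ex_new_if_finite[OF infinite_UNIV_char_0 0(1)] by blast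
  with 0 show ?case by (auto simp: lead_def)
next
  case (Suc n)
  obtain b where b: "b \<notin> E" using ex_new_if_finite[OF infinite_UNIV_char_0 Suc.prems(1)] by blast
  obtain g where g: "g (Suc n) = a" "f = (\<lambda>z. reval (Suc (Suc n)) g (\<kappa> z))"
    using Suc.prems(2) unfolding lead_iff by blast
  let ?h = "\<lambda>z. reval (Suc n) (divided_diff (Suc (Suc n)) g (\<kappa> b)) (\<kappa> z)"
  have "lead n a ?h"
    using lead_reval[of n "divided_diff (Suc (Suc n)) g (\<kappa> b)"] by (simp add: divided_diff_top g)
  moreover have "?h z \<in> V" if "z \<notin> insert b E" for z
  proof -
    have "f z - f b = ?h z * \<kappa> (z - b)"
      using divided_diff[OF \<kappa>_central[of b "\<kappa> z"], of "Suc (Suc n)" g] by (simp add: g \<kappa>_diff)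
    also have "\<dots> = (z - b) \<odot> ?h z" by (rule mult_\<kappa>_right)
    finally have "?h z = inverse (z - b) \<odot> (f z - f b)" using that by simp
    also have "\<dots> \<in> V" using Suc.prems(3) b that assms(1) by (intro subspace_scale subspace_diff) auto
    finally show ?thesis .
  qed
  ultimately show ?case using Suc.IH[of "insert b E" a ?h] Suc.prems(1) by blast
qed

lemma lead_unique:
  assumes "lead n a f" "lead n b f"
  shows "a = b"
  using lead_mem[OF subspace_single_0 finite.emptyI lead_diff[OF assms]] by simp

lemma coeff_mem:
  assumes "subspace V" "finite E" "\<And>z. z \<notin> E \<Longrightarrow> reval n f (\<kappa> z) \<in> V" "i < n"
  shows "f i \<in> V"
  using assms(3,4)
proof (induction n)
  case (Suc n)
  have "f n \<in> V" using lead_mem[OF assms(1,2) lead_reval] Suc.prems(1) by blast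
  moreover have "reval n f (\<kappa> z) \<in> V" if "z \<notin> E" for z
  proof -
    have "reval n f (\<kappa> z) = reval (Suc n) f (\<kappa> z) - z ^ n \<odot> f n"
      by (simp add: reval_Suc scale_power_eq)
    also have "\<dots> \<in> V" using Suc.prems(1)[OF that] \<open>f n \<in> V\<close> assms(1)
      by (intro subspace_scale subspace_diff)
    finally show ?thesis .
  qed
  ultimately show ?case using Suc by (metis less_antisym)
qed simp

lemma reval_mem: 
  assumes "subspace V" "\<And>i. i < n \<Longrightarrow> f i \<in> V"
  shows "reval n f (\<kappa> z) \<in> V"
  unfolding reval_def using assms by (auto intro!: subspace_sum subspace_scale simp flip: scale_power_eq)

lemma subspace_subalg: "subalg B \<Longrightarrow> subspace B"
  using subalgD by (auto simp: subspace_def)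

inductive_set lmod :: "('k \<Rightarrow> 'f) set \<Rightarrow> ('k \<Rightarrow> 'f) set" for G where
  gen: "f \<in> G \<Longrightarrow> f \<in> lmod G"
| add: "f \<in> lmod G \<Longrightarrow> g \<in> lmod G \<Longrightarrow> (\<lambda>z. f z + g z) \<in> lmod G"
| mult: "f \<in> lmod G \<Longrightarrow> (\<lambda>z. a * f z) \<in> lmod G"
| times: "f \<in> lmod G \<Longrightarrow> (\<lambda>z. z \<odot> f z) \<in> lmod G"

lemma lmod_trans:
  assumes "f \<in> lmod G" "G \<subseteq> lmod H"
  shows "f \<in> lmod H"
  using assms(1) by induction (use assms(2) in \<open>auto intro: lmod.intros\<close>)

lemma lmod_monic_proper:
  assumes P: "lead m 1 P" "m > 0" and f: "f \<in> lmod {P, \<lambda>_. 0}"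
  shows "f \<noteq> (\<lambda>_. 1)"
proof
  assume f1: "f = (\<lambda>_. 1)"
  have "\<exists>n a. f = (\<lambda>z. reval n a (\<kappa> z) * P z)" using f
  proof induction
    case (gen f)
    then consider "f = P" | "f = (\<lambda>_. 0)" by blast
    then show ?case
    proof cases
      case 1
      have "f = (\<lambda>z. reval (Suc 0) (\<lambda>_. 1) (\<kappa> z) * P z)" by (simp add: 1 reval_def)
      then show ?thesis by blast
    next
      case 2
      have "f = (\<lambda>z. reval 0 (\<lambda>_. 1) (\<kappa> z) * P z)" by (simp add: 2)
      then show ?thesis by blast
    qed
  next
    case (add f g)
    then obtain n a m b where ab: "f = (\<lambda>z. reval n a (\<kappa> z) * P z)" "g = (\<lambda>z. reval m b (\<kappa> z) * P z)"
      by blast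
    have pad: "reval n a x = reval (n + k) (\<lambda>i. if i < n then a i else 0) x" for n a k and x :: 'f
      by (induction k) (simp_all add: reval_Suc, simp add: reval_def)
    have "f z + g z = reval (n + m) (\<lambda>i. (if i < n then a i else 0) + (if i < m then b i else 0)) (\<kappa> z) * P z" for z
      by (simp add: ab reval_add distrib_right pad[of n a _ m] pad[of m b _ n] add.commute[of m n])
    then show ?case by (blast intro: ext)
  next
    case (mult f a)
    then obtain n b where "f = (\<lambda>z. reval n b (\<kappa> z) * P z)" by blast
    then have "(\<lambda>z. a * f z) = (\<lambda>z. reval n (\<lambda>i. a * b i) (\<kappa> z) * P z)" 
      by (simp add: reval_mult_left mult.assoc)
    then show ?case by blast
  next
    case (times f)
    then obtain n b where b: "f = (\<lambda>z. reval n b (\<kappa> z) * P z)" by blast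
    have "(\<lambda>z. z \<odot> f z) = (\<lambda>z. reval (Suc n) (case_nat 0 b) (\<kappa> z) * P z)" 
      by (subst reval_shift) (simp add: b mult_\<kappa>_right mult_scale_left)
    then show ?case by blast
  qed
  then obtain n a where a: "\<And>z. reval n a (\<kappa> z) * P z = 1" using f1 by metis
  have up: "lead (k + j) (if j = 0 then b else 0) g" if "lead k b g" for k b g j
    by (induction j) (use that in \<open>auto dest: lead_Suc\<close>)
  have "lead (n + m) (a n) (\<lambda>z. reval (Suc n) a (\<kappa> z) * P z)" for n
  proof (induction n)
    case 0
    have "(\<lambda>z. reval (Suc 0) a (\<kappa> z) * P z) = (\<lambda>z. a 0 * P z)" by (simp add: reval_def)
    moreover have "lead m (a 0) (\<lambda>z. a 0 * P z)" using lead_mult_left[OF P(1), of "a 0"] by simp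
    ultimately show ?case by (simp only: add_0)
  next
    case (Suc n)
    have t: "lead (k + m) b (\<lambda>z. z ^ k \<odot> (b * P z))" for k b
    proof (induction k)
      case 0 then show ?case using lead_mult_left[OF P(1), of b] by simp
    next
      case (Suc k) from lead_times[OF this] show ?case by simp
    qed
    have "(\<lambda>z. reval (Suc (Suc n)) a (\<kappa> z) * P z) 
        = (\<lambda>z. reval (Suc n) a (\<kappa> z) * P z + z ^ Suc n \<odot> (a (Suc n) * P z))"
      by (simp add: reval_Suc[of "Suc n"] distrib_right mult_scale_left[symmetric] scale_power_eq del: power_Suc)
    moreover have "lead (Suc n + m) 0 (\<lambda>z. reval (Suc n) a (\<kappa> z) * P z)"
      using lead_Suc[OF Suc] by simp
    ultimately show ?case using lead_add[OF _ t[of "Suc n" "a (Suc n)"], of 0] by (simp only: add_0)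
  qed
  note l = this
  from a show False
  proof (induction n)
    case (Suc n)
    have "lead (n + m) (a n) (\<lambda>_. 1)" using l[of n] Suc.prems by simp
    moreover have "lead (n + m) 0 (\<lambda>_. 1)" using up[OF lead_const, of "n + m" 1] P(2) by simp
    ultimately have "a n = 0" by (rule lead_unique)
    then have "reval n a (\<kappa> z) * P z = 1" for z using Suc.prems[of z] by (simp add: reval_Suc)
    then show ?case by (rule Suc.IH)
  qed simp
qed

end


section \<open>Peeling off one quantum plane\<close>

context skew_kalgebra
begin

lemma lead_0: "lead n 0 (\<lambda>_. 0)"
  by (rule leadI[of _ _ _ "\<lambda>_. 0"]) (simp add: reval_def)

lemma commutes_with_quotient:
  fixes a b :: 'f
  assumes "a * b = b * a"
  shows "a * (inverse a * b) = inverse a * b * a"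
proof (cases "a = 0")
  case False
  have "inverse a * b * a = inverse a * (a * b)" by (simp add: assms mult.assoc)
  also have "\<dots> = a * (inverse a * b)" using False by (simp flip: mult.assoc)
  finally show ?thesis by simp
qed simp

lemma exchange_reduce:
  assumes "h \<noteq> 0"
    and R: "(q * (w - z)) \<odot> (Pw * (h * Dz)) = (q * w - z) \<odot> (h * Dz * Pw) - ((q - 1) * w) \<odot> (h * Dw * Pz)"
    and star: "q \<odot> (Pw * h) = h * Pw + ((q - 1) * w) \<odot> (h * Dw)"
    and comm: "Dw * Dz = Dz * Dw"
    and P: "Pw = w \<odot> Dw + Sw" "Pz = z \<odot> Dz + Sz"
  shows "(w - z) \<odot> (Sw * Dz) = (q * w - z) \<odot> (Dz * Sw) - ((q - 1) * w) \<odot> (Dw * Sz)"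
proof -
  have "(q * (w - z)) \<odot> (Pw * (h * Dz)) = (w - z) \<odot> ((q \<odot> (Pw * h)) * Dz)"
    by (simp add: scale_algebra mult.assoc mult.commute)
  also have "\<dots> = h * ((w - z) \<odot> (Pw * Dz) + ((w - z) * ((q - 1) * w)) \<odot> (Dw * Dz))"
    by (simp only: star scale_algebra distrib_left distrib_right right_diff_distrib mult.assoc scale_scale)
  finally have "h * ((w - z) \<odot> (Pw * Dz) + ((w - z) * ((q - 1) * w)) \<odot> (Dw * Dz))
      = h * ((q * w - z) \<odot> (Dz * Pw) - ((q - 1) * w) \<odot> (Dw * Pz))"
    unfolding R by (simp only: scale_algebra right_diff_distrib mult.assoc)
  then have "(w - z) \<odot> (Pw * Dz) + ((w - z) * ((q - 1) * w)) \<odot> (Dw * Dz)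
      = (q * w - z) \<odot> (Dz * Pw) - ((q - 1) * w) \<odot> (Dw * Pz)"
    using \<open>h \<noteq> 0\<close> by simp
  moreover have "(w - z) \<odot> (Pw * Dz) + ((w - z) * ((q - 1) * w)) \<odot> (Dw * Dz)
      - ((q * w - z) \<odot> (Dz * Pw) - ((q - 1) * w) \<odot> (Dw * Pz))
      = (w - z) \<odot> (Sw * Dz) - ((q * w - z) \<odot> (Dz * Sw) - ((q - 1) * w) \<odot> (Dw * Sz))"
    by (simp add: P scale_algebra algebra_simps comm)
  ultimately show ?thesis by simp
qed

lemma commute_reduce:
  assumes "w \<noteq> z"
    and Rwz: "(w - z) \<odot> (Sw * Dz) = (q * w - z) \<odot> (Dz * Sw) - ((q - 1) * w) \<odot> (Dw * Sz)"
    and Rzw: "(z - w) \<odot> (Sz * Dw) = (q * z - w) \<odot> (Dw * Sz) - ((q - 1) * z) \<odot> (Dz * Sw)"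
    and comm: "Dw * Dz = Dz * Dw" "(w \<odot> Dw + Sw) * (z \<odot> Dz + Sz) = (z \<odot> Dz + Sz) * (w \<odot> Dw + Sw)"
  shows "Sw * Sz = Sz * Sw"
proof -
  have "(w - z) \<odot> (Sw * Sz - Sz * Sw)
    = (w - z) \<odot> ((w \<odot> Dw + Sw) * (z \<odot> Dz + Sz) - (z \<odot> Dz + Sz) * (w \<odot> Dw + Sw))
      - z \<odot> ((w - z) \<odot> (Sw * Dz) - ((q * w - z) \<odot> (Dz * Sw) - ((q - 1) * w) \<odot> (Dw * Sz)))
      - w \<odot> ((z - w) \<odot> (Sz * Dw) - ((q * z - w) \<odot> (Dw * Sz) - ((q - 1) * z) \<odot> (Dz * Sw)))"
    by (simp add: scale_algebra algebra_simps comm(1))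
  also have "\<dots> = 0" by (simp only: Rwz Rzw comm(2)) simp
  finally show ?thesis using \<open>w \<noteq> z\<close> by simp
qed

text \<open>
  With \<open>S = s D + T\<close> the pair \<open>(D, S)\<close> satisfies the exchange relation without the factor \<open>q\<close>
  exactly when \<open>(D, T)\<close> satisfies it with the factor: eliminate \<open>D(z) T(w)\<close> between the
  relation and its mirror image.
\<close>

lemma exchange_restore:
  assumes "w \<noteq> z" "q \<noteq> 0"
    and Rwz: "(w - z) \<odot> (Sw * Dz) = (q * w - z) \<odot> (Dz * Sw) - ((q - 1) * w) \<odot> (Dw * Sz)"
    and Rzw: "(z - w) \<odot> (Sz * Dw) = (q * z - w) \<odot> (Dw * Sz) - ((q - 1) * z) \<odot> (Dz * Sw)"
    and Ds: "q \<odot> (Dz * s) = q \<odot> (s * Dz) + (q - 1) \<odot> Tz" "q \<odot> (Dw * s) = q \<odot> (s * Dw) + (q - 1) \<odot> Tw"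
    and comm: "Dw * Dz = Dz * Dw"
    and S: "Sw = s * Dw + Tw" "Sz = s * Dz + Tz"
  shows "(q * (w - z)) \<odot> (Dw * Tz) = (q * w - z) \<odot> (Tz * Dw) - ((q - 1) * w) \<odot> (Tw * Dz)"
proof -
  define a b c d m where "a = Tw * Dz" and "b = Tz * Dw" and "c = Dz * Tw" and "d = Dw * Tz"
    and "m = s * (Dw * Dz)"
  have 1: "q \<odot> (Dz * (s * Dw)) = q \<odot> m + (q - 1) \<odot> b"
  proof -
    have "q \<odot> (Dz * (s * Dw)) = (q \<odot> (Dz * s)) * Dw" by (simp add: scale_algebra mult.assoc)
    then show ?thesis by (simp add: Ds scale_algebra m_def b_def mult.assoc distrib_right left_diff_distrib comm)
  qed
  have 2: "q \<odot> (Dw * (s * Dz)) = q \<odot> m + (q - 1) \<odot> a"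
  proof -
    have "q \<odot> (Dw * (s * Dz)) = (q \<odot> (Dw * s)) * Dz" by (simp add: scale_algebra mult.assoc)
    then show ?thesis by (simp add: Ds scale_algebra m_def a_def mult.assoc distrib_right left_diff_distrib)
  qed
  have "q \<odot> ((w - z) \<odot> (Sw * Dz)) = (q * (w - z)) \<odot> (m + a)"
    by (simp add: S m_def a_def distrib_right mult.assoc)
  moreover have "q \<odot> ((q * w - z) \<odot> (Dz * Sw) - ((q - 1) * w) \<odot> (Dw * Sz))
      = (q * w - z) \<odot> (q \<odot> (Dz * (s * Dw)) + q \<odot> c) - ((q - 1) * w) \<odot> (q \<odot> (Dw * (s * Dz)) + q \<odot> d)"
    by (simp add: S c_def d_def scale_algebra algebra_simps)
  ultimately have E: "(q * (w - z)) \<odot> (m + a) - ((q * w - z) \<odot> (q \<odot> m + (q - 1) \<odot> b + q \<odot> c)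
      - ((q - 1) * w) \<odot> (q \<odot> m + (q - 1) \<odot> a + q \<odot> d)) = 0"
    unfolding Rwz 1 2 by simp
  have "q \<odot> ((z - w) \<odot> (Sz * Dw)) = (q * (z - w)) \<odot> (m + b)"
    by (simp add: S m_def b_def distrib_right mult.assoc comm)
  moreover have "q \<odot> ((q * z - w) \<odot> (Dw * Sz) - ((q - 1) * z) \<odot> (Dz * Sw))
      = (q * z - w) \<odot> (q \<odot> (Dw * (s * Dz)) + q \<odot> d) - ((q - 1) * z) \<odot> (q \<odot> (Dz * (s * Dw)) + q \<odot> c)"
    by (simp add: S c_def d_def scale_algebra algebra_simps)
  ultimately have E': "(q * (z - w)) \<odot> (m + b) - ((q * z - w) \<odot> (q \<odot> m + (q - 1) \<odot> a + q \<odot> d)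
      - ((q - 1) * z) \<odot> (q \<odot> m + (q - 1) \<odot> b + q \<odot> c)) = 0"
    unfolding Rzw 1 2 by simp
  have "(q * (w - z)) \<odot> ((q * (w - z)) \<odot> d - ((q * w - z) \<odot> b - ((q - 1) * w) \<odot> a))
    = (q * w - z) \<odot> ((q * (z - w)) \<odot> (m + b) - ((q * z - w) \<odot> (q \<odot> m + (q - 1) \<odot> a + q \<odot> d)
      - ((q - 1) * z) \<odot> (q \<odot> m + (q - 1) \<odot> b + q \<odot> c)))
    + ((q - 1) * z) \<odot> ((q * (w - z)) \<odot> (m + a) - ((q * w - z) \<odot> (q \<odot> m + (q - 1) \<odot> b + q \<odot> c)
      - ((q - 1) * w) \<odot> (q \<odot> m + (q - 1) \<odot> a + q \<odot> d)))"
    by (simp add: scale_algebra algebra_simps)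
  also have "\<dots> = 0" unfolding E E' by simp
  finally show ?thesis using assms(1,2) by (simp add: a_def b_def d_def)
qed

lemma commute_restore:
  assumes "w \<noteq> z" "q \<noteq> 0"
    and Rwz: "(q * (w - z)) \<odot> (Dw * Tz) = (q * w - z) \<odot> (Tz * Dw) - ((q - 1) * w) \<odot> (Tw * Dz)"
    and Rzw: "(q * (z - w)) \<odot> (Dz * Tw) = (q * z - w) \<odot> (Tw * Dz) - ((q - 1) * z) \<odot> (Tz * Dw)"
    and S: "Sw = s * Dw + Tw" "Sz = s * Dz + Tz"
    and comm: "Dw * Dz = Dz * Dw" "Sw * Sz = Sz * Sw" "s * Sw = Sw * s" "s * Sz = Sz * s"
  shows "Tw * Tz = Tz * Tw"
proof -
  have T: "Tw = Sw - s * Dw" "Tz = Sz - s * Dz" using S by simp_all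
  have 1: "Sw * (s * Dz) = s * (Sw * Dz)" "Sz * (s * Dw) = s * (Sz * Dw)"
    by (simp_all add: comm(3,4) flip: mult.assoc)
  have "(q * (w - z)) \<odot> (Tz * Dw - Tw * Dz + Dz * Tw - Dw * Tz)
    = - ((q * (w - z)) \<odot> (Dw * Tz) - ((q * w - z) \<odot> (Tz * Dw) - ((q - 1) * w) \<odot> (Tw * Dz)))
      - ((q * (z - w)) \<odot> (Dz * Tw) - ((q * z - w) \<odot> (Tw * Dz) - ((q - 1) * z) \<odot> (Tz * Dw)))"
    by (simp add: scale_algebra algebra_simps)
  also have "\<dots> = 0" by (simp only: Rwz Rzw) simp
  finally have G: "Tz * Dw - Tw * Dz + Dz * Tw - Dw * Tz = 0" using assms(1,2) by simp
  have "Tw * Tz - Tz * Tw = s * (Sz * Dw - Sw * Dz + Dz * Sw - Dw * Sz + Dw * (s * Dz) - Dz * (s * Dw))"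
    unfolding T by (simp add: algebra_simps 1 comm(2))
  also have "Sz * Dw - Sw * Dz + Dz * Sw - Dw * Sz + Dw * (s * Dz) - Dz * (s * Dw)
      = Tz * Dw - Tw * Dz + Dz * Tw - Dw * Tz"
    by (simp add: S algebra_simps comm(1))
  finally show ?thesis using G by simp
qed

definition exchange_pair :: "'k \<Rightarrow> nat \<Rightarrow> ('k \<Rightarrow> 'f) \<Rightarrow> ('k \<Rightarrow> 'f) \<Rightarrow> bool"
  where "exchange_pair q n P Q \<longleftrightarrow>
    (\<exists>p. P = (\<lambda>z. \<kappa> z ^ n + reval n p (\<kappa> z))) \<and>
    (\<exists>c. Q = (\<lambda>z. reval n c (\<kappa> z))) \<and>
    (\<forall>w z. P w * P z = P z * P w) \<and> (\<forall>w z. Q w * Q z = Q z * Q w) \<and>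
    (\<forall>w z. (q * (w - z)) \<odot> (P w * Q z) = (q * w - z) \<odot> (Q z * P w) - ((q - 1) * w) \<odot> (Q w * P z)) \<and>
    P 0 \<noteq> 0 \<and> (\<lambda>_. 1) \<in> lmod {P, Q}"

definition qplanes :: "'k \<Rightarrow> nat \<Rightarrow> (nat \<Rightarrow> 'f) \<Rightarrow> (nat \<Rightarrow> 'f) \<Rightarrow> bool"
  where "qplanes q n u v \<longleftrightarrow>
    (\<forall>i<n. u i \<noteq> 0 \<and> v i \<noteq> 0) \<and>
    (\<forall>i<n. \<forall>j<n. u i * u j = u j * u i \<and> v i * v j = v j * v i \<and>
       v i * u j = (if i = j then q else 1) \<odot> (u j * v i))"

text \<open>
  The quantum planes of a pair: they lie in the division subring generated by the pair, and
  the pair is polynomial in them and their inverses. The last clause keeps track of an element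
  that commutes with \<open>P\<close> and commutes with \<open>Q\<close> up to a scalar.
\<close>

definition separates :: "'k \<Rightarrow> nat \<Rightarrow> ('k \<Rightarrow> 'f) \<Rightarrow> ('k \<Rightarrow> 'f) \<Rightarrow> (nat \<Rightarrow> 'f) \<Rightarrow> (nat \<Rightarrow> 'f) \<Rightarrow> bool"
  where "separates q n P Q u v \<longleftrightarrow> qplanes q n u v \<and>
    (\<forall>D. divsub D \<longrightarrow> (\<forall>z. P z \<in> D \<and> Q z \<in> D) \<longrightarrow> (\<forall>i<n. u i \<in> D \<and> v i \<in> D)) \<and>
    (\<forall>B. subalg B \<longrightarrow> (\<forall>i<n. u i \<in> B \<and> inverse (u i) \<in> B \<and> v i \<in> B \<and> inverse (v i) \<in> B) \<longrightarrow>
       (\<forall>z. P z \<in> B \<and> Q z \<in> B)) \<and>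
    (0 < n \<longrightarrow> u 0 = P 0) \<and>
    (\<forall>e c. c \<noteq> 0 \<longrightarrow> (\<forall>z. e * P z = P z * e) \<longrightarrow> (\<forall>z. Q z * e = c \<odot> (e * Q z)) \<longrightarrow>
       (\<forall>i<n. u i * e = e * u i \<and> v i * e = (if i = 0 then c else 1) \<odot> (e * v i)))"

lemma exchange_pair_peel:
  assumes pair: "exchange_pair q (Suc m) P Q" and q: "q \<noteq> 0" "q \<noteq> 1"
  obtains h e D s T where "h \<noteq> 0" "e = P 0" "e \<noteq> 0" "exchange_pair q m D T"
    "\<And>z. h * D z = D z * h" "\<And>z. e * D z = D z * e" "\<And>z. h * T z = T z * h" "\<And>z. e * T z = T z * e"
    "h * e = q \<odot> (e * h)" "s = (1 - T 0) * inverse (D 0)"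
    "\<And>z. Q z = h * D z" "\<And>z. P z = z \<odot> D z + e * (s * D z + T z)"
    "\<And>V. subspace V \<Longrightarrow> (\<And>z. Q z \<in> V) \<Longrightarrow> h \<in> V"
proof -
  obtain p c where Pp: "P = (\<lambda>z. \<kappa> z ^ Suc m + reval (Suc m) p (\<kappa> z))"
    and Qc: "Q = (\<lambda>z. reval (Suc m) c (\<kappa> z))"
    and PP: "\<And>w z. P w * P z = P z * P w" and QQ: "\<And>w z. Q w * Q z = Q z * Q w"
    and R: "\<And>w z. (q * (w - z)) \<odot> (P w * Q z) = (q * w - z) \<odot> (Q z * P w) - ((q - 1) * w) \<odot> (Q w * P z)"
    and P0: "P 0 \<noteq> 0" and one: "(\<lambda>_. 1) \<in> lmod {P, Q}"
    using pair unfolding exchange_pair_def by blast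
  define h where "h = c m"
  have leadP: "lead (Suc m) 1 P" unfolding Pp by (rule lead_monic)
  have leadQ: "lead m h Q" unfolding Qc h_def by (rule lead_reval)
  have h_mem: "h \<in> V" if "subspace V" "\<And>z. Q z \<in> V" for V
    using lead_mem[OF that(1) finite.emptyI leadQ] that(2) by blast
  have central_sub: "subspace {a. g * a = a * g}" for g
    using subspace_subalg[OF divsubD(1)[OF divsub_centralizer[of "{g}"]]] by simp
  have hQ: "h * Q z = Q z * h" for z
    using h_mem[of "{a. Q z * a = a * Q z}"] central_sub QQ by auto
  have star: "q \<odot> (P w * h) = h * P w + ((q - 1) * w) \<odot> Q w" for w
  proof -
    have "lead (Suc m) ((q * w) \<odot> 0 - q \<odot> (P w * h) - ((q * w) \<odot> 0 - h * P w - ((q - 1) * w) \<odot> (Q w * 1)))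
      (\<lambda>z. ((q * w) \<odot> (P w * Q z) - q \<odot> (z \<odot> (P w * Q z))) 
        - ((q * w) \<odot> (Q z * P w) - z \<odot> (Q z * P w) - ((q - 1) * w) \<odot> (Q w * P z)))"
      by (intro lead_diff lead_scale lead_times lead_mult_left lead_mult_right leadP leadQ
          lead_Suc[OF lead_mult_left[OF leadQ]] lead_Suc[OF lead_mult_right[OF leadQ]])
    moreover have "(\<lambda>z. ((q * w) \<odot> (P w * Q z) - q \<odot> (z \<odot> (P w * Q z))) 
        - ((q * w) \<odot> (Q z * P w) - z \<odot> (Q z * P w) - ((q - 1) * w) \<odot> (Q w * P z))) = (\<lambda>_. 0)"
    proof
      fix z
      show "((q * w) \<odot> (P w * Q z) - q \<odot> (z \<odot> (P w * Q z))) 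
        - ((q * w) \<odot> (Q z * P w) - z \<odot> (Q z * P w) - ((q - 1) * w) \<odot> (Q w * P z)) = 0"
        using R[of w z] by (simp add: scale_algebra algebra_simps)
    qed
    ultimately have "(q * w) \<odot> 0 - q \<odot> (P w * h) - ((q * w) \<odot> 0 - h * P w - ((q - 1) * w) \<odot> (Q w * 1)) = 0"
      by (simp only: lead_unique[OF _ lead_0])
    then show ?thesis by (simp add: algebra_simps)
  qed
  have h0: "h \<noteq> 0"
  proof
    assume "h = 0"
    have "Q w = 0" if "w \<noteq> 0" for w
      using star[of w] \<open>h = 0\<close> that q by simp
    then have "c i = 0" if "i < Suc m" for i
      using coeff_mem[OF subspace_single_0, of "{0}" "Suc m" c i] that by (simp add: Qc)
    then have "Q = (\<lambda>_. 0)" by (simp add: Qc reval_def)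
    then show False using lmod_monic_proper[OF leadP] one by auto
  qed
  define D where "D z = inverse h * Q z" for z
  have Q: "Q z = h * D z" for z using h0 by (simp add: D_def flip: mult.assoc)
  have hi: "inverse h * Q z = Q z * inverse h" for z
    using inverse_commutes[OF hQ] .
  have hD: "h * D z = D z * h" for z unfolding D_def by (rule commutes_with_quotient[OF hQ])
  have DD: "D w * D z = D z * D w" for w z
  proof -
    have "D w * D z = inverse h * inverse h * (Q w * Q z)" for w z
      unfolding D_def by (metis hi mult.assoc)
    then show ?thesis using QQ by simp
  qed
  define p' where "p' i = inverse h * c i" for i
  have Dm: "D = (\<lambda>z. \<kappa> z ^ m + reval m p' (\<kappa> z))"
  proof -
    have "reval m p' x = inverse h * reval m c x" for x
      unfolding p'_def[abs_def] reval_mult_left ..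
    then show ?thesis
      using h0 by (simp add: D_def fun_eq_iff Qc reval_Suc distrib_left h_def flip: mult.assoc)
  qed
  have leadD: "lead m 1 D" unfolding Dm by (rule lead_monic)
  define S where "S z = P z - z \<odot> D z" for z
  have P: "P z = z \<odot> D z + S z" for z by (simp add: S_def)
  define \<sigma> where "\<sigma> i = p i - (case i of 0 \<Rightarrow> 0 | Suc j \<Rightarrow> p' j)" for i
  have S\<sigma>: "S = (\<lambda>z. reval (Suc m) \<sigma> (\<kappa> z))"
  proof
    fix z
    have "reval (Suc m) (case_nat 0 p') (\<kappa> z) = z \<odot> reval m p' (\<kappa> z)"
      by (subst reval_shift) (simp add: mult_\<kappa>_right)
    then have "reval (Suc m) \<sigma> (\<kappa> z) = reval (Suc m) p (\<kappa> z) - z \<odot> reval m p' (\<kappa> z)"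
      unfolding \<sigma>_def by (simp only: reval_diff)
    then show "S z = reval (Suc m) \<sigma> (\<kappa> z)"
      by (simp add: S_def Pp Dm scale_right_distrib) (simp add: scale_def)
  qed
  have RS: "(w - z) \<odot> (S w * D z) = (q * w - z) \<odot> (D z * S w) - ((q - 1) * w) \<odot> (D w * S z)" for w z
    using exchange_reduce[OF h0, of q w z "P w" "D z" "D w" "P z" "S w" "S z"] R[of w z] star[of w] DD P Q by metis
  have SS: "S w * S z = S z * S w" for w z
  proof (cases "w = z")
    case False
    show ?thesis
      using commute_reduce[OF False RS[of w z] RS[of z w] DD] PP[of w z] by (simp add: P[symmetric])
  qed simp
  have hS: "q \<odot> (S w * h) = h * S w" for w
  proof -
    have "q \<odot> ((w \<odot> D w + S w) * h) - (h * (w \<odot> D w + S w) + ((q - 1) * w) \<odot> (h * D w)) = 0"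
      using star[of w] by (simp add: P[symmetric] Q[symmetric])
    then show ?thesis by (simp add: scale_algebra algebra_simps hD)
  qed
  define e where "e = P 0"
  have e: "e = S 0" "e \<noteq> 0" using P[of 0] P0 by (simp_all add: e_def)
  have eS: "e * S z = S z * e" for z unfolding e by (rule SS)
  have eD: "e * D z = D z * e" for z
  proof -
    have nz: "D z \<in> {a. e * a = a * e}" if "z \<notin> {0}" for z
      using RS[of 0 z] that e by simp
    have "reval m p' (\<kappa> z) \<in> {a. e * a = a * e}" if "z \<notin> {0}" for z
    proof -
      have "reval m p' (\<kappa> z) = D z - z ^ m \<odot> 1" by (simp add: Dm scale_power_eq)
      also have "\<dots> \<in> {a. e * a = a * e}"
        using nz[OF that] by (intro subspace_diff[OF central_sub]) (auto simp: scale_algebra)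
      finally show ?thesis .
    qed
    then have "p' i \<in> {a. e * a = a * e}" if "i < m" for i
      using coeff_mem[OF central_sub, of "{0}" m p' e i] that by blast
    then have "reval m p' (\<kappa> z) \<in> {a. e * a = a * e}" by (intro reval_mem central_sub)
    then have "z ^ m \<odot> 1 + reval m p' (\<kappa> z) \<in> {a. e * a = a * e}"
      by (intro subspace_add[OF central_sub]) (auto simp: scale_algebra)
    then show ?thesis by (simp add: Dm scale_power_eq)
  qed
  have he: "h * e = q \<odot> (e * h)" using hS[of 0] e by simp
  define S' where "S' z = inverse e * S z" for z
  have S: "S z = e * S' z" for z using e by (simp add: S'_def flip: mult.assoc)
  have ei: "inverse e * S z = S z * inverse e" "inverse e * D z = D z * inverse e" for z
    using inverse_commutes eS eD by blast+
  have eS': "e * S' z = S' z * e" for z unfolding S'_def by (rule commutes_with_quotient[OF eS])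
  have SS': "S' w * S' z = S' z * S' w" for w z
  proof -
    have "S' w * S' z = inverse e * inverse e * (S w * S z)" for w z
      unfolding S'_def by (metis ei(1) mult.assoc)
    then show ?thesis using SS by simp
  qed
  have RS': "(w - z) \<odot> (S' w * D z) = (q * w - z) \<odot> (D z * S' w) - ((q - 1) * w) \<odot> (D w * S' z)" for w z
  proof -
    have "inverse e * ((w - z) \<odot> (S w * D z)) = inverse e * ((q * w - z) \<odot> (D z * S w) - ((q - 1) * w) \<odot> (D w * S z))"
      by (simp only: RS)
    moreover have "inverse e * (D w * S z) = D w * S' z" for w z
      unfolding S'_def by (metis ei(2) mult.assoc)
    ultimately show ?thesis
      by (simp only: mult_scale_right right_diff_distrib S'_def mult.assoc[symmetric])
  qed
  have hS': "h * S' z = S' z * h" for z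
  proof -
    have "e * (h * S' z) = inverse q \<odot> (h * (e * S' z))"
      using q by (simp add: he mult_scale_left flip: mult.assoc)
    also have "\<dots> = S z * h" using q by (simp add: S[symmetric] hS[symmetric])
    also have "\<dots> = e * (S' z * h)" by (simp add: S mult.assoc)
    finally show ?thesis using e by simp
  qed
  have S'\<sigma>: "S' = (\<lambda>z. reval (Suc m) (\<lambda>i. inverse e * \<sigma> i) (\<kappa> z))"
    by (simp add: fun_eq_iff S'_def S\<sigma> reval_mult_left)
  define s where "s = inverse e * \<sigma> m"
  have leadS': "lead m s S'" unfolding S'\<sigma> s_def by (rule lead_reval)
  have s_mem: "s \<in> V" if "subspace V" "\<And>z. S' z \<in> V" for V
    using lead_mem[OF that(1) finite.emptyI leadS'] that(2) by blast
  have sS': "s * S' z = S' z * s" for z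
    using s_mem[OF central_sub, of "S' z"] SS' by simp
  have hs: "h * s = s * h" and es: "e * s = s * e"
    using s_mem[OF central_sub, of h] s_mem[OF central_sub, of e] hS' eS' by simp_all
  have Ds': "s * D z = q \<odot> (D z * s) - (q - 1) \<odot> S' z" for z
  proof -
    have "lead (Suc m) (s * D z - z \<odot> 0 - (q \<odot> (D z * s) - z \<odot> 0 - (q - 1) \<odot> (1 * S' z)))
      (\<lambda>w. w \<odot> (S' w * D z) - z \<odot> (S' w * D z)
        - (q \<odot> (w \<odot> (D z * S' w)) - z \<odot> (D z * S' w) - (q - 1) \<odot> (w \<odot> (D w * S' z))))"
      by (intro lead_diff lead_scale lead_times lead_mult_left lead_mult_right leadD leadS'
          lead_Suc[OF lead_mult_left[OF leadS']] lead_Suc[OF lead_mult_right[OF leadS']])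
    moreover have "(\<lambda>w. w \<odot> (S' w * D z) - z \<odot> (S' w * D z)
        - (q \<odot> (w \<odot> (D z * S' w)) - z \<odot> (D z * S' w) - (q - 1) \<odot> (w \<odot> (D w * S' z)))) = (\<lambda>_. 0)"
    proof
      fix w
      show "w \<odot> (S' w * D z) - z \<odot> (S' w * D z)
        - (q \<odot> (w \<odot> (D z * S' w)) - z \<odot> (D z * S' w) - (q - 1) \<odot> (w \<odot> (D w * S' z))) = 0"
        using RS'[of w z] by (simp add: scale_algebra algebra_simps)
    qed
    ultimately have "s * D z - z \<odot> 0 - (q \<odot> (D z * s) - z \<odot> 0 - (q - 1) \<odot> (1 * S' z)) = 0"
      by (simp only: lead_unique[OF _ lead_0])
    then show ?thesis by (simp add: algebra_simps)
  qed
  define T where "T z = S' z - s * D z" for z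
  have ST: "S' z = s * D z + T z" for z by (simp add: T_def)
  have Ds: "q \<odot> (D z * s) = q \<odot> (s * D z) + (q - 1) \<odot> T z" for z
    using Ds'[of z] unfolding ST by (simp add: scale_algebra algebra_simps)
  have RT: "(q * (w - z)) \<odot> (D w * T z) = (q * w - z) \<odot> (T z * D w) - ((q - 1) * w) \<odot> (T w * D z)" for w z
  proof (cases "w = z")
    case False
    show ?thesis
      by (rule exchange_restore[OF False q(1) RS' RS' Ds Ds DD ST ST])
  qed (simp add: scale_algebra algebra_simps)
  have TT: "T w * T z = T z * T w" for w z
  proof (cases "w = z")
    case False
    show ?thesis
      by (rule commute_restore[OF False q(1) RT RT ST ST DD SS' sS' sS'])
  qed simp
  have Tt: "T = (\<lambda>z. reval m (\<lambda>i. inverse e * \<sigma> i - s * p' i) (\<kappa> z))"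
    by (simp add: T_def fun_eq_iff S'\<sigma> Dm reval_Suc reval_diff reval_mult_left s_def distrib_left mult.assoc)
  have S'0: "S' 0 = 1" using e by (simp add: S'_def)
  have D0: "D 0 \<noteq> 0"
  proof
    assume "D 0 = 0"
    with Ds[of 0] q have "T 0 = 0" by simp
    with ST[of 0] S'0 \<open>D 0 = 0\<close> show False by simp
  qed
  have s: "s = (1 - T 0) * inverse (D 0)"
  proof -
    have "s * D 0 = 1 - T 0" using ST[of 0] S'0 by (simp add: eq_diff_eq)
    then have "s * D 0 * inverse (D 0) = (1 - T 0) * inverse (D 0)" by simp
    then show ?thesis using D0 by (simp add: mult.assoc)
  qed
  have lQ: "Q \<in> lmod {D, T}" unfolding Q by (intro lmod.mult lmod.gen) simp
  have PT: "P z = z \<odot> D z + e * (s * D z + T z)" for z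
    using P[of z] S[of z] ST[of z] by simp
  have lP: "P \<in> lmod {D, T}" unfolding PT by (intro lmod.intros) simp_all
  have one': "(\<lambda>_. 1) \<in> lmod {D, T}" using lmod_trans[OF one, of "{D, T}"] lP lQ by simp
  have "exchange_pair q m D T"
    unfolding exchange_pair_def using Dm Tt DD TT RT D0 one' by blast
  moreover have "h * T z = T z * h" "e * T z = T z * e" for z
  proof -
    have "h * (s * D z) = s * D z * h" by (metis hs hD mult.assoc)
    then show "h * T z = T z * h" by (simp add: T_def right_diff_distrib left_diff_distrib hS')
    have "e * (s * D z) = s * D z * e" by (metis es eD mult.assoc)
    then show "e * T z = T z * e" by (simp add: T_def right_diff_distrib left_diff_distrib eS')
  qed
  ultimately show thesis
    using that[of h e D T s] h0 e_def e(2) hD eD he s Q PT h_mem by blast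
qed

end


context skew_kalgebra
begin

lemma separates_exists_peel:
  assumes "exchange_pair q n P Q" "q \<noteq> 0" "q \<noteq> 1"
  shows "\<exists>u v. separates q n P Q u v"
  using assms(1)
proof (induction n arbitrary: P Q)
  case 0
  then obtain p c where "P = (\<lambda>z. \<kappa> z ^ 0 + reval 0 p (\<kappa> z))" "Q = (\<lambda>z. reval 0 c (\<kappa> z))"
    unfolding exchange_pair_def by blast
  then have "separates q 0 P Q (\<lambda>_. 0) (\<lambda>_. 0)"
    by (auto simp: separates_def qplanes_def subalgD)
  then show ?case by blast
next
  case (Suc m)
  obtain h e D s T where h: "h \<noteq> 0" "e = P 0" "e \<noteq> 0" and pair: "exchange_pair q m D T"
    and comm: "\<And>z. h * D z = D z * h" "\<And>z. e * D z = D z * e" "\<And>z. h * T z = T z * h" "\<And>z. e * T z = T z * e"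
    and he: "h * e = q \<odot> (e * h)" and s: "s = (1 - T 0) * inverse (D 0)"
    and Q: "\<And>z. Q z = h * D z" and P: "\<And>z. P z = z \<odot> D z + e * (s * D z + T z)"
    and h_mem: "\<And>V. subspace V \<Longrightarrow> (\<And>z. Q z \<in> V) \<Longrightarrow> h \<in> V"
    by (rule exchange_pair_peel[OF Suc.prems assms(2,3)], rule that, assumption+, blast)
  obtain u v where uv: "separates q m D T u v" using Suc.IH[OF pair] by blast
  have planes: "qplanes q m u v"
    and in_D: "\<And>E i. divsub E \<Longrightarrow> \<forall>z. D z \<in> E \<and> T z \<in> E \<Longrightarrow> i < m \<Longrightarrow> u i \<in> E \<and> v i \<in> E"
    and in_B: "\<And>B z. subalg B \<Longrightarrow> \<forall>i<m. u i \<in> B \<and> inverse (u i) \<in> B \<and> v i \<in> B \<and> inverse (v i) \<in> B \<Longrightarrow>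
       D z \<in> B \<and> T z \<in> B"
    and u0: "0 < m \<Longrightarrow> u 0 = D 0"
    using uv unfolding separates_def by simp_all
  have T_eq: "T z = inverse e * (P z - z \<odot> D z) - s * D z" for z
    using h(3) by (simp add: P flip: mult.assoc)
  have D_eq: "D z = inverse h * Q z" for z
    using h(1) by (simp add: Q flip: mult.assoc)
  have D0: "D 0 \<noteq> 0" using pair by (auto simp: exchange_pair_def)
  have s_eq: "s * D 0 + T 0 = 1" using D0 by (simp add: s mult.assoc)
  have s_lead: "s \<in> V" if V: "subspace V" "\<And>z. inverse e * (P z - z \<odot> D z) \<in> V" for V
  proof -
    obtain p' c' where *: "D = (\<lambda>z. \<kappa> z ^ m + reval m p' (\<kappa> z))" "T = (\<lambda>z. reval m c' (\<kappa> z))"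
      using pair unfolding exchange_pair_def by blast
    have "lead m s (\<lambda>z. s * D z + T z)"
      by (rule leadI[of _ _ _ "\<lambda>i. s * p' i + c' i"])
         (simp add: * reval_add reval_mult_left scale_power_eq distrib_left)
    moreover have "s * D z + T z \<in> V" for z using V(2)[of z] by (simp add: T_eq)
    ultimately show ?thesis using lead_mem[OF V(1) finite.emptyI] by blast
  qed
  have DT_mem: "D z \<in> E \<and> T z \<in> E" if E: "divsub E" "\<And>z. P z \<in> E" "\<And>z. inverse h * Q z \<in> E" for E z
  proof -
    note sub = subalgD[OF divsubD(1)[OF E(1)]]
    have D: "D z \<in> E" for z using E(3) by (simp add: D_eq)
    have "inverse e \<in> E" using E(2)[of 0] divsubD(2)[OF E(1)] by (simp add: h)
    then have x: "inverse e * (P z - z \<odot> D z) \<in> E" for z using E(2) D by (intro sub)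
    then have "s \<in> E" by (intro s_lead subspace_subalg divsubD(1)[OF E(1)])
    then have "T z \<in> E" unfolding T_eq by (rule sub(3)[OF x sub(4)[OF _ D]])
    then show ?thesis using D by blast
  qed
  have cent: "u i * h = h * u i \<and> v i * h = h * v i \<and> u i * e = e * u i \<and> v i * e = e * v i" if "i < m" for i
    using in_D[OF divsub_centralizer[of "{h, e}"] _ that] comm by simp
  define u' v' where "u' = case_nat e u" and "v' = case_nat h v"
  have planes': "qplanes q (Suc m) u' v'"
    unfolding qplanes_def
  proof (intro conjI allI impI)
    fix i j assume ij: "i < Suc m" "j < Suc m"
    show "u' i \<noteq> 0" "v' i \<noteq> 0" using planes h ij by (auto simp: u'_def v'_def qplanes_def split: nat.split)
    show "u' i * u' j = u' j * u' i" "v' i * v' j = v' j * v' i"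
      using planes cent ij by (auto simp: u'_def v'_def qplanes_def split: nat.split)
    show "v' i * u' j = (if i = j then q else 1) \<odot> (u' j * v' i)"
      using planes cent ij he by (auto simp: u'_def v'_def qplanes_def split: nat.split)
  qed
  have mem: "u' i \<in> E \<and> v' i \<in> E" if E: "divsub E" "\<forall>z. P z \<in> E \<and> Q z \<in> E" "i < Suc m" for E i
  proof -
    have hE: "h \<in> E" using h_mem[OF subspace_subalg[OF divsubD(1)[OF E(1)]]] E(2) by blast
    then have "inverse h * Q z \<in> E" for z
      using E(2) by (intro subalgD[OF divsubD(1)[OF E(1)]] divsubD(2)[OF E(1)]) auto
    then have "\<forall>z. D z \<in> E \<and> T z \<in> E" using DT_mem[OF E(1)] E(2) by blast
    then show ?thesis using in_D[OF E(1)] hE E(2,3) by (auto simp: u'_def v'_def h split: nat.split)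
  qed
  have gen: "P z \<in> B \<and> Q z \<in> B"
    if B: "subalg B" "\<forall>i<Suc m. u' i \<in> B \<and> inverse (u' i) \<in> B \<and> v' i \<in> B \<and> inverse (v' i) \<in> B" for B z
  proof -
    have eh: "e \<in> B" "h \<in> B" using B(2)[rule_format, of 0] by (simp_all add: u'_def v'_def)
    have uvB: "\<forall>i<m. u i \<in> B \<and> inverse (u i) \<in> B \<and> v i \<in> B \<and> inverse (v i) \<in> B"
    proof (intro allI impI)
      fix i assume "i < m"
      then show "u i \<in> B \<and> inverse (u i) \<in> B \<and> v i \<in> B \<and> inverse (v i) \<in> B"
        using B(2)[rule_format, of "Suc i"] by (simp add: u'_def v'_def)
    qed
    have DT: "D z \<in> B" "T z \<in> B" for z using in_B[OF B(1) uvB] by blast+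
    have "inverse (D 0) \<in> B"
    proof (cases "m = 0")
      case True
      then have "D 0 = 1" using pair by (auto simp: exchange_pair_def)
      then show ?thesis using subalgD[OF B(1)] by simp
    next
      case False
      then show ?thesis using u0 uvB by auto
    qed
    then have "s \<in> B" unfolding s using DT by (intro subalgD[OF B(1)])
    then show ?thesis unfolding P Q using DT eh by (intro conjI subalgD[OF B(1)])
  qed
  have skew: "u' i * g = g * u' i \<and> v' i * g = (if i = 0 then c else 1) \<odot> (g * v' i)"
    if g: "c \<noteq> 0" "\<forall>z. g * P z = P z * g" "\<forall>z. Q z * g = c \<odot> (g * Q z)" "i < Suc m" for g c i
  proof -
    have "subspace {a. a * g = c \<odot> (g * a)}"
      by (auto simp: subspace_def scale_algebra distrib_left distrib_right)
    from h_mem[OF this] g(3) have hg: "h * g = c \<odot> (g * h)" by simp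
    have "h * (D z * g) = h * (g * D z)" for z
    proof -
      have "h * (D z * g) = c \<odot> (g * (h * D z))" using g(3)[rule_format, of z] by (simp add: Q mult.assoc)
      also have "\<dots> = h * (g * D z)" by (simp add: hg mult_scale_left flip: mult.assoc)
      finally show ?thesis .
    qed
    then have gQ: "g * (inverse h * Q z) = inverse h * Q z * g" for z
      using h(1) by (simp add: D_eq)
    let ?E = "{a. \<forall>x\<in>{g}. x * a = a * x}"
    have 1: "P z \<in> ?E" for z using g(2) by blast
    have 2: "inverse h * Q z \<in> ?E" for z using gQ by blast
    have "\<forall>z. D z \<in> ?E \<and> T z \<in> ?E" using DT_mem[OF divsub_centralizer 1 2] by blast
    note j = in_D[OF divsub_centralizer this]
    show ?thesis
    proof (cases i)
      case 0
      then show ?thesis using hg g(2)[rule_format, of 0] by (simp add: u'_def v'_def h(2))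
    next
      case (Suc k)
      then show ?thesis using j[of k] g(4) by (simp add: u'_def v'_def)
    qed
  qed
  have zero: "u' 0 = P 0" by (simp add: u'_def h)
  have "separates q (Suc m) P Q u' v'"
    unfolding separates_def
    by (intro conjI planes' impI zero; (intro allI impI)?; (rule mem gen skew; assumption)?)
  then show ?case by blast
qed

text \<open>For \<open>q = 1\<close> everything commutes, and the coefficients themselves do.\<close>

lemma separates_exists_commutative:
  assumes pair: "exchange_pair 1 n P Q"
  shows "\<exists>u v. separates 1 n P Q u v"
proof (cases n)
  case 0
  then obtain p c where "P = (\<lambda>z. \<kappa> z ^ 0 + reval 0 p (\<kappa> z))" "Q = (\<lambda>z. reval 0 c (\<kappa> z))"
    using pair unfolding exchange_pair_def by blast
  then have "separates 1 0 P Q (\<lambda>_. 0) (\<lambda>_. 0)"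
    by (auto simp: separates_def qplanes_def subalgD)
  then show ?thesis using 0 by blast
next
  case (Suc m)
  obtain p c where Pp: "P = (\<lambda>z. \<kappa> z ^ n + reval n p (\<kappa> z))"
    and Qc: "Q = (\<lambda>z. reval n c (\<kappa> z))"
    and PP: "\<And>w z. P w * P z = P z * P w" and QQ: "\<And>w z. Q w * Q z = Q z * Q w"
    and R: "\<And>w z. (w - z) \<odot> (P w * Q z) = (w - z) \<odot> (Q z * P w)"
    and P0: "P 0 \<noteq> 0" and one: "(\<lambda>_. 1) \<in> lmod {P, Q}"
    using pair unfolding exchange_pair_def by auto
  have p_mem: "p i \<in> V" if "subspace V" "finite E" "1 \<in> V" "\<And>z. z \<notin> E \<Longrightarrow> P z \<in> V" "i < n" for V E i
  proof (rule coeff_mem[OF that(1,2) _ that(5)])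
    fix z assume "z \<notin> E"
    then have "P z - z ^ n \<odot> 1 \<in> V" using that by (intro subspace_diff subspace_scale) auto
    then show "reval n p (\<kappa> z) \<in> V" by (simp add: Pp scale_power_eq)
  qed
  have c_mem: "c i \<in> V" if "subspace V" "finite E" "\<And>z. z \<notin> E \<Longrightarrow> Q z \<in> V" "i < n" for V E i
    using coeff_mem[OF that(1,2) _ that(4)] that(3) by (simp add: Qc)
  have cs: "subspace {a. g * a = a * g}" for g
    using subspace_subalg[OF divsubD(1)[OF divsub_centralizer[of "{g}"]]] by simp
  have pQ: "Q z * p i = p i * Q z" if "i < n" for i z
  proof -
    have "P w * Q z = Q z * P w" if "w \<noteq> z" for w using R[of w z] that by simp
    then have "p i \<in> {a. Q z * a = a * Q z}" by (intro p_mem[OF cs, of "{z}"] that) simp_all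
    then show ?thesis by simp
  qed
  have pc: "c j * p i = p i * c j" if "i < n" "j < n" for i j
  proof -
    have "c j \<in> {a. p i * a = a * p i}" by (intro c_mem[OF cs, of "{}"]) (simp_all add: pQ that)
    then show ?thesis by simp
  qed
  have pP: "P z * p i = p i * P z" if "i < n" for i z
  proof -
    have "p i \<in> {a. P z * a = a * P z}" by (intro p_mem[OF cs, of "{}"] that) (simp_all add: PP)
    then show ?thesis by simp
  qed
  have pp: "p j * p i = p i * p j" if "i < n" "j < n" for i j
  proof -
    have "p j \<in> {a. p i * a = a * p i}" by (intro p_mem[OF cs, of "{}"]) (simp_all add: pP that)
    then show ?thesis by simp
  qed
  have cQ: "Q z * c i = c i * Q z" if "i < n" for i z
  proof -
    have "c i \<in> {a. Q z * a = a * Q z}" by (intro c_mem[OF cs, of "{}"] that) (simp_all add: QQ)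
    then show ?thesis by simp
  qed
  have cc: "c j * c i = c i * c j" if "i < n" "j < n" for i j
  proof -
    have "c j \<in> {a. c i * a = a * c i}" by (intro c_mem[OF cs, of "{}"]) (simp_all add: cQ that)
    then show ?thesis by simp
  qed
  have "lead n 1 P" unfolding Pp by (rule lead_monic)
  then have "Q \<noteq> (\<lambda>_. 0)" using lmod_monic_proper[of n P "\<lambda>_. 1"] one Suc by auto
  then obtain k where k: "k < n" "c k \<noteq> 0" unfolding Qc reval_def by fastforce
  define \<pi> where "\<pi> i = (if i = 0 then k else if i = k then 0 else i)" for i
  have \<pi>: "\<pi> i < n" "\<pi> (\<pi> i) = i" if "i < n" for i using that k by (auto simp: \<pi>_def)
  define nz where "nz a = (if a = 0 then 1 else a)" for a :: 'f
  have nz: "nz a \<noteq> 0" for a by (simp add: nz_def)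
  define u where "u i = nz (p i)" for i
  define v where "v i = (if i = 0 then c k else nz (inverse (c k) * c (\<pi> i)))" for i
  have nz_comm: "nz a * b = b * nz a" if "a * b = b * a" for a b using that by (simp add: nz_def)
  have q_comm: "inverse (c k) * a * b = b * (inverse (c k) * a)" if "c k * b = b * c k" "a * b = b * a" for a b
    using inverse_commutes[OF that(1)] that(2) by (metis mult.assoc)
  have v_comm: "v i * b = b * v i" if "i < n" "\<And>j. j < n \<Longrightarrow> c j * b = b * c j" for i b
    unfolding v_def using that k \<pi>[OF that(1)] by (auto intro!: nz_comm q_comm)
  have u_comm: "u i * b = b * u i" if "i < n" "p i * b = b * p i" for i b
    unfolding u_def using that by (intro nz_comm)
  have vc: "v i * c j = c j * v i" if "i < n" "j < n" for i j
    using v_comm[of i "c j"] cc that by simp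
  have planes': "qplanes 1 n u v"
    unfolding qplanes_def
  proof (intro conjI allI impI)
    fix i j assume ij: "i < n" "j < n"
    show "u i \<noteq> 0" "v i \<noteq> 0" using nz k by (auto simp: u_def v_def)
    have "p i * u j = u j * p i" using u_comm[of j "p i"] pp ij by simp
    then show "u i * u j = u j * u i" using u_comm[of i "u j"] ij by simp
    have "c l * v j = v j * c l" if "l < n" for l using vc[of j l] ij that by simp
    then show "v i * v j = v j * v i" using v_comm[of i "v j"] ij by simp
    have "c l * u j = u j * c l" if "l < n" for l using u_comm[of j "c l"] pc ij that by simp
    then show "v i * u j = (if i = j then 1 else 1) \<odot> (u j * v i)" using v_comm[of i "u j"] ij by simp
  qed
  have mem: "u i \<in> E \<and> v i \<in> E" if E: "divsub E" "\<forall>z. P z \<in> E \<and> Q z \<in> E" "i < n" for E i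
  proof -
    note sub = subalgD[OF divsubD(1)[OF E(1)]] and ssp = subspace_subalg[OF divsubD(1)[OF E(1)]]
    have "p j \<in> E" "c j \<in> E" if "j < n" for j
      using p_mem[OF ssp, of "{}"] c_mem[OF ssp, of "{}"] E(2) sub that by auto
    then show ?thesis unfolding u_def v_def nz_def using E(3) k \<pi>[OF E(3)]
      by (auto intro!: sub divsubD(2)[OF E(1)])
  qed
  have gen: "P z \<in> B \<and> Q z \<in> B"
    if B: "subalg B" "\<forall>i<n. u i \<in> B \<and> inverse (u i) \<in> B \<and> v i \<in> B \<and> inverse (v i) \<in> B" for B z
  proof -
    note sub = subalgD[OF B(1)]
    have nzB: "a \<in> B" if "nz a \<in> B" for a using that sub by (auto simp: nz_def split: if_splits)
    have p: "p i \<in> B" if "i < n" for i using B(2) that nzB unfolding u_def by blast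
    have ck: "c k \<in> B" using B(2)[rule_format, of 0] Suc by (simp add: v_def)
    have c: "c i \<in> B" if "i < n" for i
    proof (cases "i = k")
      case False
      have "\<pi> i \<noteq> 0" using False by (auto simp: \<pi>_def)
      then have "inverse (c k) * c i \<in> B" using B(2)[rule_format, OF \<pi>(1)[OF that]] nzB
        by (simp add: v_def \<pi>(2)[OF that])
      from sub(4)[OF ck this] have "c k * (inverse (c k) * c i) \<in> B" .
      then show ?thesis using k by (simp flip: mult.assoc)
    qed (simp add: ck)
    show ?thesis unfolding Pp Qc using p c
      by (intro conjI sub reval_mem[OF subspace_subalg[OF B(1)]]) auto
  qed
  have skew: "u i * g = g * u i \<and> v i * g = (if i = 0 then a else 1) \<odot> (g * v i)"
    if g: "a \<noteq> 0" "\<forall>z. g * P z = P z * g" "\<forall>z. Q z * g = a \<odot> (g * Q z)" "i < n" for g a i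
  proof -
    have "p i * g = g * p i" using p_mem[OF cs[of g], of "{}" i] g by simp
    moreover have "subspace {x. x * g = a \<odot> (g * x)}"
      by (auto simp: subspace_def scale_algebra distrib_left distrib_right)
    then have cg: "c j * g = a \<odot> (g * c j)" if "j < n" for j
      using c_mem[of "{x. x * g = a \<odot> (g * x)}" "{}" j] g that by simp
    have "inverse (c k) * c j * g = g * (inverse (c k) * c j)" if "j < n" for j
    proof -
      have "c k * (g * (inverse (c k) * c j)) = (c k * g) * (inverse (c k) * c j)"
        by (simp only: mult.assoc)
      also have "\<dots> = a \<odot> (g * ((c k * inverse (c k)) * c j))"
        by (simp only: cg[OF k(1)] mult_scale_left mult.assoc)
      also have "\<dots> = c j * g"
        using k(2) by (simp add: cg[OF that])
      also have "\<dots> = c k * (inverse (c k) * c j * g)"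
        using k(2) by (simp flip: mult.assoc)
      finally show ?thesis using k(2) by simp
    qed
    ultimately show ?thesis using u_comm[OF g(4)] cg[OF k(1)] \<pi>[OF g(4)]
      by (auto simp: v_def intro!: nz_comm)
  qed
  have zero: "u 0 = P 0"
    using P0 Suc by (simp add: Pp u_def nz_def reval_at_0)
  have "separates 1 n P Q u v"
    unfolding separates_def
    by (intro conjI planes' impI zero; (intro allI impI)?; (rule mem gen skew; assumption)?)
  then show ?thesis by blast
qed

end


section \<open>The pair attached to quantum planes\<close>

locale quantum_points = skew_kalgebra \<kappa>
  for \<kappa> :: "'k::field_char_0 \<Rightarrow> 'f::division_ring" +
  fixes q :: 'k and X Y :: "'n::finite \<Rightarrow> 'f"
  assumes q_nonzero: "q \<noteq> 0"
    and XX: "X i * X j = X j * X i"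
    and YY: "Y i * Y j = Y j * Y i"
    and YX: "Y i * X j = (if i = j then q else 1) \<odot> (X j * Y i)"
    and X_nonzero: "X i \<noteq> 0"
    and Y_nonzero: "Y i \<noteq> 0"
    and X_distinct: "i \<noteq> j \<Longrightarrow> X i \<noteq> c \<odot> X j"
begin

definition lin :: "'f \<Rightarrow> 'n set \<Rightarrow> 'f"
  where "lin a S = cprod (\<lambda>j. a - X j) S"

lemma commuting_lin:
  assumes "\<And>j. a * X j = X j * a"
  shows "commuting (\<lambda>j. a - X j) S"
  unfolding commuting_def
proof (intro ballI)
  fix i j
  show "(a - X i) * (a - X j) = (a - X j) * (a - X i)"
    using assms[of i] assms[of j] XX[of i j] by (simp add: algebra_simps)
qed

lemma \<kappa>X: "\<kappa> z * X j = X j * \<kappa> z"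
  by (rule \<kappa>_central)

lemma lin_insert:
  assumes "\<And>j. a * X j = X j * a" "i \<notin> S"
  shows "lin a (insert i S) = (a - X i) * lin a S"
  unfolding lin_def using assms by (intro cprod_insert commuting_lin) auto

lemma lin_commute:
  assumes "\<And>j. a * X j = X j * a" "\<And>j. j \<in> S \<Longrightarrow> b * X j = X j * b" "a * b = b * a"
  shows "lin a S * b = b * lin a S"
  unfolding lin_def using assms(2,3)
  by (intro cprod_commute commuting_lin assms(1)) (auto simp: left_diff_distrib right_diff_distrib)

lemma lin_X:
  assumes "\<And>j. a * X j = X j * a"
  shows "lin a S * X j = X j * lin a S"
  by (rule lin_commute) (rule assms XX)+

lemma lin_nonzero:
  assumes "k \<notin> S"
  shows "lin (X k) S \<noteq> 0"
proof -
  have "X k - X i \<noteq> 0" if "i \<in> S" for i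
    using X_distinct[of k i 1] that assms by auto
  then show ?thesis
    unfolding lin_def by (intro cprod_nonzero[OF commuting_lin[OF XX]]) auto
qed

definition P :: "'k \<Rightarrow> 'f"
  where "P z = lin (\<kappa> z) UNIV"

definition N :: "'n \<Rightarrow> 'f \<Rightarrow> 'f"
  where "N i a = lin a (UNIV - {i})"

definition y :: "'n \<Rightarrow> 'f"
  where "y i = Y i * inverse (N i (X i))"

definition Q :: "'k \<Rightarrow> 'f"
  where "Q z = (\<Sum>i\<in>UNIV. y i * N i (\<kappa> z))"

lemma N_X: "N i (X k) * X j = X j * N i (X k)"
  unfolding N_def by (rule lin_X) (rule XX)

lemma N_\<kappa>_X: "N i (\<kappa> z) * X j = X j * N i (\<kappa> z)"
  unfolding N_def by (rule lin_X) (rule \<kappa>X)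

lemma N_nonzero: "N i (X i) \<noteq> 0"
  unfolding N_def by (rule lin_nonzero) simp

lemma N_root: "i \<noteq> k \<Longrightarrow> N i (X k) = 0"
  using lin_insert[of "X k" k "UNIV - {i} - {k}", OF XX] by (simp add: N_def insert_absorb)

lemma yN: "y i * N i (X i) = Y i"
  using N_nonzero by (simp add: y_def mult.assoc)

lemma y_nonzero: "y i \<noteq> 0"
  using yN Y_nonzero by (metis mult_zero_left)

lemma yX: "y i * X j = (if i = j then q else 1) \<odot> (X j * y i)"
proof -
  have "inverse (N i (X i)) * X j = X j * inverse (N i (X i))"
    by (rule inverse_commutes[OF N_X])
  then have "y i * X j = (Y i * X j) * inverse (N i (X i))"
    by (simp add: y_def mult.assoc)
  then show ?thesis by (simp only: YX y_def mult_scale_left mult.assoc)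
qed

lemma yX_other: "i \<noteq> j \<Longrightarrow> y i * X j = X j * y i"
  using yX[of i j] by simp

lemma Xy: "X i * y i = y i * (inverse q \<odot> X i)"
  using yX[of i i] q_nonzero by (simp add: mult_scale_right)

lemma P_remove: "P z = (\<kappa> z - X i) * N i (\<kappa> z)"
  unfolding P_def N_def using lin_insert[of "\<kappa> z" i "UNIV - {i}", OF \<kappa>X]
  by (simp add: insert_absorb)

lemma N_remove:
  assumes "i \<noteq> j" "\<And>l. a * X l = X l * a"
  shows "N i a = (a - X j) * lin a (UNIV - {i, j})"
proof -
  have "UNIV - {i} = insert j (UNIV - {i, j})" using assms by auto
  then show ?thesis unfolding N_def using lin_insert[OF assms(2), of j "UNIV - {i, j}"] by simp
qed

lemma N_y: "N i (\<kappa> z) * y i = y i * N i (\<kappa> z)"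
  unfolding N_def by (rule lin_commute) (auto simp: \<kappa>X yX_other \<kappa>_central[of z "y i"])

lemma lin_y: "i \<notin> S \<Longrightarrow> lin (\<kappa> z) S * y i = y i * lin (\<kappa> z) S"
  by (rule lin_commute) (auto simp: \<kappa>X yX \<kappa>_central[of z "y i"])

lemma N_y_other:
  assumes "i \<noteq> j"
  shows "N i (\<kappa> z) * y j = y j * ((\<kappa> z - inverse q \<odot> X j) * lin (\<kappa> z) (UNIV - {i, j}))"
proof -
  have "N i (\<kappa> z) * y j = (\<kappa> z - X j) * (y j * lin (\<kappa> z) (UNIV - {i, j}))"
    by (simp add: N_remove[OF assms \<kappa>X] mult.assoc lin_y)
  also have "(\<kappa> z - X j) * (y j * L) = y j * ((\<kappa> z - inverse q \<odot> X j) * L)" for L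
  proof -
    have "(\<kappa> z - X j) * y j = y j * (\<kappa> z - inverse q \<odot> X j)"
      by (simp add: left_diff_distrib right_diff_distrib Xy \<kappa>_central[of z "y j"])
    then show ?thesis by (simp flip: mult.assoc)
  qed
  finally show ?thesis .
qed

lemma y_exchange:
  assumes "i \<noteq> j"
  shows "y i * y j * (X i - inverse q \<odot> X j) = - (y j * y i * (X j - inverse q \<odot> X i))"
proof -
  have key: "y i * y j * (X i - inverse q \<odot> X j) * ((X j - X i) *
      (lin (X i) (UNIV - {i, j}) * lin (X j) (UNIV - {i, j}))) = Y i * Y j" if "i \<noteq> j" for i j
  proof -
    define E E' r where "E = lin (X i) (UNIV - {i, j})" and "E' = lin (X j) (UNIV - {i, j})"
      and "r = X i - inverse q \<odot> X j"
    have EX: "E * X l = X l * E" "E' * X l = X l * E'" for l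
      unfolding E_def E'_def by (rule lin_X[OF XX])+
    have Nj: "N j (X j) = (X j - X i) * E'"
      unfolding E'_def using N_remove[of j i "X j"] that XX by (simp add: insert_commute)
    have Ni: "N i (X i) = (X i - X j) * E"
      unfolding E_def using N_remove[of i j "X i"] that XX by simp
    have EY: "E * Y j = Y j * E"
      unfolding E_def
    proof (rule lin_commute[OF XX])
      show "Y j * X l = X l * Y j" if "l \<in> UNIV - {i, j}" for l using that YX[of j l] by auto
      show "X i * Y j = Y j * X i" using that YX[of j i] by auto
    qed
    have "X j * Y j = Y j * (inverse q \<odot> X j)"
      using YX[of j j] q_nonzero by (simp add: mult_scale_right)
    moreover have "X i * Y j = Y j * X i" using that YX[of j i] by auto
    ultimately have "N i (X i) * Y j = Y j * (r * E)"
      unfolding Ni r_def by (simp add: mult.assoc EY left_diff_distrib right_diff_distrib)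
         (simp add: left_diff_distrib right_diff_distrib flip: mult.assoc)
    moreover have "E * E' = E' * E"
      unfolding E_def by (rule lin_commute[OF XX]) (simp_all add: EX)
    then have "r * ((X j - X i) * (E * E')) = (X j - X i) * E' * (r * E)"
    proof -
      have rE': "r * E' = E' * r" unfolding r_def
        by (simp add: left_diff_distrib right_diff_distrib mult_scale_left mult_scale_right EX)
      have rX: "r * (X j - X i) = (X j - X i) * r" unfolding r_def
        using XX[of i j] by (simp add: algebra_simps scale_algebra)
      have "r * ((X j - X i) * (E * E')) = (r * (X j - X i)) * (E' * E)"
        by (simp add: mult.assoc \<open>E * E' = E' * E\<close>)
      also have "\<dots> = (X j - X i) * (r * E') * E" unfolding rX by (simp only: mult.assoc)
      also have "\<dots> = (X j - X i) * E' * (r * E)" unfolding rE' by (simp only: mult.assoc)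
      finally show ?thesis .
    qed
    ultimately have "y i * y j * r * ((X j - X i) * (E * E')) = y i * (y j * N j (X j)) * (r * E)"
      by (simp only: Nj mult.assoc)
    also have "\<dots> = y i * (Y j * (r * E))" by (simp only: yN mult.assoc)
    also have "\<dots> = y i * N i (X i) * Y j"
      by (simp only: \<open>N i (X i) * Y j = Y j * (r * E)\<close> mult.assoc)
    also have "\<dots> = Y i * Y j" by (simp only: yN)
    finally show ?thesis unfolding E_def E'_def r_def .
  qed
  let ?E = "lin (X i) (UNIV - {i, j})" and ?E' = "lin (X j) (UNIV - {i, j})"
  have EX: "?E * X l = X l * ?E" "?E' * X l = X l * ?E'" for l
    by (rule lin_X[OF XX])+
  have E: "?E' * ?E = ?E * ?E'"
    by (rule lin_commute[OF XX]) (simp_all add: EX)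
  have "(y i * y j * (X i - inverse q \<odot> X j) + y j * y i * (X j - inverse q \<odot> X i)) * ((X j - X i) * (?E * ?E'))
    = Y i * Y j - Y j * Y i"
  proof -
    have "y j * y i * (X j - inverse q \<odot> X i) * ((X j - X i) * (?E * ?E'))
       = - (y j * y i * (X j - inverse q \<odot> X i) * ((X i - X j) * (?E' * ?E)))"
      by (simp add: E algebra_simps)
    moreover have "y j * y i * (X j - inverse q \<odot> X i) * ((X i - X j) * (?E' * ?E)) = Y j * Y i"
      using key[of j i] assms by (simp add: insert_commute)
    ultimately show ?thesis using key[OF assms] by (simp add: distrib_right)
  qed
  also have "\<dots> = 0" using YY by simp
  finally show ?thesis
    using X_distinct[of j i 1] assms lin_nonzero[of i "UNIV - {i, j}"] lin_nonzero[of j "UNIV - {i, j}"]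
    by (simp add: eq_neg_iff_add_eq_0)
qed

lemma PP: "P w * P z = P z * P w"
  unfolding P_def
  by (rule lin_commute[OF \<kappa>X]) (simp_all add: lin_X[OF \<kappa>X] \<kappa>_central[of w])

lemma QQ: "Q w * Q z = Q z * Q w"
proof -
  define t where "t i j = y i * N i (\<kappa> w) * (y j * N j (\<kappa> z)) - y i * N i (\<kappa> z) * (y j * N j (\<kappa> w))" for i j
  have QQt: "Q w * Q z - Q z * Q w = (\<Sum>i\<in>UNIV. \<Sum>j\<in>UNIV. t i j)"
    by (simp add: Q_def sum_product t_def sum_subtractf)
  have NN: "lin (\<kappa> a) S * lin (\<kappa> b) S = lin (\<kappa> b) S * lin (\<kappa> a) S" for a b S
    by (rule lin_commute[OF \<kappa>X]) (simp_all add: lin_X[OF \<kappa>X] \<kappa>_central[of a])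
  have diag: "t i i = 0" for i
  proof -
    have "y i * N i (\<kappa> a) * (y i * N i (\<kappa> b)) = y i * y i * (N i (\<kappa> a) * N i (\<kappa> b))" for a b
      using N_y[of i a] by (metis mult.assoc)
    then show ?thesis unfolding t_def using NN[of w "UNIV - {i}" z] by (simp add: N_def)
  qed
  have off: "t i j = - t j i" if "i \<noteq> j" for i j
  proof -
    have *: "t i j = (z - w) \<odot> (y i * y j * (X i - inverse q \<odot> X j) * (lin (\<kappa> w) (UNIV - {i, j}) * lin (\<kappa> z) (UNIV - {i, j})))"
      if "i \<noteq> j" for i j
    proof -
      let ?L = "\<lambda>a. lin (\<kappa> a) (UNIV - {i, j})"
      have s: "y i * N i (\<kappa> a) * (y j * N j (\<kappa> b)) 
          = y i * y j * ((\<kappa> a - inverse q \<odot> X j) * (\<kappa> b - X i)) * (?L a * ?L b)" for a b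
      proof -
        have Lb: "?L a * (\<kappa> b - X i) = (\<kappa> b - X i) * ?L a"
          using lin_X[OF \<kappa>X, of a "UNIV - {i, j}" i] \<kappa>_central[of b "?L a"]
          by (simp add: left_diff_distrib right_diff_distrib)
        have "y i * N i (\<kappa> a) * (y j * N j (\<kappa> b)) = y i * (N i (\<kappa> a) * y j) * N j (\<kappa> b)"
          by (simp only: mult.assoc)
        also have "\<dots> = y i * y j * (\<kappa> a - inverse q \<odot> X j) * (?L a * (\<kappa> b - X i)) * ?L b"
          unfolding N_y_other[OF that] N_remove[OF that[symmetric] \<kappa>X]
          by (simp only: mult.assoc insert_commute)
        finally show ?thesis unfolding Lb by (simp only: mult.assoc)
      qed
      have "t i j = y i * y j * ((\<kappa> w - inverse q \<odot> X j) * (\<kappa> z - X i) - (\<kappa> z - inverse q \<odot> X j) * (\<kappa> w - X i)) * (?L w * ?L z)"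
        unfolding t_def s using NN[of w "UNIV - {i, j}" z] 
        by (simp add: left_diff_distrib right_diff_distrib)
      also have "(\<kappa> w - inverse q \<odot> X j) * (\<kappa> z - X i) - (\<kappa> z - inverse q \<odot> X j) * (\<kappa> w - X i)
          = (z - w) \<odot> (X i - inverse q \<odot> X j)"
        by (simp add: left_diff_distrib right_diff_distrib mult_\<kappa>_right scale_algebra scale_def[symmetric] mult.commute[of w z] 
             mult.commute[of z "inverse q"] mult.commute[of w "inverse q"] XX)
           (simp add: scale_def \<kappa>_mult[symmetric] mult.commute[of w z])
      finally show ?thesis by (simp only: mult_scale_left mult_scale_right)
    qed
    have "{j, i} = {i, j}" by auto
    then show ?thesis
      by (simp only: *[OF that] *[OF that[symmetric]] y_exchange[OF that] mult_minus_left scale_minus_right)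
  qed
  have anti: "t i j = - t j i" for i j
  proof (cases "i = j")
    case True
    then show ?thesis by (simp only: diag minus_zero)
  qed (rule off)
  have "(\<Sum>i\<in>UNIV. \<Sum>j\<in>UNIV. t i j) = (\<Sum>j\<in>UNIV. \<Sum>i\<in>UNIV. t i j)" by (rule sum.swap)
  also have "\<dots> = - (\<Sum>j\<in>UNIV. \<Sum>i\<in>UNIV. t j i)" by (simp only: sum_negf[symmetric] anti[symmetric])
  finally have "2 \<odot> (\<Sum>i\<in>UNIV. \<Sum>j\<in>UNIV. t i j) = 0"
    using scale_left_distrib[of 1 1] by (simp add: eq_neg_iff_add_eq_0)
  then show ?thesis using QQt by simp
qed

lemma PQ: "(q * (w - z)) \<odot> (P w * Q z) = (q * w - z) \<odot> (Q z * P w) - ((q - 1) * w) \<odot> (Q w * P z)"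
proof -
  have NN: "N i (\<kappa> a) * N i (\<kappa> b) = N i (\<kappa> b) * N i (\<kappa> a)" for a b i
    unfolding N_def by (rule lin_commute[OF \<kappa>X]) (simp_all add: lin_X[OF \<kappa>X] \<kappa>_central[of a])
  have 1: "P w * (y i * N i (\<kappa> z)) = y i * ((\<kappa> w - inverse q \<odot> X i) * (N i (\<kappa> w) * N i (\<kappa> z)))" for i
  proof -
    have "(\<kappa> w - X i) * y i = y i * (\<kappa> w - inverse q \<odot> X i)"
      by (simp add: left_diff_distrib right_diff_distrib Xy \<kappa>_central[of w "y i"])
    then show ?thesis
      unfolding P_remove[of w i] using N_y[of i w] by (metis mult.assoc)
  qed
  have 2: "y i * N i (\<kappa> a) * P b = y i * ((\<kappa> b - X i) * (N i (\<kappa> a) * N i (\<kappa> b)))" for a b i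
  proof -
    have "N i (\<kappa> a) * (\<kappa> b - X i) = (\<kappa> b - X i) * N i (\<kappa> a)"
      by (simp add: left_diff_distrib right_diff_distrib N_\<kappa>_X \<kappa>_central[of b "N i (\<kappa> a)"])
    then show ?thesis unfolding P_remove[of b i] by (metis mult.assoc)
  qed
  have "(q * (w - z)) \<odot> (P w * (y i * N i (\<kappa> z))) = (q * w - z) \<odot> (y i * N i (\<kappa> z) * P w)
      - ((q - 1) * w) \<odot> (y i * N i (\<kappa> w) * P z)" for i
  proof -
    have "(q * (w - z)) \<odot> (\<kappa> w - inverse q \<odot> X i) = (q * w - z) \<odot> (\<kappa> w - X i) - ((q - 1) * w) \<odot> (\<kappa> z - X i)"
    proof -
      have qq: "q * (c * inverse q) = c" for c using q_nonzero by simp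
      show ?thesis
        by (simp add: scale_algebra algebra_simps)
           (simp add: scale_def \<kappa>_mult[symmetric] qq mult.commute mult.left_commute)
    qed
    then have "y i * (((q * (w - z)) \<odot> (\<kappa> w - inverse q \<odot> X i)) * (N i (\<kappa> w) * N i (\<kappa> z))) 
      = y i * (((q * w - z) \<odot> (\<kappa> w - X i) - ((q - 1) * w) \<odot> (\<kappa> z - X i)) * (N i (\<kappa> w) * N i (\<kappa> z)))" by simp
    then show ?thesis
      unfolding 1 2 NN[of i z w] by (simp only: left_diff_distrib right_diff_distrib mult_scale_left mult_scale_right)
  qed
  then show ?thesis
    unfolding Q_def sum_distrib_left sum_distrib_right scale_sum_right by (simp flip: sum_subtractf)
qed

end


context skew_kalgebra
begin

lemma lmod_diff:
  assumes "f \<in> lmod G" "g \<in> lmod G"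
  shows "(\<lambda>z. f z - g z) \<in> lmod G"
  using lmod.add[OF assms(1) lmod.mult[OF assms(2), of "- 1"]] by simp

lemma lmod_sum:
  assumes "finite A" "\<And>i. i \<in> A \<Longrightarrow> f i \<in> lmod G" "g \<in> lmod G"
  shows "(\<lambda>z. \<Sum>i\<in>A. f i z) \<in> lmod G"
  using assms(1,2)
proof (induction A rule: finite_induct)
  case empty
  show ?case using lmod.mult[OF assms(3), of 0] by simp
next
  case (insert i A)
  then show ?case using lmod.add[of "f i" G "\<lambda>z. \<Sum>i\<in>A. f i z"] by simp
qed

lemma lmod_linear:
  assumes "f \<in> lmod G"
  shows "(\<lambda>z. (\<kappa> z - b) * f z) \<in> lmod G"
  using lmod_diff[OF lmod.times[OF assms] lmod.mult[OF assms, of b]]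
  by (simp add: left_diff_distrib scale_def)

lemma commuting_\<kappa>_minus:
  assumes "\<And>i j. b i * b j = b j * b i"
  shows "commuting (\<lambda>j. \<kappa> z - b j) S"
  unfolding commuting_def
proof (intro ballI)
  fix i j
  show "(\<kappa> z - b i) * (\<kappa> z - b j) = (\<kappa> z - b j) * (\<kappa> z - b i)"
    using \<kappa>_central[of z "b i"] \<kappa>_central[of z "b j"] assms[of i j] by (simp add: algebra_simps)
qed

lemma lmod_cprod:
  assumes "finite S" "\<And>i j. b i * b j = b j * b i" "f \<in> lmod G"
  shows "(\<lambda>z. cprod (\<lambda>j. \<kappa> z - b j) S * f z) \<in> lmod G"
  using assms(1)
proof (induction S rule: finite_induct)
  case empty
  show ?case using assms(3) by simp
next
  case (insert i S)
  have c: "commuting (\<lambda>j. \<kappa> z - b j) (insert i S)" for z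
    by (rule commuting_\<kappa>_minus[OF assms(2)])
  from lmod_linear[OF insert.IH, of "b i"] show ?case
    by (simp add: cprod_insert[OF c insert.hyps] mult.assoc)
qed

end

context quantum_points
begin



lemma one_in_lmod: "(\<lambda>_. 1) \<in> lmod {P, Q}"
proof -
  let ?I = "lmod {P, Q}"
  let ?G = "\<lambda>z S. cprod (\<lambda>j. \<kappa> z - q \<odot> X j) S"
  have PI: "P \<in> ?I" and QI: "Q \<in> ?I" by (auto intro: lmod.gen)
  have qX: "(q \<odot> X i) * (q \<odot> X j) = (q \<odot> X j) * (q \<odot> X i)" for i j
    by (simp add: scale_algebra XX[of i j])
  have c: "commuting (\<lambda>j. \<kappa> z - q \<odot> X j) S" for z S
    by (rule commuting_\<kappa>_minus[OF qX])
  have qXy: "(q \<odot> X j) * y i = y i * (if i = j then X j else q \<odot> X j)" for i j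
    by (auto simp: yX mult_scale_left mult_scale_right)
  have G_y: "?G z S * y k = y k * ?G z S" if "k \<notin> S" for z S k
  proof (rule cprod_commute[OF c])
    fix j assume "j \<in> S"
    then have "k \<noteq> j" using that by blast
    then show "(\<kappa> z - q \<odot> X j) * y k = y k * (\<kappa> z - q \<odot> X j)"
      using qXy[of j k] \<kappa>_central[of z "y k"] by (simp add: left_diff_distrib right_diff_distrib)
  qed simp
  have GN: "(\<lambda>z. ?G z (UNIV - {k}) * N k (\<kappa> z)) \<in> ?I" for k
  proof -
    have "(\<lambda>z. ?G z (UNIV - {k}) * (y i * N i (\<kappa> z))) \<in> ?I" if "i \<noteq> k" for i
    proof -
      have "?G z (UNIV - {k}) * (y i * N i (\<kappa> z)) = ?G z (UNIV - {k} - {i}) * (y i * P z)" for z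
      proof -
        have "?G z (UNIV - {k}) = (\<kappa> z - q \<odot> X i) * ?G z (UNIV - {k} - {i})"
          using that by (intro cprod_remove[OF c]) auto
        moreover have "?G z (UNIV - {k} - {i}) * (\<kappa> z - q \<odot> X i) = (\<kappa> z - q \<odot> X i) * ?G z (UNIV - {k} - {i})"
          using c[of z UNIV] by (intro cprod_commute[OF c]) (auto simp: commuting_def)
        moreover have "(\<kappa> z - q \<odot> X i) * (y i * N i (\<kappa> z)) = y i * P z"
        proof -
          have "(\<kappa> z - q \<odot> X i) * y i = y i * (\<kappa> z - X i)"
            using qXy[of i i] \<kappa>_central[of z "y i"] by (simp add: left_diff_distrib right_diff_distrib)
          then show ?thesis unfolding P_remove[of z i] by (simp only: mult.assoc[symmetric])
        qed
        ultimately show ?thesis by (metis mult.assoc)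
      qed
      then show ?thesis
        using lmod_cprod[of "UNIV - {k} - {i}" "\<lambda>j. q \<odot> X j", OF finite qX lmod.mult[OF PI, of "y i"]] by simp
    qed
    then have "(\<lambda>z. \<Sum>i\<in>UNIV - {k}. ?G z (UNIV - {k}) * (y i * N i (\<kappa> z))) \<in> ?I"
      by (intro lmod_sum[OF _ _ PI]) auto
    from lmod_diff[OF lmod_cprod[of "UNIV - {k}" "\<lambda>j. q \<odot> X j", OF finite qX QI] this]
    have "(\<lambda>z. ?G z (UNIV - {k}) * (y k * N k (\<kappa> z))) \<in> ?I"
      by (simp add: Q_def sum.remove[of UNIV k] distrib_left flip: sum_distrib_left)
    then have "(\<lambda>z. y k * (?G z (UNIV - {k}) * N k (\<kappa> z))) \<in> ?I"
      using G_y[of k "UNIV - {k}"] by (simp flip: mult.assoc)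
    from lmod.mult[OF this, of "inverse (y k)"] show ?thesis
      using y_nonzero by (simp flip: mult.assoc)
  qed
  have N1: "(\<lambda>z. ?G z S * N k (\<kappa> z)) \<in> ?I \<Longrightarrow> (\<lambda>z. N k (\<kappa> z)) \<in> ?I" if "finite S" "k \<notin> S" for S k
    using that
  proof (induction S rule: finite_induct)
    case empty
    then show ?case by simp
  next
    case (insert j S)
    have jk: "j \<noteq> k" using insert.prems(2) by auto
    define a where "a = X k - q \<odot> X j"
    have a0: "a \<noteq> 0" using X_distinct[of k j q] jk by (auto simp: a_def)
    have aG: "?G z S * a = a * ?G z S" for z
    proof (rule cprod_commute[OF c insert.hyps(1)])
      fix i assume "i \<in> S"
      have "X i * a = a * X i"
        by (simp add: a_def left_diff_distrib right_diff_distrib mult_scale_left mult_scale_right XX[of i])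
      then show "(\<kappa> z - q \<odot> X i) * a = a * (\<kappa> z - q \<odot> X i)"
        by (simp add: left_diff_distrib right_diff_distrib mult_scale_left mult_scale_right \<kappa>_central[of z a])
    qed
    have "a * (?G z S * N k (\<kappa> z)) = ?G z (insert j S) * N k (\<kappa> z) - ?G z S * P z" for z
    proof -
      have G: "?G z (insert j S) = ?G z S * (\<kappa> z - q \<odot> X j)"
        using cprod_insert[OF c insert.hyps] cprod_commute[OF c[of z S] insert.hyps(1), of "\<kappa> z - q \<odot> X j"] c[of z UNIV]
        by (simp add: commuting_def)
      have "(\<kappa> z - q \<odot> X j) * N k (\<kappa> z) = P z + a * N k (\<kappa> z)"
        unfolding P_remove[of z k] a_def by (simp flip: distrib_right)
      then have "?G z S * (a * N k (\<kappa> z)) = ?G z (insert j S) * N k (\<kappa> z) - ?G z S * P z"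
        by (simp add: G mult.assoc distrib_left)
      moreover have "a * (?G z S * N k (\<kappa> z)) = ?G z S * (a * N k (\<kappa> z))"
        by (simp only: mult.assoc[symmetric] aG)
      ultimately show ?thesis by simp
    qed
    then have "(\<lambda>z. a * (?G z S * N k (\<kappa> z))) \<in> ?I"
      using lmod_diff[OF insert.prems(1) lmod_cprod[of S "\<lambda>j. q \<odot> X j", OF insert.hyps(1) qX PI]] by simp
    from lmod.mult[OF this, of "inverse a"] have "(\<lambda>z. ?G z S * N k (\<kappa> z)) \<in> ?I"
      using a0 by (simp flip: mult.assoc)
    then show ?case using insert.IH insert.prems by blast
  qed
  have "(\<lambda>z. lin (\<kappa> z) (UNIV - U)) \<in> ?I" if "card U = Suc m" for m U
    using that
  proof (induction m arbitrary: U)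
    case 0
    then obtain k where "U = {k}" by (metis One_nat_def card_1_singletonE)
    then show ?case using N1[OF _ _ GN, of k] by (simp add: N_def)
  next
    case (Suc m)
    obtain i where i: "i \<in> U" using Suc.prems by (metis card.empty equals0I nat.distinct(1))
    then have "card (U - {i}) = Suc m" using Suc.prems by simp
    then obtain j where j: "j \<in> U" "j \<noteq> i" by (metis card.empty DiffE equals0I insertI1 nat.distinct(1))
    have "card (U - {j}) = Suc m" using Suc.prems j by simp
    have e: "lin (\<kappa> z) (UNIV - (U - {k})) = (\<kappa> z - X k) * lin (\<kappa> z) (UNIV - U)" if "k \<in> U" for k z
    proof -
      have "UNIV - (U - {k}) = insert k (UNIV - U)" using that by auto
      then show ?thesis using lin_insert[of "\<kappa> z" k "UNIV - U", OF \<kappa>X] that by simp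
    qed
    have "(\<lambda>z. lin (\<kappa> z) (UNIV - (U - {i})) - lin (\<kappa> z) (UNIV - (U - {j}))) \<in> ?I"
      by (intro lmod_diff Suc.IH) fact+
    then have "(\<lambda>z. (X j - X i) * lin (\<kappa> z) (UNIV - U)) \<in> ?I"
      by (simp add: e i j flip: left_diff_distrib)
    from lmod.mult[OF this, of "inverse (X j - X i)"] show ?case
      using X_distinct[of j i 1] j by (simp flip: mult.assoc)
  qed
  from this[of UNIV "CARD('n) - 1"] show ?thesis by (simp add: lin_def)
qed

lemma P_coeffs:
  obtains p where "\<And>a. (\<And>j. a * X j = X j * a) \<Longrightarrow> lin a UNIV = a ^ CARD('n) + reval CARD('n) p a"
  using cprod_linear_coeffs[of X UNIV] XX unfolding lin_def commuting_def by (metis UNIV_I finite)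

lemma N_coeffs:
  obtains p where "\<And>i a. (\<And>j. a * X j = X j * a) \<Longrightarrow> N i a = reval CARD('n) (p i) a"
proof -
  have "\<exists>p. \<forall>a. (\<forall>j. a * X j = X j * a) \<longrightarrow> N i a = reval CARD('n) p a" for i
  proof -
    define m where "m = card (UNIV - {i})"
    have m: "CARD('n) = Suc m" by (simp add: m_def card_Diff_singleton card_gt_0_iff)
    obtain p where p: "\<And>a. \<forall>j\<in>UNIV - {i}. a * X j = X j * a \<Longrightarrow> N i a = a ^ m + reval m p a"
    proof -
      have "commuting X (UNIV - {i})" unfolding commuting_def by (intro ballI XX)
      from cprod_linear_coeffs[OF this finite] show thesis
        using that unfolding lin_def N_def m_def by blast
    qed
    have "N i a = reval CARD('n) (\<lambda>j. if j < m then p j else 1) a" if "\<forall>j. a * X j = X j * a" for a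
    proof -
      have "reval m (\<lambda>j. if j < m then p j else 1) a = reval m p a" by (rule reval_cong) simp
      then show ?thesis using p[of a] that by (simp add: m reval_Suc)
    qed
    then show ?thesis by blast
  qed
  then show thesis using that by metis
qed

lemma Q_coeffs:
  obtains c where "\<And>a. (\<And>j. a * X j = X j * a) \<Longrightarrow> (\<Sum>i\<in>UNIV. y i * N i a) = reval CARD('n) c a"
proof -
  obtain p where p: "\<And>i a. (\<And>j. a * X j = X j * a) \<Longrightarrow> N i a = reval CARD('n) (p i) a"
    using N_coeffs by blast
  show thesis
  proof (rule that[of "\<lambda>j. \<Sum>i\<in>UNIV. y i * p i j"])
    fix a assume a: "\<And>j. a * X j = X j * a"
    have "(\<Sum>i\<in>UNIV. y i * N i a) = (\<Sum>i\<in>UNIV. \<Sum>j<CARD('n). y i * p i j * a ^ j)"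
      by (simp add: p[OF a] reval_def sum_distrib_left mult.assoc)
    also have "\<dots> = reval CARD('n) (\<lambda>j. \<Sum>i\<in>UNIV. y i * p i j) a"
      unfolding reval_def sum_distrib_right by (rule sum.swap)
    finally show "(\<Sum>i\<in>UNIV. y i * N i a) = reval CARD('n) (\<lambda>j. \<Sum>i\<in>UNIV. y i * p i j) a" .
  qed
qed

lemma P_nonzero: "P 0 \<noteq> 0"
  unfolding P_def lin_def
  by (rule cprod_nonzero[OF commuting_lin[OF \<kappa>X]]) (simp_all add: X_nonzero)

lemma exchange_pair: "exchange_pair q CARD('n) P Q"
proof -
  obtain p where "\<And>a. (\<And>j. a * X j = X j * a) \<Longrightarrow> lin a UNIV = a ^ CARD('n) + reval CARD('n) p a"
    using P_coeffs by blast
  then have "P = (\<lambda>z. \<kappa> z ^ CARD('n) + reval CARD('n) p (\<kappa> z))" using \<kappa>X by (simp add: P_def fun_eq_iff)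
  moreover obtain c where "\<And>a. (\<And>j. a * X j = X j * a) \<Longrightarrow> (\<Sum>i\<in>UNIV. y i * N i a) = reval CARD('n) c a"
    using Q_coeffs by blast
  then have "Q = (\<lambda>z. reval CARD('n) c (\<kappa> z))" using \<kappa>X by (simp add: Q_def fun_eq_iff)
  ultimately show ?thesis
    unfolding exchange_pair_def using PP QQ PQ P_nonzero one_in_lmod by blast
qed

text \<open>The coefficients of \<open>P\<close> and \<open>Q\<close> recover the \<open>X i\<close> as roots and the \<open>Y i\<close> as values.\<close>

lemma roots_and_values:
  obtains p c where
    "\<And>k. X k ^ CARD('n) + reval CARD('n) p (X k) = 0" "\<And>k. Y k = reval CARD('n) c (X k)"
    "\<And>i j. i < CARD('n) \<Longrightarrow> p i * X j = X j * p i"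
    "\<And>B i. subalg B \<Longrightarrow> (\<And>z. P z \<in> B) \<Longrightarrow> i < CARD('n) \<Longrightarrow> p i \<in> B"
    "\<And>B i. subalg B \<Longrightarrow> (\<And>z. Q z \<in> B) \<Longrightarrow> i < CARD('n) \<Longrightarrow> c i \<in> B"
    "\<And>z. P z = \<kappa> z ^ CARD('n) + reval CARD('n) p (\<kappa> z)"
proof -
  obtain p where p: "\<And>a. (\<And>j. a * X j = X j * a) \<Longrightarrow> lin a UNIV = a ^ CARD('n) + reval CARD('n) p a"
    using P_coeffs by blast
  obtain c where c: "\<And>a. (\<And>j. a * X j = X j * a) \<Longrightarrow> (\<Sum>i\<in>UNIV. y i * N i a) = reval CARD('n) c a"
    using Q_coeffs by blast
  have P: "P z = \<kappa> z ^ CARD('n) + reval CARD('n) p (\<kappa> z)" for z using p[OF \<kappa>X] by (simp add: P_def)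
  have Q: "Q z = reval CARD('n) c (\<kappa> z)" for z using c[OF \<kappa>X] by (simp add: Q_def)
  have p_mem: "p i \<in> B" if "subalg B" "\<And>z. P z \<in> B" "i < CARD('n)" for B i
  proof (rule coeff_mem[OF subspace_subalg[OF that(1)] finite.emptyI _ that(3)])
    fix z
    have "P z - \<kappa> z ^ CARD('n) \<in> B" using that subalgD[OF that(1)] by simp
    then show "reval CARD('n) p (\<kappa> z) \<in> B" by (simp add: P)
  qed
  have c_mem: "c i \<in> B" if "subalg B" "\<And>z. Q z \<in> B" "i < CARD('n)" for B i
    by (rule coeff_mem[OF subspace_subalg[OF that(1)] finite.emptyI _ that(3)]) (use that(2) in \<open>simp add: Q\<close>)
  have "lin (X k) UNIV = 0" for k
    using lin_insert[of "X k" k "UNIV - {k}", OF XX] by (simp add: insert_absorb)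
  then have "X k ^ CARD('n) + reval CARD('n) p (X k) = 0" for k using p[OF XX] by simp
  moreover have "Y k = reval CARD('n) c (X k)" for k
  proof -
    have "(\<Sum>i\<in>UNIV. y i * N i (X k)) = y k * N k (X k)"
      by (subst sum.remove[of _ k]) (simp_all add: N_root)
    then show ?thesis using c[OF XX] yN by simp
  qed
  moreover have "p i * X j = X j * p i" if "i < CARD('n)" for i j
    using p_mem[OF divsubD(1)[OF divsub_centralizer[of "{X j}"]] _ that] lin_X[OF \<kappa>X] by (simp add: P_def)
  ultimately show thesis using that p_mem c_mem P by blast
qed

lemma equivariant:
  assumes g: "\<And>a b. g (a + b) = g a + g b" "\<And>a b. g (a * b) = g a * g b" "\<And>c. g (\<kappa> c) = \<kappa> c"
    and "bij \<pi>" and gX: "\<And>i. g (X i) = X (\<pi> i)" and gY: "\<And>i. g (Y i) = Y (\<pi> i)"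
  shows "g (P z) = P z" "g (Q z) = Q z"
proof -
  have g1: "g 1 = 1" using g(3)[of 1] by simp
  have g0: "g 0 = 0" using g(3)[of 0] by simp
  have gm: "g (a - b) = g a - g b" for a b
    using g(1)[of "a - b" b] by (simp add: algebra_simps)
  have gi: "g (inverse a) = inverse (g a)" if "a \<noteq> 0" for a
    using g(2)[of a "inverse a"] that g1 by (simp add: inverse_unique)
  have gsum: "g (\<Sum>i\<in>A. f i) = (\<Sum>i\<in>A. g (f i))" for f :: "'n \<Rightarrow> 'f" and A
    by (induction A rule: infinite_finite_induct) (simp_all add: g0 g(1))
  have glin: "g (lin a S) = lin (g a) (\<pi> ` S)" if a: "\<And>j. a * X j = X j * a" for a S
  proof -
    have ga: "g a * X j = X j * g a" for j
    proof -
      obtain i where "j = \<pi> i" using \<open>bij \<pi>\<close> by (metis bij_pointE)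
      then show ?thesis using a[of i] by (metis g(2) gX)
    qed
    have "g (lin a S) = cprod (\<lambda>j. g (a - X j)) S"
      unfolding lin_def by (rule cprod_hom[OF commuting_lin[OF a]]) (simp_all add: g1 g(2))
    also have "\<dots> = cprod (\<lambda>j. g a - X (\<pi> j)) S" by (simp add: gm gX)
    also have "\<dots> = lin (g a) (\<pi> ` S)"
      unfolding lin_def
      by (rule cprod_reindex[symmetric, OF commuting_lin[OF ga]])
         (use \<open>bij \<pi>\<close> in \<open>auto intro: inj_on_subset simp: bij_def\<close>)
    finally show ?thesis .
  qed
  have img: "\<pi> ` UNIV = UNIV" "\<pi> ` (UNIV - {i}) = UNIV - {\<pi> i}" for i
    using \<open>bij \<pi>\<close> by (auto simp: bij_def image_set_diff)
  show "g (P z) = P z" unfolding P_def by (subst glin[OF \<kappa>X]) (simp add: g(3) img)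
  have gN: "g (N i (\<kappa> z)) = N (\<pi> i) (\<kappa> z)" "g (N i (X i)) = N (\<pi> i) (X (\<pi> i))" for i
    unfolding N_def by (subst glin, rule \<kappa>X XX, simp add: g(3) gX img)+
  have gy: "g (y i) = y (\<pi> i)" for i
    unfolding y_def by (simp add: g(2) gi[OF N_nonzero] gN gY)
  have "g (Q z) = (\<Sum>i\<in>UNIV. y (\<pi> i) * N (\<pi> i) (\<kappa> z))"
    unfolding Q_def by (simp add: gsum g(2) gN gy)
  also have "\<dots> = Q z"
    unfolding Q_def by (rule sum.reindex_bij_betw[OF \<open>bij \<pi>\<close>])
  finally show "g (Q z) = Q z" .
qed

lemma skew_commuting:
  assumes "\<And>i. e * X i = X i * e" "\<And>i. Y i * e = c \<odot> (e * Y i)"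
  shows "e * P z = P z * e" "Q z * e = c \<odot> (e * Q z)"
proof -
  show "e * P z = P z * e"
    unfolding P_def by (rule lin_commute[symmetric, OF \<kappa>X]) (simp_all add: assms \<kappa>_central[of z e])
  have N: "N i (\<kappa> z) * e = e * N i (\<kappa> z)" "N i (X i) * e = e * N i (X i)" for i
    unfolding N_def by (rule lin_commute; simp add: \<kappa>X XX assms \<kappa>_central[of z e])+
  have "y i * N i (\<kappa> z) * e = c \<odot> (e * (y i * N i (\<kappa> z)))" for i
  proof -
    have "y i * N i (\<kappa> z) * e = y i * e * N i (\<kappa> z)" by (simp add: mult.assoc N)
    also have "y i * e = Y i * e * inverse (N i (X i))"
      unfolding y_def using inverse_commutes[OF N(2)] by (simp add: mult.assoc)
    finally show ?thesis by (simp only: assms(2) mult_scale_left y_def mult.assoc)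
  qed
  then show "Q z * e = c \<odot> (e * Q z)"
    unfolding Q_def by (simp add: sum_distrib_left sum_distrib_right scale_sum_right)
qed

end


section \<open>Monomials in a family that commutes up to scalars\<close>

definition qmono :: "('i \<Rightarrow> 'a::monoid_mult) \<Rightarrow> 'i list \<Rightarrow> ('i \<Rightarrow> nat) \<Rightarrow> 'a"
  where "qmono z ls e = prod_list (map (\<lambda>i. z i ^ e i) ls)"

primrec passing :: "('i \<Rightarrow> 'i \<Rightarrow> 'k::comm_monoid_mult) \<Rightarrow> 'i \<Rightarrow> 'i list \<Rightarrow> ('i \<Rightarrow> nat) \<Rightarrow> 'k"
  where "passing \<mu> g [] e = 1"
  | "passing \<mu> g (i # ls) e = (if g = i then 1 else \<mu> g i ^ e i * passing \<mu> g ls e)"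

primrec word_coeff :: "('i \<Rightarrow> 'i \<Rightarrow> 'k::comm_monoid_mult) \<Rightarrow> 'i list \<Rightarrow> 'i list \<Rightarrow> 'k"
  where "word_coeff \<mu> ls [] = 1"
  | "word_coeff \<mu> ls (g # ws) = word_coeff \<mu> ls ws * passing \<mu> g ls (count_list ws)"

definition expand :: "'i list \<Rightarrow> ('i \<Rightarrow> nat) \<Rightarrow> 'i list"
  where "expand ls e = concat (map (\<lambda>i. replicate (e i) i) ls)"

lemma prod_list_replicate_power: "prod_list (replicate n (a::'a::monoid_mult)) = a ^ n"
  by (induction n) simp_all

lemma mono_expand: "qmono z ls e = prod_list (map z (expand ls e))"
  unfolding qmono_def expand_def
  by (induction "ls") (simp_all add: prod_list_replicate_power)

lemma count_list_replicate: "count_list (replicate n x) y = (if x = y then n else 0)"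
  by (induction n) auto

lemma count_expand_notin: "i \<notin> set ls \<Longrightarrow> count_list (expand ls e) i = 0"
  unfolding expand_def by (auto simp: count_list_0_iff)

lemma count_expand: "distinct ls \<Longrightarrow> i \<in> set ls \<Longrightarrow> count_list (expand ls e) i = e i"
proof (induction "ls")
  case (Cons j "ls")
  have "count_list (expand (j # ls) e) i = count_list (replicate (e j) j) i + count_list (expand ls e) i"
    by (simp add: expand_def)
  then show ?case using Cons count_expand_notin[of i "ls" e] by (auto simp: count_list_replicate)
qed simp

locale qfamily = kalgebra \<kappa>
  for \<kappa> :: "'k::field \<Rightarrow> 'a::ring_1" +
  fixes z :: "'i \<Rightarrow> 'a" and \<mu> :: "'i \<Rightarrow> 'i \<Rightarrow> 'k" and enum :: "'i list"
  assumes enum: "distinct enum" "set enum = UNIV"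
    and comm: "z i * z j = \<mu> i j \<odot> (z j * z i)"
begin

lemma pass_power: "z g * z i ^ n = (\<mu> g i ^ n) \<odot> (z i ^ n * z g)"
proof (induction n)
  case (Suc n)
  have "z g * z i ^ Suc n = (z g * z i) * z i ^ n" by (simp add: mult.assoc)
  also have "\<dots> = \<mu> g i \<odot> (z i * (z g * z i ^ n))" by (simp only: comm[of g i] mult_scale_left mult.assoc)
  also have "\<dots> = (\<mu> g i ^ Suc n) \<odot> (z i ^ Suc n * z g)" by (simp only: Suc mult_scale_right scale_scale power_Suc mult.assoc)
  finally show ?case .
qed simp

lemma mono_cong: "(\<And>i. i \<in> set ls \<Longrightarrow> e i = e' i) \<Longrightarrow> qmono z ls e = qmono z ls e'"
  unfolding qmono_def by (metis (mono_tags, lifting) map_eq_conv)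

lemma pass_mono:
  assumes "distinct ls" "g \<in> set ls"
  shows "z g * qmono z ls e = passing \<mu> g ls e \<odot> qmono z ls (e(g := Suc (e g)))"
  using assms
proof (induction "ls")
  case (Cons i "ls")
  show ?case
  proof (cases "g = i")
    case True
    have "qmono z ls (e(g := Suc (e g))) = qmono z ls e"
      by (rule mono_cong) (use True Cons.prems in auto)
    then show ?thesis using True by (simp add: qmono_def mult.assoc)
  next
    case False
    have IH: "z g * qmono z ls e = passing \<mu> g ls e \<odot> qmono z ls (e(g := Suc (e g)))"
      using Cons.IH Cons.prems False by (simp del: fun_upd_apply)
    have "z g * qmono z (i # ls) e = (z g * z i ^ e i) * qmono z ls e" by (simp add: qmono_def mult.assoc)
    also have "\<dots> = (\<mu> g i ^ e i) \<odot> (z i ^ e i * (z g * qmono z ls e))"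
      by (simp only: pass_power mult_scale_left mult.assoc)
    also have "\<dots> = passing \<mu> g (i # ls) e \<odot> qmono z (i # ls) (e(g := Suc (e g)))"
      unfolding IH using False by (simp add: mult_scale_right qmono_def)
    finally show ?thesis .
  qed
qed simp

text \<open>The normal form of a word depends on the scalars only.\<close>

lemma word_normal_form: "prod_list (map z ws) = word_coeff \<mu> enum ws \<odot> qmono z enum (count_list ws)"
proof (induction ws)
  case Nil
  have "qmono z is (\<lambda>_. 0) = 1" for "is" by (induction "is") (simp_all add: qmono_def)
  then show ?case by (simp add: count_list.simps(1)[abs_def])
next
  case (Cons g ws)
  have "(count_list ws)(g := Suc (count_list ws g)) = count_list (g # ws)" by auto
  moreover have "prod_list (map z (g # ws)) = word_coeff \<mu> enum ws \<odot> (z g * qmono z enum (count_list ws))"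
    by (simp add: Cons mult_scale_right)
  moreover have "z g * qmono z enum (count_list ws)
      = passing \<mu> g enum (count_list ws) \<odot> qmono z enum ((count_list ws)(g := Suc (count_list ws g)))"
    by (rule pass_mono) (simp_all add: enum)
  ultimately show ?case by (simp only: scale_scale word_coeff.simps)
qed

lemma mono_mult:
  "qmono z enum e * qmono z enum e' = word_coeff \<mu> enum (expand enum e @ expand enum e') \<odot> qmono z enum (\<lambda>i. e i + e' i)"
proof -
  have "count_list (expand enum e @ expand enum e') = (\<lambda>i. e i + e' i)"
  proof -
    have "count_list (expand enum f) i = f i" for f i
      using enum by (intro count_expand) auto
    then show ?thesis by (simp add: fun_eq_iff)
  qed
  then show ?thesis
    using word_normal_form[of "expand enum e @ expand enum e'"] by (simp add: mono_expand)
qed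

lemma passing_nonzero: "(\<And>i j. \<mu> i j \<noteq> 0) \<Longrightarrow> passing \<mu> g is e \<noteq> 0"
  by (induction "is") auto

lemma word_coeff_nonzero: "(\<And>i j. \<mu> i j \<noteq> 0) \<Longrightarrow> word_coeff \<mu> enum ws \<noteq> 0"
  using passing_nonzero by (induction ws) auto

end

context kalgebra
begin

definition free_family :: "('e \<Rightarrow> 'a) \<Rightarrow> bool"
  where "free_family f \<longleftrightarrow> (\<forall>E r. finite E \<longrightarrow> (\<Sum>e\<in>E. r e \<odot> f e) = 0 \<longrightarrow> (\<forall>e\<in>E. r e = 0))"

end

section \<open>Counting monomials\<close>

context skew_kalgebra
begin

lemma subspace_unscale:
  assumes "subspace V" "c \<odot> a \<in> V" "c \<noteq> 0"
  shows "a \<in> V"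
proof -
  have "a = inverse c \<odot> (c \<odot> a)" using assms(3) by simp
  then show ?thesis using subspace_scale[OF assms(1,2)] by metis
qed

lemma free_family_bound:
  assumes "free_family f" "finite E" "finite T" "f ` E \<subseteq> span T"
  shows "card E \<le> card T"
proof -
  have free: "\<And>r E. finite E \<Longrightarrow> (\<Sum>e\<in>E. r e \<odot> f e) = 0 \<Longrightarrow> \<forall>e\<in>E. r e = 0"
    using assms(1) unfolding free_family_def by blast
  have inj: "inj_on f E"
  proof (rule inj_onI)
    fix a b assume ab: "f a = f b"
    show "a = b"
    proof (rule ccontr)
      assume "a \<noteq> b"
      then have "(\<Sum>e\<in>{a, b}. (if e = a then 1 else - 1) \<odot> f e) = 0" using ab by simp
      from free[OF _ this] show False by simp
    qed
  qed
  have "independent (f ` E)"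
    unfolding dependent_finite[OF finite_imageI[OF assms(2)]]
  proof clarify
    fix u e assume s: "(\<Sum>v\<in>f ` E. u v \<odot> v) = 0" and e: "e \<in> E" "u (f e) \<noteq> 0"
    have "(\<Sum>e\<in>E. u (f e) \<odot> f e) = 0" using s by (simp add: sum.reindex[OF inj])
    from free[OF assms(2) this] e show False by blast
  qed
  then have "card (f ` E) \<le> card T"
    using independent_span_bound[OF assms(3) _ assms(4)] by blast
  then show ?thesis by (simp add: card_image[OF inj])
qed

lemma free_family_mult_left:
  assumes "free_family f" "b \<noteq> 0"
  shows "free_family (\<lambda>e. b * f e)"
  unfolding free_family_def
proof (intro allI impI)
  fix E r assume E: "finite E" and "(\<Sum>e\<in>E. r e \<odot> (b * f e)) = 0"
  then have "b * (\<Sum>e\<in>E. r e \<odot> f e) = 0" by (simp add: sum_distrib_left mult_scale_right)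
  then show "\<forall>e\<in>E. r e = 0" using assms E unfolding free_family_def by auto
qed

end

definition box :: "nat \<Rightarrow> ('i \<Rightarrow> nat) set"
  where "box M = {e. \<forall>i. e i \<le> M}"

lemma box_add: "e \<in> box M \<Longrightarrow> e' \<in> box M' \<Longrightarrow> (\<lambda>i. e i + e' i) \<in> box (M + M')"
  by (simp add: box_def add_mono)

lemma card_box: "finite (box M :: ('i::finite \<Rightarrow> nat) set)" "card (box M :: ('i \<Rightarrow> nat) set) = Suc M ^ card (UNIV :: 'i set)"
proof -
  have *: "(box M :: ('i \<Rightarrow> nat) set) = PiE UNIV (\<lambda>_. {..M})"
    by (auto simp: box_def PiE_def)
  show "finite (box M :: ('i::finite \<Rightarrow> nat) set)" unfolding * by (intro finite_PiE) auto
  show "card (box M :: ('i \<Rightarrow> nat) set) = Suc M ^ card (UNIV :: 'i set)"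
    unfolding * by (subst card_PiE) simp_all
qed

lemma power_add_bound: "(s + K) ^ Suc N \<le> s ^ Suc N + Suc N * K * (s + K) ^ N" for s K :: nat
proof (induction N)
  case 0
  then show ?case by simp
next
  case (Suc N)
  have p: "s ^ Suc N \<le> (s + K) ^ Suc N" by (rule power_mono) simp_all
  have "(s + K) ^ Suc (Suc N) = (s + K) * (s + K) ^ Suc N" by simp
  also have "\<dots> \<le> (s + K) * (s ^ Suc N + Suc N * K * (s + K) ^ N)"
    by (rule mult_left_mono[OF Suc]) simp
  also have "\<dots> = s * s ^ Suc N + K * s ^ Suc N + Suc N * K * ((s + K) * (s + K) ^ N)"
    by (simp only: distrib_left distrib_right mult.assoc mult.left_commute add.assoc)
  also have "\<dots> \<le> s * s ^ Suc N + K * (s + K) ^ Suc N + Suc N * K * ((s + K) * (s + K) ^ N)"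
    using mult_left_mono[OF p, of K] by simp
  also have "\<dots> = s ^ Suc (Suc N) + Suc (Suc N) * K * (s + K) ^ Suc N"
    by (simp only: power_Suc mult_Suc distrib_right mult.assoc add.assoc)
  finally show ?case .
qed

text \<open>A linear weight that separates the exponents with entries below \<open>B\<close>.\<close>

primrec weight :: "nat \<Rightarrow> 'i list \<Rightarrow> ('i \<Rightarrow> nat) \<Rightarrow> nat"
  where "weight B [] e = 0"
  | "weight B (i # ls) e = e i + B * weight B ls e"

lemma weight_add: "weight B ls (\<lambda>i. e i + e' i) = weight B ls e + weight B ls e'"
  by (induction "ls") (simp_all add: algebra_simps)

lemma weight_inj:
  assumes "weight B ls e = weight B ls e'" "\<And>i. e i < B" "\<And>i. e' i < B" "i \<in> set ls"
  shows "e i = e' i"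
  using assms(1,4)
proof (induction "ls")
  case (Cons j "ls")
  have B: "0 < B" using assms(2)[of i] by simp
  have m: "weight B (j # ls) f mod B = f j" "weight B (j # ls) f div B = weight B ls f" if "f j < B" for f
    using that B by simp_all
  have "e j = e' j"
    using m(1)[of e, OF assms(2)] m(1)[of e', OF assms(3)] unfolding Cons.prems(1) by simp
  moreover have "weight B ls e = weight B ls e'"
    using m(2)[of e, OF assms(2)] m(2)[of e', OF assms(3)] unfolding Cons.prems(1) by simp
  ultimately show ?case using Cons.IH Cons.prems(2) by (cases "i = j") simp_all
qed simp

locale qtorus = skew_kalgebra \<kappa> + qfamily \<kappa> z \<mu> enum
  for \<kappa> :: "'k::field_char_0 \<Rightarrow> 'f::division_ring" and z :: "'i::finite \<Rightarrow> 'f" and \<mu> enum +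
  assumes z_nonzero: "z i \<noteq> 0"
begin

abbreviation mon :: "('i \<Rightarrow> nat) \<Rightarrow> 'f"
  where "mon \<equiv> qmono z enum"

lemma \<mu>_nonzero: "\<mu> i j \<noteq> 0"
  using comm[of i j] z_nonzero[of i] z_nonzero[of j] by (metis mult_eq_0_iff scale_zero_left)

definition poly_part :: "nat \<Rightarrow> 'f set"
  where "poly_part M = span (mon ` box M)"

definition full :: 'f
  where "full = mon (\<lambda>_. 1)"

lemma mon_nonzero: "mon e \<noteq> 0"
proof -
  have "qmono z ls e \<noteq> 0" for "ls" by (induction "ls") (simp_all add: qmono_def z_nonzero)
  then show ?thesis .
qed

lemma full_nonzero: "full \<noteq> 0"
  unfolding full_def by (rule mon_nonzero)

lemma poly_part_mono: "M \<le> M' \<Longrightarrow> poly_part M \<subseteq> poly_part M'"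
  unfolding poly_part_def by (intro span_mono image_mono) (auto simp: box_def intro: order_trans)

lemma mon_in: "e \<in> box M \<Longrightarrow> mon e \<in> poly_part M"
  unfolding poly_part_def by (intro span_base imageI)

lemma subspace_poly_part: "subspace (poly_part M)"
  unfolding poly_part_def by (rule subspace_span)

lemma poly_part_mult:
  assumes "a \<in> poly_part M" "b \<in> poly_part M'"
  shows "a * b \<in> poly_part (M + M')"
  using assms(1) unfolding poly_part_def[of M]
proof (induction rule: span_induct_alt)
  case base
  then show ?case using subspace_0[OF subspace_poly_part] by simp
next
  case (step c m a)
  from step(1) obtain e where e: "e \<in> box M" "m = mon e" by blast
  have "mon e * b \<in> poly_part (M + M')"
    using assms(2) unfolding poly_part_def[of M']
  proof (induction rule: span_induct_alt)
    case base
    then show ?case using subspace_0[OF subspace_poly_part] by simp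
  next
    case (step c m a)
    from step(1) obtain e' where e': "e' \<in> box M'" "m = mon e'" by blast
    have "(\<lambda>i. e i + e' i) \<in> box (M + M')" using e(1) e'(1) by (simp add: box_def add_mono)
    then have "mon e * m \<in> poly_part (M + M')"
      unfolding e'(2) mono_mult by (intro subspace_scale[OF subspace_poly_part] mon_in)
    then show ?case unfolding distrib_left mult_scale_right
      using step(2) by (intro subspace_add subspace_scale subspace_poly_part)
  qed
  then show ?case unfolding distrib_right mult_scale_left e(2)
    using step(2) by (intro subspace_add subspace_scale subspace_poly_part)
qed

lemma full_pow_in: "full ^ C \<in> poly_part C"
proof (induction C)
  case 0
  have "mon (\<lambda>_. 0) = 1"
  proof -
    have "qmono z ls (\<lambda>_. 0) = 1" for "ls" by (induction "ls") (simp_all add: qmono_def)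
    then show ?thesis .
  qed
  then show ?case using mon_in[of "\<lambda>_. 0" 0] by (simp add: box_def)
next
  case (Suc C)
  have "full \<in> poly_part 1" unfolding full_def by (rule mon_in) (simp add: box_def)
  from poly_part_mult[OF this Suc] show ?case by simp
qed

lemma mon_full: "\<exists>c. mon e * full = c \<odot> (full * mon e)"
proof -
  let ?c = "\<lambda>e e'. word_coeff \<mu> enum (expand enum e @ expand enum e')"
  have 1: "full * mon e = ?c (\<lambda>_. 1) e \<odot> mon (\<lambda>i. 1 + e i)"
    unfolding full_def by (rule mono_mult)
  have "mon e * full = ?c e (\<lambda>_. 1) \<odot> mon (\<lambda>i. e i + 1)"
    unfolding full_def by (rule mono_mult)
  also have "\<dots> = (?c e (\<lambda>_. 1) * inverse (?c (\<lambda>_. 1) e)) \<odot> (full * mon e)"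
    unfolding 1 using word_coeff_nonzero[OF \<mu>_nonzero] by simp
  finally show ?thesis by blast
qed

lemma poly_part_full:
  assumes "a \<in> poly_part M"
  shows "\<exists>b\<in>poly_part M. a * full ^ C = full ^ C * b"
proof (induction C)
  case 0
  then show ?case using assms by auto
next
  case (Suc C)
  then obtain b where b: "b \<in> poly_part M" "a * full ^ C = full ^ C * b" by blast
  have "\<exists>b'\<in>poly_part M. b * full = full * b'"
    using b(1) unfolding poly_part_def[of M]
  proof (induction rule: span_induct_alt)
    case base
    then show ?case using span_zero by (intro bexI[of _ 0]) auto
  next
    case (step c m a)
    then obtain b' where b': "b' \<in> span (mon ` box M)" "a * full = full * b'" by blast
    from step(1) obtain e where e: "e \<in> box M" "m = mon e" by blast
    obtain d where "mon e * full = d \<odot> (full * mon e)" using mon_full by blast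
    then have "(c \<odot> m + a) * full = full * ((c * d) \<odot> m + b')"
      by (simp add: e distrib_left distrib_right mult_scale_left mult_scale_right b')
    moreover have "(c * d) \<odot> m + b' \<in> span (mon ` box M)"
      by (rule span_add[OF span_scale[OF span_base[OF step(1)]] b'(1)])
    ultimately show ?case by blast
  qed
  then obtain b' where "b' \<in> poly_part M" "b * full = full * b'" by blast
  moreover have "a * full ^ Suc C = full ^ C * (b * full)" 
    using b(2) by (metis mult.assoc power_Suc2)
  ultimately show ?case by (intro bexI[of _ b']) (simp_all add: power_Suc2 mult.assoc del: power_Suc)
qed

definition laurent_part :: "nat \<Rightarrow> 'f set"
  where "laurent_part C = {b. full ^ C * b \<in> poly_part (2 * C)}"

definition laurent :: "'f set"
  where "laurent = (\<Union>C. laurent_part C)"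

lemma laurent_part_Suc: "laurent_part C \<subseteq> laurent_part (Suc C)"
proof
  fix b assume "b \<in> laurent_part C"
  then have "full * (full ^ C * b) \<in> poly_part (1 + 2 * C)"
    unfolding laurent_part_def using poly_part_mult[of full 1] full_pow_in[of 1] by simp
  then show "b \<in> laurent_part (Suc C)"
    unfolding laurent_part_def using poly_part_mono[of "1 + 2 * C" "2 * Suc C"] by (auto simp: mult.assoc)
qed

lemma laurent_part_mono: "C \<le> C' \<Longrightarrow> laurent_part C \<subseteq> laurent_part C'"
  by (rule lift_Suc_mono_le[of laurent_part]) (rule laurent_part_Suc)

lemma laurent_part_mult:
  assumes "a \<in> laurent_part C" "b \<in> laurent_part C'"
  shows "a * b \<in> laurent_part (C + C')"
proof -
  obtain a' where a': "a' \<in> poly_part (2 * C)" "(full ^ C * a) * full ^ C' = full ^ C' * a'"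
    using poly_part_full assms(1) unfolding laurent_part_def by blast
  have "full ^ C' * (full ^ C' * (full ^ C * (a * b))) = full ^ C' * (full ^ C' * (full ^ C * a) * b)"
    by (simp add: mult.assoc)
  obtain a'' where a'': "a'' \<in> poly_part (2 * C)" "full ^ C' * (full ^ C * a) = a'' * full ^ C'"
  proof -
    have inv: "\<exists>b'\<in>poly_part M. full * b = b' * full" if "b \<in> poly_part M" for b M
      using that unfolding poly_part_def[of M]
    proof (induction rule: span_induct_alt)
      case base
      then show ?case using span_zero by (intro bexI[of _ 0]) auto
    next
      case (step c m a)
      then obtain b' where b': "b' \<in> span (mon ` box M)" "full * a = b' * full" by blast
      from step(1) obtain e where e: "e \<in> box M" "m = mon e" by blast
      obtain d where d: "mon e * full = d \<odot> (full * mon e)" using mon_full by blast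
      have "d \<noteq> 0" using d mon_nonzero full_nonzero by (metis mult_eq_0_iff scale_zero_left)
      then have "full * mon e = inverse d \<odot> (mon e * full)" by (simp add: d)
      then have "full * (c \<odot> m + a) = ((c * inverse d) \<odot> m + b') * full"
        by (simp add: e distrib_left distrib_right mult_scale_left mult_scale_right b')
      moreover have "(c * inverse d) \<odot> m + b' \<in> span (mon ` box M)"
        by (rule span_add[OF span_scale[OF span_base[OF step(1)]] b'(1)])
      ultimately show ?case by blast
    qed
    have "\<exists>b'\<in>poly_part M. full ^ n * b = b' * full ^ n" if "b \<in> poly_part M" for b M n
    proof (induction n)
      case 0
      then show ?case using that by auto
    next
      case (Suc n)
      then obtain b' where b': "b' \<in> poly_part M" "full ^ n * b = b' * full ^ n" by blast
      obtain b'' where b'': "b'' \<in> poly_part M" "full * b' = b'' * full" using inv[OF b'(1)] by blast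
      have "full ^ Suc n * b = b'' * full ^ Suc n" using b'(2) b''(2) by (metis mult.assoc power_Suc)
      then show ?case using b''(1) by blast
    qed
    from this[of "full ^ C * a" "2 * C" C'] show thesis using that assms(1) unfolding laurent_part_def by blast
  qed
  have "full ^ (C + C') * (a * b) = full ^ C' * (full ^ C * a) * b"
    by (simp add: power_add mult.assoc add.commute[of C])
  also have "\<dots> = a'' * (full ^ C' * b)" unfolding a''(2) by (simp add: mult.assoc)
  also have "\<dots> \<in> poly_part (2 * C + 2 * C')"
    using a''(1) assms(2) unfolding laurent_part_def by (intro poly_part_mult) auto
  finally show ?thesis by (simp add: laurent_part_def distrib_left)
qed

lemma subspace_laurent_part: "subspace (laurent_part C)"
  unfolding laurent_part_def subspace_def
  using subspace_poly_part[of "2 * C"] by (auto simp: subspace_def distrib_left mult_scale_right)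

lemma laurent_part_one: "1 \<in> laurent_part C"
  unfolding laurent_part_def using full_pow_in[of C] poly_part_mono[of C "2 * C"] by auto

lemma subalg_laurent: "subalg laurent"
  unfolding subalg_def
proof (intro conjI ballI subsetI)
  fix a assume "a \<in> range \<kappa>"
  then obtain c where "a = c \<odot> 1" by (auto simp: scale_def)
  then show "a \<in> laurent"
    unfolding laurent_def using laurent_part_one[of 0] subspace_scale[OF subspace_laurent_part] by blast
next
  fix a b assume "a \<in> laurent" "b \<in> laurent"
  then obtain C C' where "a \<in> laurent_part C" "b \<in> laurent_part C'" unfolding laurent_def by blast
  then have ab: "a \<in> laurent_part (C + C')" "b \<in> laurent_part (C + C')" and "a * b \<in> laurent_part (C + C')"
    using laurent_part_mono[of C "C + C'"] laurent_part_mono[of C' "C + C'"] laurent_part_mult by auto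
  then show "a + b \<in> laurent" "a - b \<in> laurent" "a * b \<in> laurent"
    unfolding laurent_def
    using subspace_add[OF subspace_laurent_part ab] subspace_diff[OF subspace_laurent_part ab] by blast+
qed

lemma z_laurent: "z i \<in> laurent" "inverse (z i) \<in> laurent"
proof -
  have z: "z i = mon (\<lambda>j. if j = i then 1 else 0)"
  proof -
    have "qmono z ls (\<lambda>j. if j = i then 1 else 0) = (if i \<in> set ls then z i else 1)" if "distinct ls" for "ls"
      using that by (induction "ls") (auto simp: qmono_def)
    then show ?thesis using enum by simp
  qed
  have "full * z i \<in> poly_part (1 + 1)"
    using full_pow_in[of 1] mon_in[of "\<lambda>j. if j = i then 1 else 0" 1] 
    unfolding z by (intro poly_part_mult) (auto simp: box_def)
  then have "z i \<in> laurent_part 1" by (simp add: laurent_part_def numeral_2_eq_2)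
  then show "z i \<in> laurent" unfolding laurent_def by blast
  let ?e = "\<lambda>j. if j = i then 0 else 1 :: nat"
  have "mon ?e * z i = word_coeff \<mu> enum (expand enum ?e @ expand enum (\<lambda>j. if j = i then 1 else 0)) \<odot> full"
  proof -
    have "(\<lambda>j. ?e j + (if j = i then 1 else 0)) = (\<lambda>_. 1)" by auto
    then show ?thesis unfolding full_def by (subst (1) z) (simp only: mono_mult)
  qed
  then obtain c where c: "mon ?e * z i = c \<odot> full" "c \<noteq> 0"
    using word_coeff_nonzero[OF \<mu>_nonzero] by blast
  have "full * inverse (z i) = inverse c \<odot> ((c \<odot> full) * inverse (z i))"
    using c(2) by (simp add: mult_scale_left)
  also have "\<dots> = inverse c \<odot> mon ?e"
    unfolding c(1)[symmetric] using z_nonzero by (simp add: mult.assoc)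
  also have "\<dots> \<in> poly_part 2"
    by (intro subspace_scale[OF subspace_poly_part] mon_in) (auto simp: box_def)
  finally have "inverse (z i) \<in> laurent_part 1" by (simp add: laurent_part_def)
  then show "inverse (z i) \<in> laurent" unfolding laurent_def by blast
qed

text \<open>
  One relation among the monomials of degree at most \<open>K\<close> in each variable makes the monomials
  over a shifted box redundant, since the largest monomial of the relation can be traded for
  smaller ones.
\<close>

lemma poly_part_relation:
  assumes "finite A" "A \<subseteq> box K" "(\<Sum>e\<in>A. r e \<odot> mon e) = 0" "e0 \<in> A" "r e0 \<noteq> 0"
  shows "\<exists>e1\<in>box K. \<forall>M. poly_part (M + K) \<subseteq> span (mon ` (box (M + K) - (\<lambda>b i. e1 i + b i) ` box M))"
proof -
  let ?w = "weight (Suc K) enum"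
  define A' where "A' = {e\<in>A. r e \<noteq> 0}"
  have A': "finite A'" "A' \<noteq> {}" "A' \<subseteq> box K" using assms by (auto simp: A'_def)
  have sumA': "(\<Sum>e\<in>A'. r e \<odot> mon e) = 0"
    using sum.mono_neutral_left[of A A' "\<lambda>e. r e \<odot> mon e"] assms by (auto simp: A'_def)
  have "Max (?w ` A') \<in> ?w ` A'" using A' by (intro Max_in) auto
  then obtain e1 where e1: "e1 \<in> A'" "Max (?w ` A') = ?w e1" by blast
  have le: "?w e \<le> ?w e1" if "e \<in> A'" for e
    unfolding e1(2)[symmetric] using that A'(1) by (intro Max_ge) auto
  have lt: "?w e < ?w e1" if "e \<in> A'" "e \<noteq> e1" for e
  proof -
    have "?w e \<noteq> ?w e1"
    proof
      assume "?w e = ?w e1"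
      then have "e i = e1 i" for i
        using weight_inj[of "Suc K" enum e e1 i] that e1 A'(3) enum(2) by (auto simp: box_def less_Suc_eq_le)
      then show False using that by auto
    qed
    then show ?thesis using le[OF that(1)] by simp
  qed
  have "mon e \<in> span (mon ` (box (M + K) - (\<lambda>b i. e1 i + b i) ` box M))" (is "_ \<in> ?S M") if "e \<in> box (M + K)" for M e
    using that
  proof (induction "?w e" arbitrary: e rule: less_induct)
    case less
    show ?case
    proof (cases "e \<in> (\<lambda>b i. e1 i + b i) ` box M")
      case False
      then show ?thesis using less.prems by (intro span_base) auto
    next
      case True
      then obtain b where b: "b \<in> box M" "e = (\<lambda>i. e1 i + b i)" by blast
      let ?c = "\<lambda>a. word_coeff \<mu> enum (expand enum a @ expand enum b)"
      have "(\<Sum>a\<in>A'. (r a * ?c a) \<odot> mon (\<lambda>i. a i + b i)) = (\<Sum>a\<in>A'. r a \<odot> mon a) * mon b"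
        by (simp add: sum_distrib_right mult_scale_left mono_mult)
      then have "(\<Sum>a\<in>A'. (r a * ?c a) \<odot> mon (\<lambda>i. a i + b i)) = 0" using sumA' by simp
      then have "(r e1 * ?c e1) \<odot> mon e = - (\<Sum>a\<in>A' - {e1}. (r a * ?c a) \<odot> mon (\<lambda>i. a i + b i))"
        using A'(1) e1(1) by (simp add: sum.remove[of A' e1] b eq_neg_iff_add_eq_0)
      moreover have "(\<Sum>a\<in>A' - {e1}. (r a * ?c a) \<odot> mon (\<lambda>i. a i + b i)) \<in> ?S M"
      proof (intro span_sum span_scale)
        fix a assume a: "a \<in> A' - {e1}"
        have "?w (\<lambda>i. a i + b i) < ?w e" unfolding b weight_add using lt a by simp
        moreover have "(\<lambda>i. a i + b i) \<in> box (M + K)"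
        proof -
          have "a \<in> box K" using a A'(3) by blast
          from box_add[OF this b(1)] show ?thesis by (simp only: add.commute)
        qed
        ultimately show "mon (\<lambda>i. a i + b i) \<in> ?S M" using less.hyps by blast
      qed
      ultimately have "(r e1 * ?c e1) \<odot> mon e \<in> ?S M" by (simp only: span_neg)
      moreover have "r e1 * ?c e1 \<noteq> 0"
        using e1(1) word_coeff_nonzero[OF \<mu>_nonzero] by (simp add: A'_def)
      ultimately show ?thesis by (rule subspace_unscale[OF subspace_span])
    qed
  qed
  then have "poly_part (M + K) \<subseteq> ?S M" for M
    unfolding poly_part_def by (intro span_minimal subspace_span) auto
  then show ?thesis using e1(1) A'(3) by blast
qed

text \<open>
  If a free family of monomials in as many variables is finite over the Laurent polynomials in
  \<open>z\<close>, then the monomials in \<open>z\<close> are free: a relation would lower the order of growth.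
\<close>

lemma free_by_growth:
  fixes x :: "'j::finite \<Rightarrow> 'f"
  assumes free: "free_family (qmono x js)" and card: "card (UNIV :: 'i set) = card (UNIV :: 'j set)"
    and js: "distinct js" "set js = UNIV"
    and Ms: "finite Ms" "1 \<in> Ms"
    and step: "\<And>m g. m \<in> Ms \<Longrightarrow> \<exists>b. (\<forall>m'\<in>Ms. b m' \<in> laurent) \<and> m * x g = (\<Sum>m'\<in>Ms. b m' * m')"
  shows "free_family mon"
proof (rule ccontr)
  assume "\<not> free_family mon"
  then obtain A r e0 where A: "finite A" "(\<Sum>e\<in>A. r e \<odot> mon e) = 0" "e0 \<in> A" "r e0 \<noteq> 0"
    unfolding free_family_def by blast
  obtain K where K: "A \<subseteq> box K"
  proof
    show "A \<subseteq> box (Max (insert 0 ((\<lambda>(e, i). e i) ` (A \<times> UNIV))))"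
    proof
      fix e assume "e \<in> A"
      then have "e i \<le> Max (insert 0 ((\<lambda>(e, i). e i) ` (A \<times> UNIV)))" for i
        using A(1) by (intro Max_ge) (auto simp: image_iff)
      then show "e \<in> box (Max (insert 0 ((\<lambda>(e, i). e i) ` (A \<times> UNIV))))" by (simp add: box_def)
    qed
  qed
  obtain e1 where e1: "e1 \<in> box K"
    and red: "\<And>M. poly_part (M + K) \<subseteq> span (mon ` (box (M + K) - (\<lambda>b i. e1 i + b i) ` box M))"
    using poly_part_relation[OF A(1) K A(2-4)] by blast
  define N where "N = card (UNIV :: 'i set)"
  have N0: "N \<noteq> 0" by (simp add: N_def)
  then obtain N' where N': "N = Suc N'" using not0_implies_Suc by blast
  let ?R = "\<lambda>C. {a. \<exists>b. (\<forall>m\<in>Ms. b m \<in> laurent_part C) \<and> a = (\<Sum>m\<in>Ms. b m * m)}"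
  obtain s where s: "\<And>m g m'. m \<in> Ms \<Longrightarrow> m' \<in> Ms \<Longrightarrow> s m g m' \<in> laurent"
    and sx: "\<And>m g. m \<in> Ms \<Longrightarrow> m * x g = (\<Sum>m'\<in>Ms. s m g m' * m')"
    using step by metis
  obtain c where c: "\<And>m g m'. m \<in> Ms \<Longrightarrow> m' \<in> Ms \<Longrightarrow> s m g m' \<in> laurent_part c"
  proof -
    have "\<exists>C. a \<in> laurent_part C" if "a \<in> laurent" for a using that unfolding laurent_def by blast
    then obtain C where C: "\<And>a. a \<in> laurent \<Longrightarrow> a \<in> laurent_part (C a)" by metis
    let ?S = "(\<lambda>(m, g, m'). C (s m g m')) ` (Ms \<times> UNIV \<times> Ms)"
    have fin: "finite ?S" using Ms(1) by simp
    have "s m g m' \<in> laurent_part (Max ?S)" if "m \<in> Ms" "m' \<in> Ms" for m g m'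
    proof -
      have "C (s m g m') \<le> Max ?S" using that by (intro Max_ge[OF fin]) (auto intro!: image_eqI[of _ _ "(m, g, m')"])
      then show ?thesis using C[OF s[OF that]] laurent_part_mono by blast
    qed
    then show thesis using that by blast
  qed
  have R_step: "a * x g \<in> ?R (C + c)" if "a \<in> ?R C" for a g C
  proof -
    obtain b where b: "\<forall>m\<in>Ms. b m \<in> laurent_part C" "a = (\<Sum>m\<in>Ms. b m * m)" using \<open>a \<in> ?R C\<close> by blast
    have "a * x g = (\<Sum>m\<in>Ms. \<Sum>m'\<in>Ms. b m * s m g m' * m')"
      unfolding b(2) by (simp add: sum_distrib_right sum_distrib_left mult.assoc sx)
    also have "\<dots> = (\<Sum>m'\<in>Ms. (\<Sum>m\<in>Ms. b m * s m g m') * m')"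
      by (subst sum.swap) (simp add: sum_distrib_right)
    finally show ?thesis
      using b(1) c by (auto intro!: exI[of _ "\<lambda>m'. \<Sum>m\<in>Ms. b m * s m g m'"] 
         subspace_sum[OF subspace_laurent_part] laurent_part_mult)
  qed
  have R_mono: "?R C \<subseteq> ?R C'" if "C \<le> C'" for C C'
    using laurent_part_mono[OF that] by blast
  have R_word: "prod_list (map x ws) \<in> ?R (length ws * c)" for ws
  proof (induction ws rule: rev_induct)
    case Nil
    have "1 = (\<Sum>m\<in>Ms. (if m = 1 then 1 else 0) * m)" using Ms by (simp add: if_distrib[of "\<lambda>a. a * _"] sum.delta cong: if_cong)
    then show ?case using laurent_part_one subspace_0[OF subspace_laurent_part]
      by (auto intro!: exI[of _ "\<lambda>m. if m = 1 then 1 else 0"])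
  next
    case (snoc g ws)
    from R_step[OF snoc, of g] show ?case by (simp add: add.commute)
  qed
  have len: "length (expand js e) \<le> N * M" if "e \<in> box M" for e :: "'j \<Rightarrow> nat" and M
  proof -
    have "length (expand ls e) \<le> length ls * M" for "ls"
      using that by (induction "ls") (auto simp: expand_def box_def add_mono)
    then show ?thesis using js distinct_card[OF js(1)] card by (metis N_def)
  qed
  define L where "L = card Ms"
  have main: "Suc m ^ N \<le> L * (N * K * ((2 * c * N + 2 * K + 1) * Suc m) ^ N')" for m
  proof -
    define T where "T = N * m * c + K"
    define M where "M = 2 * T - K"
    have MK: "M + K = 2 * T" by (simp add: M_def T_def)
    let ?red = "box (M + K) - (\<lambda>b i. e1 i + b i) ` box M"
    let ?G = "(\<lambda>(e, m). mon e * m) ` (?red \<times> Ms)"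
    have fin: "finite ?red" by (simp add: card_box)
    have "full ^ T * qmono x js e \<in> span ?G" if "e \<in> box m" for e
    proof -
      have "qmono x js e \<in> ?R T"
        unfolding mono_expand using R_word[of "expand js e"] R_mono[of "length (expand js e) * c" T] len[OF that]
        by (auto simp: T_def intro!: trans_le_add1 mult_right_mono)
      then obtain b where b: "\<forall>m\<in>Ms. b m \<in> laurent_part T" "qmono x js e = (\<Sum>m\<in>Ms. b m * m)" by blast
      have "full ^ T * qmono x js e = (\<Sum>m\<in>Ms. (full ^ T * b m) * m)"
        unfolding b(2) by (simp add: sum_distrib_left mult.assoc)
      also have "\<dots> \<in> span ?G"
      proof (rule span_sum)
        fix m assume m: "m \<in> Ms"
        then have "full ^ T * b m \<in> span (mon ` ?red)"
          using b(1) red[of M] unfolding laurent_part_def MK by blast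
        then show "full ^ T * b m * m \<in> span ?G"
        proof (induction rule: span_induct_alt)
          case base
          then show ?case by (simp add: span_zero)
        next
          case (step c a b)
          then obtain e where "e \<in> ?red" "a = mon e" by blast
          then have am: "a * m \<in> ?G" using m by force
          show ?case unfolding distrib_right mult_scale_left
            by (rule span_add[OF span_scale[OF span_base[OF am]] step(2)])
        qed
      qed
      finally show ?thesis .
    qed
    then have "card (box m :: ('j \<Rightarrow> nat) set) \<le> card ?G"
      using fin Ms(1) full_nonzero
      by (intro free_family_bound[OF free_family_mult_left[OF free, of "full ^ T"]] card_box) auto
    also have "\<dots> \<le> card (?red \<times> Ms)" using fin Ms(1) by (intro card_image_le) auto
    also have "\<dots> = card ?red * L" by (simp add: card_cartesian_product L_def)
    also have "card ?red = Suc (M + K) ^ N - Suc M ^ N"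
    proof -
      have inj: "inj_on (\<lambda>b i. e1 i + b i) (box M)" by (auto simp: inj_on_def fun_eq_iff)
      have "(\<lambda>b i. e1 i + b i) ` box M \<subseteq> box (K + M)"
        using box_add[OF e1] by blast
      then have "(\<lambda>b i. e1 i + b i) ` box M \<subseteq> box (M + K)"
        by (simp only: add.commute)
      then show ?thesis
        by (simp add: card_Diff_subset card_box card_image[OF inj] N_def)
    qed
    also have "\<dots> \<le> N * K * Suc (M + K) ^ N'"
      using power_add_bound[of "Suc M" K N'] by (simp add: N')
    finally have "Suc m ^ N \<le> N * K * Suc (M + K) ^ N' * L"
      using card by (simp add: card_box N_def)
    also have "\<dots> \<le> N * K * ((2 * c * N + 2 * K + 1) * Suc m) ^ N' * L"
    proof -
      have "Suc (M + K) \<le> (2 * c * N + 2 * K + 1) * Suc m"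
        unfolding MK T_def by (simp add: algebra_simps)
      then show ?thesis by (intro mult_le_mono1 mult_le_mono2 power_mono) simp_all
    qed
    finally show ?thesis by (simp only: mult.commute[of L])
  qed
  define B where "B = L * (N * K * (2 * c * N + 2 * K + 1) ^ N')"
  have "Suc m \<le> B" for m
  proof -
    have "Suc m * Suc m ^ N' \<le> B * Suc m ^ N'"
      using main[of m] unfolding B_def power_mult_distrib by (simp only: N' power_Suc mult.assoc)
    then show ?thesis unfolding mult_le_cancel2 by simp
  qed
  then show False using not_less_eq_eq by blast
qed

end


section \<open>Left spans over a division subring\<close>

lemma linear_system:
  fixes a :: "'i \<Rightarrow> 'm \<Rightarrow> 'f::division_ring"
  assumes "finite M" "finite I" "card M < card I"
    and D: "1 \<in> D" "\<And>a b. a \<in> D \<Longrightarrow> b \<in> D \<Longrightarrow> a - b \<in> D" "\<And>a b. a \<in> D \<Longrightarrow> b \<in> D \<Longrightarrow> a * b \<in> D"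
      "\<And>a. a \<in> D \<Longrightarrow> inverse a \<in> D"
    and a: "\<And>i m. i \<in> I \<Longrightarrow> m \<in> M \<Longrightarrow> a i m \<in> D"
  shows "\<exists>d. (\<forall>i\<in>I. d i \<in> D) \<and> (\<exists>i\<in>I. d i \<noteq> 0) \<and> (\<forall>m\<in>M. (\<Sum>i\<in>I. d i * a i m) = 0)"
  using assms(1-3) a
proof (induction M arbitrary: I a rule: finite_induct)
  case empty
  then obtain i where "i \<in> I" by (metis card.empty equals0I less_irrefl)
  then show ?case using D(1) by (intro exI[of _ "\<lambda>_. 1"]) auto
next
  case (insert m M)
  have D0: "0 \<in> D" using D(1) D(2)[of 1 1] by simp
  have Dsum: "sum f A \<in> D" if "\<And>i. i \<in> A \<Longrightarrow> f i \<in> D" for f :: "'i \<Rightarrow> 'f" and A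
  proof -
    have "a + b \<in> D" if "a \<in> D" "b \<in> D" for a b
      using D(2)[OF that(1) D(2)[OF D0 that(2)]] by simp
    then show ?thesis using that by (induction A rule: infinite_finite_induct) (auto simp: D0)
  qed
  show ?case
  proof (cases "\<forall>i\<in>I. a i m = 0")
    case True
    then have "\<exists>d. (\<forall>i\<in>I. d i \<in> D) \<and> (\<exists>i\<in>I. d i \<noteq> 0) \<and> (\<forall>m\<in>M. (\<Sum>i\<in>I. d i * a i m) = 0)"
      using insert by (intro insert.IH) auto
    then show ?thesis using True by auto
  next
    case False
    then obtain p where p: "p \<in> I" "a p m \<noteq> 0" by blast
    define a' where "a' i m' = a i m' - a i m * inverse (a p m) * a p m'" for i m'
    have "\<exists>d. (\<forall>i\<in>I - {p}. d i \<in> D) \<and> (\<exists>i\<in>I - {p}. d i \<noteq> 0) \<and> (\<forall>m'\<in>M. (\<Sum>i\<in>I - {p}. d i * a' i m') = 0)"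
    proof (rule insert.IH)
      show "a' i m' \<in> D" if "i \<in> I - {p}" "m' \<in> M" for i m'
        unfolding a'_def using that insert.prems(3) p by (intro D) auto
    qed (use insert p in auto)
    then obtain d where d: "\<And>i. i \<in> I - {p} \<Longrightarrow> d i \<in> D" "\<exists>i\<in>I - {p}. d i \<noteq> 0"
      "\<And>m'. m' \<in> M \<Longrightarrow> (\<Sum>i\<in>I - {p}. d i * a' i m') = 0" by blast
    define d' where "d' i = (if i = p then - (\<Sum>i\<in>I - {p}. d i * a i m) * inverse (a p m) else d i)" for i
    have "(\<Sum>i\<in>I - {p}. d i * a i m) \<in> D"
      using d(1) insert.prems(3) by (intro Dsum D) auto
    then have "0 - (\<Sum>i\<in>I - {p}. d i * a i m) * inverse (a p m) \<in> D"
      using insert.prems(3) p by (intro D(2-4) D0) auto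
    then have 1: "\<forall>i\<in>I. d' i \<in> D" using d(1) by (simp add: d'_def)
    have 2: "\<exists>i\<in>I. d' i \<noteq> 0" using d(2) by (auto simp: d'_def)
    have s: "(\<Sum>i\<in>I. d' i * a i m') = d' p * a p m' + (\<Sum>i\<in>I - {p}. d i * a i m')" for m'
      using p insert.prems(1) by (simp add: sum.remove[of I p] d'_def)
    have "(\<Sum>i\<in>I. d' i * a i m) = 0" unfolding s using p by (simp add: d'_def mult.assoc)
    moreover have "(\<Sum>i\<in>I. d' i * a i m') = 0" if "m' \<in> M" for m'
    proof -
      have "(\<Sum>i\<in>I - {p}. d i * a' i m') = (\<Sum>i\<in>I - {p}. d i * a i m') + d' p * a p m'"
        by (simp add: a'_def d'_def right_diff_distrib sum_subtractf sum_distrib_right mult.assoc)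
      then show ?thesis unfolding s using d(3)[OF that] by (simp add: add.commute)
    qed
    ultimately show ?thesis using 1 2 by blast
  qed
qed

context skew_kalgebra
begin

definition lspan :: "'f set \<Rightarrow> 'f set \<Rightarrow> 'f set"
  where "lspan B M = {\<Sum>m\<in>M. b m * m | b. \<forall>m\<in>M. b m \<in> B}"

lemma lspanI: "(\<And>m. m \<in> M \<Longrightarrow> b m \<in> B) \<Longrightarrow> (\<Sum>m\<in>M. b m * m) \<in> lspan B M"
  unfolding lspan_def by blast

lemma lspan_add:
  assumes "subalg B" "a \<in> lspan B M" "b \<in> lspan B M"
  shows "a + b \<in> lspan B M"
proof -
  obtain f g where "\<forall>m\<in>M. f m \<in> B" "a = (\<Sum>m\<in>M. f m * m)" "\<forall>m\<in>M. g m \<in> B" "b = (\<Sum>m\<in>M. g m * m)"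
    using assms unfolding lspan_def by blast
  then have "a + b = (\<Sum>m\<in>M. (f m + g m) * m)" "\<forall>m\<in>M. f m + g m \<in> B"
    using subalgD[OF assms(1)] by (simp_all add: distrib_right sum.distrib)
  then show ?thesis by (simp add: lspanI)
qed

lemma lspan_mult_left:
  assumes "subalg B" "c \<in> B" "a \<in> lspan B M"
  shows "c * a \<in> lspan B M"
proof -
  obtain f where "\<forall>m\<in>M. f m \<in> B" "a = (\<Sum>m\<in>M. f m * m)"
    using assms unfolding lspan_def by blast
  then have "c * a = (\<Sum>m\<in>M. (c * f m) * m)" "\<forall>m\<in>M. c * f m \<in> B"
    using subalgD[OF assms(1)] assms(2) by (simp_all add: sum_distrib_left mult.assoc)
  then show ?thesis using lspanI[of M "\<lambda>m. c * f m" B] by simp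
qed

lemma lspan_0: "subalg B \<Longrightarrow> 0 \<in> lspan B M"
  unfolding lspan_def using subalgD(7) by (force intro: exI[of _ "\<lambda>_. 0"])

lemma lspan_sum: "subalg B \<Longrightarrow> (\<And>i. i \<in> I \<Longrightarrow> f i \<in> lspan B M) \<Longrightarrow> sum f I \<in> lspan B M"
  by (induction I rule: infinite_finite_induct) (auto intro: lspan_add lspan_0)

lemma lspan_base:
  assumes "subalg B" "finite M" "m \<in> M"
  shows "m \<in> lspan B M"
proof -
  have "m = (\<Sum>m'\<in>M. (if m' = m then 1 else 0) * m')"
    using assms(2,3) by (simp add: if_distrib[of "\<lambda>a. a * _"] cong: if_cong)
  then show ?thesis unfolding lspan_def using subalgD(6,7)[OF assms(1)] by fastforce
qed

lemma lspan_mult_right: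
  assumes "subalg B" "\<And>m. m \<in> M \<Longrightarrow> m * g \<in> lspan B M" "a \<in> lspan B M"
  shows "a * g \<in> lspan B M"
proof -
  obtain f where "\<forall>m\<in>M. f m \<in> B" "a = (\<Sum>m\<in>M. f m * m)"
    using assms(3) unfolding lspan_def by blast
  then have "a * g = (\<Sum>m\<in>M. f m * (m * g))" and "\<forall>m\<in>M. f m * (m * g) \<in> lspan B M"
    using assms(1,2) by (auto simp: sum_distrib_right mult.assoc intro: lspan_mult_left)
  then show ?thesis using lspan_sum[OF assms(1), of M "\<lambda>m. f m * (m * g)" M] by simp
qed

text \<open>
  A left space of finite dimension that is stable under right multiplication by \<open>s \<noteq> 0\<close> is
  stable under right division by \<open>s\<close>: the vectors \<open>a s\<^sup>j\<close> are dependent.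
\<close>

lemma lspan_divide:
  assumes D: "divsub D" and M: "finite M" and s: "s \<noteq> 0" "\<And>a. a \<in> lspan D M \<Longrightarrow> a * s \<in> lspan D M"
    and a: "a \<in> lspan D M"
  shows "a * inverse s \<in> lspan D M"
proof -
  note sub = divsubD(1)[OF D]
  have pow: "a * s ^ i \<in> lspan D M" for i
    by (induction i) (use a s(2) in \<open>auto simp: power_Suc2 simp del: power_Suc simp flip: mult.assoc\<close>)
  then have "\<exists>b. (\<forall>m\<in>M. b m \<in> D) \<and> a * s ^ i = (\<Sum>m\<in>M. b m * m)" for i
    unfolding lspan_def by blast
  then obtain b where b: "\<And>i m. m \<in> M \<Longrightarrow> b i m \<in> D" "\<And>i. a * s ^ i = (\<Sum>m\<in>M. b i m * m)" by metis
  obtain d where d: "\<forall>i\<in>{..card M}. d i \<in> D" "\<exists>i\<in>{..card M}. d i \<noteq> 0"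
    "\<forall>m\<in>M. (\<Sum>i\<in>{..card M}. d i * b i m) = 0"
    using linear_system[OF M, of "{..card M}" D b] subalgD(3,4,6)[OF sub] divsubD(2)[OF D] b(1) by auto
  have sum0: "(\<Sum>i\<in>{..card M}. d i * (a * s ^ i)) = 0"
  proof -
    have "(\<Sum>i\<in>{..card M}. d i * (a * s ^ i)) = (\<Sum>m\<in>M. (\<Sum>i\<in>{..card M}. d i * b i m) * m)"
      by (simp add: b(2) sum_distrib_left sum_distrib_right mult.assoc) (rule sum.swap)
    also have "\<dots> = 0" using d(3) by simp
    finally show ?thesis .
  qed
  define k where "k = (LEAST i. i \<le> card M \<and> d i \<noteq> 0)"
  have k: "k \<le> card M" "d k \<noteq> 0"
    using LeastI_ex[of "\<lambda>i. i \<le> card M \<and> d i \<noteq> 0"] d(2) unfolding k_def by auto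
  have below: "d i = 0" if "i < k" for i
    using not_less_Least[of i "\<lambda>i. i \<le> card M \<and> d i \<noteq> 0"] that k(1) unfolding k_def by auto
  have "(\<Sum>i\<in>{..card M}. d i * (a * s ^ i)) = (\<Sum>i\<in>{k..card M}. d i * (a * s ^ i))"
    by (rule sum.mono_neutral_right) (auto simp: below)
  also have "\<dots> = d k * (a * s ^ k) + (\<Sum>i\<in>{Suc k..card M}. d i * (a * s ^ i))"
    by (rule sum.atLeast_Suc_atMost[OF k(1)])
  finally have "d k * (a * s ^ k) = - (\<Sum>i\<in>{Suc k..card M}. d i * (a * s ^ i))"
    using sum0 by (simp add: eq_neg_iff_add_eq_0)
  also have "\<dots> = (\<Sum>i\<in>{Suc k..card M}. (- d i) * (a * s ^ (i - Suc k))) * s ^ Suc k"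
    unfolding sum_distrib_right sum_negf[symmetric]
    by (rule sum.cong) (auto simp: mult.assoc power_add[symmetric] simp del: power_Suc)
  finally have "d k * (a * s ^ k) * inverse (s ^ Suc k) = (\<Sum>i\<in>{Suc k..card M}. (- d i) * (a * s ^ (i - Suc k)))"
    using s(1) by (simp add: mult.assoc del: power_Suc)
  moreover have "d k * (a * s ^ k) * inverse (s ^ Suc k) = d k * (a * inverse s)"
    using s(1) by (simp add: mult.assoc nonzero_inverse_mult_distrib power_commutes flip: power_Suc2)
      (simp add: power_Suc2 nonzero_inverse_mult_distrib mult.assoc del: power_Suc flip: mult.assoc[of "s ^ k"])
  ultimately have "a * inverse s = inverse (d k) * (\<Sum>i\<in>{Suc k..card M}. (- d i) * (a * s ^ (i - Suc k)))"
    using k(2) by (simp flip: mult.assoc)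
  also have "\<dots> \<in> lspan D M"
    using d(1) k by (intro lspan_mult_left[OF sub] lspan_sum[OF sub] pow divsubD(2)[OF D] subalgD(8)[OF sub]) auto
  finally show ?thesis .
qed

lemma lspan_everything:
  assumes D: "divsub D" and M: "finite M" "1 \<in> M"
    and gens: "\<And>m g. m \<in> M \<Longrightarrow> g \<in> G \<Longrightarrow> m * g \<in> lspan D M"
    and frac: "\<And>f. \<exists>a s. f = a * inverse s \<and> s \<noteq> 0 \<and> (\<forall>B. subalg B \<longrightarrow> G \<subseteq> B \<longrightarrow> a \<in> B \<and> s \<in> B)"
  shows "f \<in> lspan D M"
proof -
  note sub = divsubD(1)[OF D]
  let ?B = "{g. \<forall>a\<in>lspan D M. a * g \<in> lspan D M}"
  have "subalg ?B"
    unfolding subalg_def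
  proof (intro conjI ballI subsetI)
    fix c assume "c \<in> range \<kappa>"
    then show "c \<in> ?B" using lspan_mult_left[OF sub] subalgD(1)[OF sub] \<kappa>_central by auto metis
  next
    fix g h assume gh: "g \<in> ?B" "h \<in> ?B"
    then show "g + h \<in> ?B" using lspan_add[OF sub] by (simp add: distrib_left)
    have "- 1 * (a * h) \<in> lspan D M" if "a \<in> lspan D M" for a
      by (rule lspan_mult_left[OF sub subalgD(8)[OF sub subalgD(6)[OF sub]]]) (use gh that in blast)
    then show "g - h \<in> ?B" using gh lspan_add[OF sub, of _ M "- (_ * h)"] by (simp add: right_diff_distrib)
    show "g * h \<in> ?B" using gh by (simp flip: mult.assoc)
  qed
  moreover have "G \<subseteq> ?B" using lspan_mult_right[OF sub gens] by blast
  moreover obtain a s where as: "f = a * inverse s" "s \<noteq> 0" "\<forall>B. subalg B \<longrightarrow> G \<subseteq> B \<longrightarrow> a \<in> B \<and> s \<in> B"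
    using frac by blast
  ultimately have "a \<in> ?B" "s \<in> ?B" by blast+
  moreover have "1 \<in> lspan D M" using lspan_base[OF sub M] .
  ultimately have "1 * a \<in> lspan D M" by blast
  then show ?thesis
    unfolding as(1) using lspan_divide[OF D M(1) as(2)] \<open>s \<in> ?B\<close> by simp
qed

text \<open>
  The monomials \<open>x\<^sup>a\<close> with exponents below \<open>h\<close> span a space stable under right multiplication by
  \<open>x i\<close> once \<open>(x i)\<^sup>h\<close> reduces.
\<close>

definition xpow :: "('n::finite \<Rightarrow> 'f) \<Rightarrow> ('n \<Rightarrow> nat) \<Rightarrow> 'f"
  where "xpow x a = cprod (\<lambda>i. x i ^ a i) UNIV"

lemma powers_commute:
  fixes a b :: "'b::monoid_mult"
  assumes "a * b = b * a"
  shows "a ^ m * b ^ n = b ^ n * a ^ m"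
proof -
  have "a ^ m * b = b * a ^ m" by (rule power_commuting_commutes[OF assms])
  from power_commuting_commutes[OF this[symmetric], of n] show ?thesis by simp
qed

lemma commuting_xpow:
  assumes "\<And>i j. x i * x j = x j * x i"
  shows "commuting (\<lambda>i. x i ^ a i) A"
  unfolding commuting_def by (intro ballI, rule powers_commute, rule assms)

lemma xpow_commute:
  assumes "\<And>i j. x i * x j = x j * x i" "\<And>i. b * x i = x i * b"
  shows "xpow x a * b = b * xpow x a"
  unfolding xpow_def
proof (rule cprod_commute[OF commuting_xpow])
  show "x i ^ a i * b = b * x i ^ a i" for i
    by (rule power_commuting_commutes) (simp add: assms(2))
qed (use assms(1) in simp_all)

lemma xpow_mult:
  assumes x: "\<And>i j. x i * x j = x j * x i"
  shows "xpow x (a(i := a i + k)) = xpow x a * x i ^ k" 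
proof -
  let ?r = "cprod (\<lambda>j. x j ^ a j) (UNIV - {i})"
  have "xpow x (a(i := a i + k)) = x i ^ (a i + k) * cprod (\<lambda>j. x j ^ (a(i := a i + k)) j) (UNIV - {i})"
    unfolding xpow_def by (subst cprod_remove[OF commuting_xpow[OF x], of UNIV i]) simp_all
  also have "cprod (\<lambda>j. x j ^ (a(i := a i + k)) j) (UNIV - {i}) = ?r"
    by (rule cprod_cong[OF commuting_xpow[OF x]]) auto
  also have "x i ^ (a i + k) * ?r = x i ^ a i * ?r * x i ^ k"
  proof -
    have "?r * x i ^ k = x i ^ k * ?r"
      by (rule cprod_commute[OF commuting_xpow[OF x]]) (simp_all add: powers_commute[OF x])
    then show ?thesis by (simp add: power_add mult.assoc)
  qed
  also have "x i ^ a i * ?r = xpow x a"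
    unfolding xpow_def by (rule cprod_remove[OF commuting_xpow[OF x], symmetric]) simp_all
  finally show ?thesis .
qed

lemma xpow_stable:
  assumes B: "subalg B" and x: "\<And>i j. x i * x j = x j * x i" and h: "0 < h"
    and root: "x i ^ h = (\<Sum>j<h. b j * x i ^ j)" "\<And>j. j < h \<Longrightarrow> b j \<in> B" "\<And>j k. j < h \<Longrightarrow> b j * x k = x k * b j"
    and m: "m \<in> xpow x ` box (h - 1)"
  shows "m * x i \<in> lspan B (xpow x ` box (h - 1))"
proof -
  let ?M = "xpow x ` box (h - 1)"
  have fin: "finite ?M" by (simp add: card_box)
  obtain a where a: "a \<in> box (h - 1)" "m = xpow x a" using m by blast
  have mx: "m * x i = xpow x (a(i := a i + 1))" using xpow_mult[OF x, where a = a and i = i and k = 1] a by simp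
  show ?thesis
  proof (cases "a i + 1 < h")
    case True
    then have "a(i := a i + 1) \<in> box (h - 1)" using a(1) by (auto simp: box_def)
    then show ?thesis unfolding mx by (intro lspan_base[OF B fin] imageI)
  next
    case False
    have "a i \<le> h - 1" using a(1) by (simp add: box_def)
    then have ai: "a i + 1 = h" using False h by simp
    let ?a0 = "a(i := 0)"
    have "m * x i = xpow x ?a0 * x i ^ h"
    proof -
      have "a(i := a i + 1) = ?a0(i := ?a0 i + h)" using ai by simp
      then have "xpow x (a(i := a i + 1)) = xpow x (?a0(i := ?a0 i + h))" by (rule arg_cong)
      also have "\<dots> = xpow x ?a0 * x i ^ h" by (rule xpow_mult[OF x])
      finally show ?thesis unfolding mx .
    qed
    also have "\<dots> = (\<Sum>j<h. b j * xpow x (?a0(i := j)))"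
    proof -
      have "xpow x ?a0 * (b j * x i ^ j) = b j * xpow x (?a0(i := j))" if "j < h" for j
      proof -
        have c: "xpow x ?a0 * b j = b j * xpow x ?a0"
          by (rule xpow_commute) (rule x root(3)[OF that])+
        have "?a0(i := j) = ?a0(i := ?a0 i + j)" by simp
        then have "xpow x (?a0(i := j)) = xpow x (?a0(i := ?a0 i + j))" by (rule arg_cong)
        also have "\<dots> = xpow x ?a0 * x i ^ j" by (rule xpow_mult[OF x])
        finally show ?thesis by (simp only: mult.assoc[symmetric] c)
      qed
      then show ?thesis unfolding root(1) sum_distrib_left by simp
    qed
    also have "\<dots> \<in> lspan B ?M"
    proof (intro lspan_sum[OF B] lspan_mult_left[OF B])
      fix j assume j: "j \<in> {..<h}"
      then show "b j \<in> B" using root(2) by simp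
      have "?a0(i := j) \<in> box (h - 1)" using a(1) j by (auto simp: box_def)
      then show "xpow x (?a0(i := j)) \<in> lspan B ?M" by (intro lspan_base[OF B fin] imageI)
    qed
    finally show ?thesis .
  qed
qed

inductive_set dspan :: "'f set \<Rightarrow> 'f set \<Rightarrow> 'f set" for D A where
  base: "d \<in> D \<Longrightarrow> a \<in> A \<Longrightarrow> d * a \<in> dspan D A"
| add: "a \<in> dspan D A \<Longrightarrow> b \<in> dspan D A \<Longrightarrow> a + b \<in> dspan D A"

lemma dspan_mult_right:
  assumes "c \<in> A" "\<And>a b. a \<in> A \<Longrightarrow> b \<in> A \<Longrightarrow> a * b \<in> A" "f \<in> dspan D A"
  shows "f * c \<in> dspan D A"
  using assms(3)
  by induction (use assms(1,2) in \<open>auto simp: mult.assoc distrib_right intro: dspan.intros\<close>)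

lemma dspan_mult_left:
  assumes "subalg D" "c \<in> D" "f \<in> dspan D A"
  shows "c * f \<in> dspan D A"
  using assms(3)
proof induction
  case (base d a)
  then show ?case using subalgD(4)[OF assms(1,2)] by (simp add: dspan.base flip: mult.assoc)
next
  case (add a b)
  then show ?case by (simp add: distrib_left dspan.add)
qed

lemma dspan_0: "subalg D \<Longrightarrow> A \<noteq> {} \<Longrightarrow> 0 \<in> dspan D A"
  using dspan.base[of 0 D _ A] subalgD(7) by fastforce

lemma dspan_sum:
  assumes "subalg D" "A \<noteq> {}" "\<And>i. i \<in> I \<Longrightarrow> f i \<in> dspan D A"
  shows "sum f I \<in> dspan D A"
  using assms(3)
  by (induction I rule: infinite_finite_induct) (auto intro: dspan.add dspan_0[OF assms(1,2)])

end

section \<open>Descent to the invariants of the symmetric group\<close>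

context quantum_points
begin

definition gen_by :: "'n set \<Rightarrow> 'f set"
  where "gen_by U = {a. \<forall>B. subalg B \<longrightarrow> X ` U \<subseteq> B \<longrightarrow> range P \<subseteq> B \<longrightarrow> a \<in> B}"

lemma subalg_gen_by: "subalg (gen_by U)"
proof -
  have D: "c \<in> B" if "c \<in> gen_by U" "subalg B" "X ` U \<subseteq> B" "range P \<subseteq> B" for c B
    using that unfolding gen_by_def by blast
  have I: "c \<in> gen_by U" if "\<And>B. subalg B \<Longrightarrow> X ` U \<subseteq> B \<Longrightarrow> range P \<subseteq> B \<Longrightarrow> c \<in> B" for c
    using that unfolding gen_by_def by blast
  show ?thesis
    unfolding subalg_def
  proof (intro conjI ballI subsetI)
    fix a assume "a \<in> range \<kappa>"
    then show "a \<in> gen_by U" using subalgD(1) by (auto intro!: I)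
  next
    fix a b assume a: "a \<in> gen_by U" and b: "b \<in> gen_by U"
    show "a + b \<in> gen_by U" by (rule I, rule subalgD(2), assumption) (rule D[OF a] D[OF b]; assumption)+
    show "a - b \<in> gen_by U" by (rule I, rule subalgD(3), assumption) (rule D[OF a] D[OF b]; assumption)+
    show "a * b \<in> gen_by U" by (rule I, rule subalgD(4), assumption) (rule D[OF a] D[OF b]; assumption)+
  qed
qed

lemma gen_by_mono: "U \<subseteq> V \<Longrightarrow> gen_by U \<subseteq> gen_by V"
  unfolding gen_by_def by blast

lemma gen_by_X: "i \<in> U \<Longrightarrow> X i \<in> gen_by U"
  unfolding gen_by_def by blast

lemma gen_by_commute:
  assumes "a \<in> gen_by U"
  shows "a * X j = X j * a"
proof -
  let ?C = "{a. \<forall>g\<in>{X j}. g * a = a * g}"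
  have "subalg ?C" by (rule divsubD(1)[OF divsub_centralizer])
  moreover have "X ` U \<subseteq> ?C" using XX by blast
  moreover have "P z \<in> ?C" for z unfolding P_def using lin_X[OF \<kappa>X, of z UNIV j] by simp
  then have "range P \<subseteq> ?C" by blast
  ultimately have "a \<in> ?C" using assms unfolding gen_by_def by blast
  then show ?thesis by simp
qed

text \<open>Removing the known roots from \<open>P\<close> leaves a polynomial for the remaining ones.\<close>

lemma remaining_roots:
  "\<exists>m. (\<forall>j<card (- U). m j \<in> gen_by U) \<and> (\<forall>k. k \<notin> U \<longrightarrow> X k ^ card (- U) + reval (card (- U)) m (X k) = 0)"
  using finite[of U]
proof (induction U rule: finite_induct)
  case empty
  obtain p where p: "\<And>k. X k ^ CARD('n) + reval CARD('n) p (X k) = 0"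
    "\<And>B i. subalg B \<Longrightarrow> (\<And>z. P z \<in> B) \<Longrightarrow> i < CARD('n) \<Longrightarrow> p i \<in> B"
    by (rule roots_and_values) blast
  have "p i \<in> gen_by {}" if "i < CARD('n)" for i
    unfolding gen_by_def using p(2)[OF _ _ that] by blast
  then show ?case using p(1) by auto
next
  case (insert k U)
  obtain m where m: "\<And>j. j < card (- U) \<Longrightarrow> m j \<in> gen_by U"
    "\<And>l. l \<notin> U \<Longrightarrow> X l ^ card (- U) + reval (card (- U)) m (X l) = 0" using insert.IH by blast
  define r where "r = card (- insert k U)"
  have "- U = insert k (- insert k U)" using insert by auto
  then have cU: "card (- U) = Suc r" unfolding r_def by (metis ComplD card_insert_disjoint finite insertI1)
  define F where "F j = (if j < Suc r then m j else 1)" for j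
  have F: "reval (Suc (Suc r)) F a = a ^ Suc r + reval (Suc r) m a" for a
  proof -
    have "reval (Suc r) F a = reval (Suc r) m a" by (rule reval_cong) (simp add: F_def)
    then show ?thesis by (simp add: reval_Suc[of "Suc r"] F_def add.commute)
  qed
  define m' where "m' = divided_diff (Suc (Suc r)) F (X k)"
  have m'r: "m' r = 1" unfolding m'_def by (simp add: divided_diff_top F_def)
  have sub: "subalg (gen_by (insert k U))" by (rule subalg_gen_by)
  have "F j \<in> gen_by (insert k U)" for j
    using m(1)[of j] gen_by_mono[of U "insert k U"] subalgD(6)[OF sub] by (auto simp: F_def cU)
  moreover have "X k \<in> gen_by (insert k U)" by (rule gen_by_X) simp
  ultimately have m'_in: "m' j \<in> gen_by (insert k U)" for j
    unfolding m'_def divided_diff_def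
    by (intro additive_subgroup_sum[OF subalg_additive[OF sub]] subalgD(4)[OF sub] subalgD(9)[OF sub])
  have "X l ^ r + reval r m' (X l) = 0" if l: "l \<notin> insert k U" for l
  proof -
    have "reval (Suc (Suc r)) F (X l) - reval (Suc (Suc r)) F (X k) = reval (Suc r) m' (X l) * (X l - X k)"
      unfolding m'_def using divided_diff[OF XX[of k l], of "Suc (Suc r)" F] by simp
    moreover have "reval (Suc (Suc r)) F (X l) = 0" "reval (Suc (Suc r)) F (X k) = 0"
      unfolding F using m(2)[of l] m(2)[of k] l insert.hyps by (simp_all add: cU)
    moreover have "X l - X k \<noteq> 0" using X_distinct[of l k 1] l by auto
    ultimately have "reval (Suc r) m' (X l) = 0" by simp
    then show ?thesis by (simp add: reval_Suc m'r add.commute)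
  qed
  then show ?case using m'_in unfolding r_def by blast
qed

lemma descend_step:
  assumes D: "subalg D" "range P \<subseteq> D" and k: "k \<notin> U"
    and f: "f \<in> dspan D (gen_by (insert k U))"
  shows "\<exists>c. (\<forall>j<card (- U). c j \<in> dspan D (gen_by U)) \<and> f = reval (card (- U)) c (X k)"
proof -
  define r where "r = card (- U)"
  let ?R = "dspan D (gen_by U)"
  have ne: "gen_by U \<noteq> {}" using subalgD(6)[OF subalg_gen_by] by blast
  have r: "0 < r" using k by (auto simp: r_def card_gt_0_iff)
  then obtain r' where r': "r = Suc r'" using gr0_implies_Suc by blast
  obtain m where m: "\<And>j. j < r \<Longrightarrow> m j \<in> gen_by U" "X k ^ r + reval r m (X k) = 0"
    using remaining_roots[of U] k unfolding r_def by blast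
  let ?S = "{reval r c (X k) | c. \<forall>j<r. c j \<in> ?R}"
  have Rm: "a * b \<in> ?R" if "a \<in> ?R" "b \<in> gen_by U" for a b
    using dspan_mult_right[OF that(2) _ that(1)] subalgD(4)[OF subalg_gen_by] by blast
  have S_add: "a + b \<in> ?S" if ab: "a \<in> ?S" "b \<in> ?S" for a b
  proof -
    obtain c c' where c: "\<forall>j<r. c j \<in> ?R" "a = reval r c (X k)" "\<forall>j<r. c' j \<in> ?R" "b = reval r c' (X k)"
      using ab by blast
    then have "a + b = reval r (\<lambda>j. c j + c' j) (X k)" by (simp add: reval_add)
    moreover have "\<forall>j<r. c j + c' j \<in> ?R" using c by (auto intro: dspan.add)
    ultimately show ?thesis by blast
  qed
  have S_left: "b * a \<in> ?S" if ab: "b \<in> D" "a \<in> ?S" for a b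
  proof -
    obtain c where c: "\<forall>j<r. c j \<in> ?R" "a = reval r c (X k)" using ab by blast
    then have "b * a = reval r (\<lambda>j. b * c j) (X k)" by (simp add: reval_mult_left)
    moreover have "\<forall>j<r. b * c j \<in> ?R" using c dspan_mult_left[OF D(1) ab(1)] by blast
    ultimately show ?thesis by blast
  qed
  have S_gen: "a * b \<in> ?S" if ab: "a \<in> ?S" "b \<in> gen_by U" for a b
  proof -
    obtain c where c: "\<forall>j<r. c j \<in> ?R" "a = reval r c (X k)" using ab by blast
    then have "a * b = reval r (\<lambda>j. c j * b) (X k)"
      by (simp add: reval_mult_right[OF gen_by_commute[OF ab(2), symmetric]])
    moreover have "\<forall>j<r. c j * b \<in> ?R" using c Rm[OF _ ab(2)] by blast
    ultimately show ?thesis by blast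
  qed
  have S_X: "a * X k \<in> ?S" if a: "a \<in> ?S" for a
  proof -
    obtain c where c: "\<forall>j<r. c j \<in> ?R" "a = reval r c (X k)" using a by blast
    have "a * X k = reval r' c (X k) * X k + c r' * X k ^ r"
      by (simp add: c r' reval_Suc distrib_right mult.assoc power_commutes)
    also have "reval r' c (X k) * X k = reval r (case_nat 0 c) (X k)"
      unfolding r' by (subst reval_shift) simp
    also have "c r' * X k ^ r = reval r (\<lambda>j. - (c r' * m j)) (X k)"
    proof -
      have "X k ^ r = - reval r m (X k)" using m(2) by (simp add: eq_neg_iff_add_eq_0)
      then show ?thesis using reval_mult_left[of r "- c r'" m "X k"] by simp
    qed
    finally have "a * X k = reval r (\<lambda>j. case_nat 0 c j + - (c r' * m j)) (X k)" by (simp only: reval_add)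
    moreover have "\<forall>j<r. case_nat 0 c j + - (c r' * m j) \<in> ?R"
    proof (intro allI impI dspan.add)
      fix j assume j: "j < r"
      show "case_nat 0 c j \<in> ?R" using c(1) j dspan_0[OF D(1) ne] by (auto split: nat.split)
      have "c r' * - m j \<in> ?R"
        using c(1) r' m(1)[OF j] by (intro Rm subalgD(8)[OF subalg_gen_by]) auto
      then show "- (c r' * m j) \<in> ?R" by simp
    qed
    ultimately show ?thesis by blast
  qed
  have one: "1 \<in> ?S"
  proof -
    have "1 = reval r (\<lambda>j. if j = 0 then 1 else 0) (X k)"
      unfolding r' by (subst reval_shift) (simp add: reval_def)
    moreover have "1 * 1 \<in> ?R" by (intro dspan.base subalgD(6)[OF D(1)] subalgD(6)[OF subalg_gen_by])
    then have "\<forall>j<r. (if j = 0 then 1 else 0) \<in> ?R" using dspan_0[OF D(1) ne] by simp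
    ultimately show ?thesis by blast
  qed
  let ?B = "{a. \<forall>s\<in>?S. s * a \<in> ?S}"
  have "subalg ?B"
    unfolding subalg_def
  proof (intro conjI ballI subsetI)
    fix c assume "c \<in> range \<kappa>"
    then show "c \<in> ?B" using S_gen subalgD(1)[OF subalg_gen_by] by blast
  next
    fix g h assume gh: "g \<in> ?B" "h \<in> ?B"
    show "g + h \<in> ?B"
    proof
      show "\<forall>s\<in>?S. s * (g + h) \<in> ?S" unfolding distrib_left using gh S_add by blast
    qed
    have m1: "- 1 \<in> D" using subalgD(6,8)[OF D(1)] by blast
    show "g - h \<in> ?B"
    proof (rule CollectI, rule ballI)
      fix s assume s: "s \<in> ?S"
      have "s * g + - 1 * (s * h) \<in> ?S" by (rule S_add[OF _ S_left[OF m1]]) (use gh s in blast)+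
      then show "s * (g - h) \<in> ?S" by (simp add: right_diff_distrib)
    qed
    show "g * h \<in> ?B"
    proof (rule CollectI, rule ballI)
      fix s assume s: "s \<in> ?S"
      then have "s * g \<in> ?S" using gh by blast
      then have "s * g * h \<in> ?S" using gh by blast
      then show "s * (g * h) \<in> ?S" by (simp only: mult.assoc)
    qed
  qed
  moreover have "X ` insert k U \<subseteq> ?B" using S_X S_gen gen_by_X by blast
  moreover have "range P \<subseteq> ?B" using S_gen unfolding gen_by_def by blast
  ultimately have B: "gen_by (insert k U) \<subseteq> ?B" unfolding gen_by_def by blast
  from f have "f \<in> ?S"
  proof induction
    case (base d a)
    then have "1 * a \<in> ?S" using B one by blast
    then show ?case using S_left base(1) by simp
  next
    case (add a b)
    then show ?case by (intro S_add)
  qed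
  then show ?thesis unfolding r_def by blast
qed

lemma descent:
  assumes D: "subalg D" "range P \<subseteq> D"
    and f: "f \<in> dspan D (gen_by U)"
    and g: "\<And>k l a b. g k l (a + b) = g k l a + g k l b" "\<And>k l a b. g k l (a * b) = g k l a * g k l b"
      "\<And>k l a. a \<in> D \<Longrightarrow> g k l a = a"
      "\<And>k l i. g k l (X i) = X (if i = k then l else if i = l then k else i)"
    and fixed: "\<And>k l. g k l f = f"
  shows "f \<in> D"
  using finite[of U] f
proof (induction U rule: finite_induct)
  case empty
  have "gen_by {} \<subseteq> D" using D unfolding gen_by_def by auto
  from empty show ?case
  proof induction
    case (base d a)
    then show ?case using \<open>gen_by {} \<subseteq> D\<close> subalgD(4)[OF D(1)] by blast
  next
    case (add a b)
    then show ?case using subalgD(2)[OF D(1)] by blast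
  qed
next
  case (insert k U)
  obtain c where c: "\<And>j. j < card (- U) \<Longrightarrow> c j \<in> dspan D (gen_by U)" "f = reval (card (- U)) c (X k)"
    using descend_step[OF D insert.hyps(2) insert.prems] by blast
  have r: "0 < card (- U)" using insert.hyps(2) by (auto simp: card_gt_0_iff)
  have g0: "g i l 0 = 0" for i l using g(1)[of i l 0 0] by simp
  have gm: "g i l (a - b) = g i l a - g i l b" for i l a b
    using g(1)[of i l "a - b" b] by (simp add: algebra_simps)
  have root: "reval (card (- U)) c (X l) = f" if l: "l \<notin> U" for l
  proof -
    have "gen_by U \<subseteq> {a. g k l a = a}"
    proof -
      have "subalg {a. g k l a = a}"
        using g(3) subalgD(1)[OF D(1)] by (auto simp: subalg_def g(1,2) gm)
      moreover have "X ` U \<subseteq> {a. g k l a = a}" using l insert.hyps by (auto simp: g(4))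
      moreover have "range P \<subseteq> {a. g k l a = a}" using D(2) g(3) by auto
      ultimately show ?thesis unfolding gen_by_def by blast
    qed
    note gU = this
    have gc: "g k l a = a" if "a \<in> dspan D (gen_by U)" for a
      using that
    proof induction
      case (base d a)
      then have "g k l a = a" using gU by blast
      then show ?case using g(3)[OF base(1)] by (simp add: g(2))
    qed (simp add: g(1))
    have gp: "g k l (X k ^ Suc j) = X l ^ Suc j" for j
      by (induction j) (simp_all add: g(2,4))
    have gp0: "g k l (X k ^ j) = X l ^ j" for j
    proof (cases j)
      case 0
      then show ?thesis using g(3)[OF subalgD(6)[OF D(1)]] by simp
    qed (simp only: gp)
    have gsum: "g k l (sum h I) = (\<Sum>i\<in>I. g k l (h i))" for h :: "nat \<Rightarrow> 'f" and I
      by (induction I rule: infinite_finite_induct) (simp_all add: g0 g(1))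
    have "f = g k l (reval (card (- U)) c (X k))" using fixed c(2) by simp
    also have "\<dots> = reval (card (- U)) c (X l)"
      unfolding reval_def gsum g(2) gp0 by (rule sum.cong) (simp_all add: gc[OF c(1)])
    finally show ?thesis by simp
  qed
  have "c 0 - f = 0"
  proof -
    let ?c = "\<lambda>j. c j - (if j = 0 then f else 0)"
    have inj: "inj_on X (- U)" using X_distinct[of _ _ 1] by (auto simp: inj_on_def)
    have "?c 0 = 0"
    proof (rule reval_eq_0[of "X ` (- U)" "card (- U)" ?c 0])
      show "card (X ` (- U)) = card (- U)" by (rule card_image[OF inj])
      show "reval (card (- U)) ?c a = 0" if a: "a \<in> X ` (- U)" for a
      proof -
        obtain l where l: "l \<notin> U" "a = X l" using a by blast
        obtain r' where r': "card (- U) = Suc r'" using r gr0_implies_Suc by blast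
        have "reval (card (- U)) (\<lambda>j. if j = 0 then f else 0) a = f"
          unfolding r' by (subst reval_shift) (simp add: reval_def)
        then show ?thesis by (simp add: reval_diff l(2) root[OF l(1)])
      qed
      show "a * b = b * a" if "a \<in> X ` (- U)" "b \<in> X ` (- U)" for a b using that XX by auto
    qed (use r in simp_all)
    then show ?thesis by simp
  qed
  then have "f = c 0" by simp
  then have "f \<in> dspan D (gen_by U)" using c(1)[OF r] by simp
  then show ?case by (rule insert.IH)
qed

end


section \<open>Quantum affine spaces and their skew fields of fractions\<close>

subsection \<open>Evaluation of the free algebra\<close>

lemma sum_keys_superset:
  assumes "finite S" "Poly_Mapping.keys a \<subseteq> S" "\<And>w. F w 0 = 0"
  shows "(\<Sum>w\<in>Poly_Mapping.keys a. F w (Poly_Mapping.lookup a w)) = (\<Sum>w\<in>S. F w (Poly_Mapping.lookup a w))"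
  using assms by (intro sum.mono_neutral_left) (auto simp: in_keys_iff)

lemma sum_keys_add:
  fixes F :: "'w \<Rightarrow> 'k::ab_group_add \<Rightarrow> 'a::ab_group_add"
  assumes "\<And>w c d. F w (c + d) = F w c + F w d"
  shows "(\<Sum>w\<in>Poly_Mapping.keys (a + b). F w (Poly_Mapping.lookup (a + b) w))
    = (\<Sum>w\<in>Poly_Mapping.keys a. F w (Poly_Mapping.lookup a w)) + (\<Sum>w\<in>Poly_Mapping.keys b. F w (Poly_Mapping.lookup b w))"
proof -
  have F0: "F w 0 = 0" for w using assms[of w 0 0] by simp
  let ?S = "Poly_Mapping.keys a \<union> Poly_Mapping.keys b"
  have S: "finite ?S" "Poly_Mapping.keys (a + b) \<subseteq> ?S" by (simp_all add: Poly_Mapping.keys_add)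
  have "(\<Sum>w\<in>?S. F w (Poly_Mapping.lookup (a + b) w))
      = (\<Sum>w\<in>?S. F w (Poly_Mapping.lookup a w)) + (\<Sum>w\<in>?S. F w (Poly_Mapping.lookup b w))"
    by (simp add: lookup_add assms sum.distrib)
  then show ?thesis
    using sum_keys_superset[of ?S "a + b" F] sum_keys_superset[of ?S a F] sum_keys_superset[of ?S b F] S F0 by simp
qed

lemma sum_singles: "a = (\<Sum>w\<in>Poly_Mapping.keys a. Poly_Mapping.single w (Poly_Mapping.lookup a w))"
proof (rule poly_mapping_eqI)
  fix v
  have "Poly_Mapping.lookup (\<Sum>w\<in>Poly_Mapping.keys a. Poly_Mapping.single w (Poly_Mapping.lookup a w)) v
      = (\<Sum>w\<in>Poly_Mapping.keys a. if w = v then Poly_Mapping.lookup a w else 0)"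
    by (simp add: lookup_sum lookup_single when_def)
  also have "\<dots> = Poly_Mapping.lookup a v" by (simp add: in_keys_iff)
  finally show "Poly_Mapping.lookup a v
      = Poly_Mapping.lookup (\<Sum>w\<in>Poly_Mapping.keys a. Poly_Mapping.single w (Poly_Mapping.lookup a w)) v" by simp
qed

lemma free_alg_induct [case_names single add]:
  assumes "\<And>w c. Q (Poly_Mapping.single w c)" "\<And>a b. Q a \<Longrightarrow> Q b \<Longrightarrow> Q (a + b)"
  shows "Q (a :: 'w \<Rightarrow>\<^sub>0 'k::ab_group_add)"
proof -
  have "Q (\<Sum>w\<in>S. Poly_Mapping.single w (Poly_Mapping.lookup a w))" if "finite S" for S
    using that
  proof (induction S rule: finite_induct)
    case empty
    show ?case using assms(1)[of undefined 0] by simp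
  qed (simp add: assms)
  then show ?thesis by (subst sum_singles) simp
qed

context kalgebra
begin

definition ev :: "('n gen \<Rightarrow> 'a) \<Rightarrow> ('n, 'k) free_alg \<Rightarrow> 'a"
  where "ev g a = (\<Sum>w\<in>Poly_Mapping.keys a. Poly_Mapping.lookup a w \<odot> prod_list (map g (letters w)))"

lemma ev_add: "ev g (a + b) = ev g a + ev g b"
  unfolding ev_def by (rule sum_keys_add) (rule scale_left_distrib)

lemma ev_single: "ev g (Poly_Mapping.single w c) = c \<odot> prod_list (map g (letters w))"
  by (cases "c = 0") (simp_all add: ev_def)

lemma ev_0 [simp]: "ev g 0 = 0"
  by (simp add: ev_def)

lemma ev_minus: "ev g (- a) = - ev g a"
  using ev_add[of g a "- a"] by (simp add: eq_neg_iff_add_eq_0 add.commute)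

lemma ev_diff: "ev g (a - b) = ev g a - ev g b"
  using ev_add[of g a "- b"] by (simp add: ev_minus)

lemma ev_sum: "ev g (\<Sum>i\<in>I. f i) = (\<Sum>i\<in>I. ev g (f i))"
  by (induction I rule: infinite_finite_induct) (simp_all add: ev_add)

lemma ev_mult: "ev g (a * b) = ev g a * ev g b"
proof (induction a rule: free_alg_induct)
  case (single w c)
  show ?case
  proof (induction b rule: free_alg_induct)
    case (single v d)
    show ?case by (simp add: mult_single ev_single plus_word_def scale_algebra mult.commute[of d c])
  qed (simp add: distrib_left ev_add)
qed (simp add: distrib_right ev_add)

lemma ev_const [simp]: "ev g (const c) = \<kappa> c"
  by (simp add: const_def ev_single zero_word_def scale_def)

lemma ev_X [simp]: "ev g (X i) = g (GenX i)"
  by (simp add: X_def ev_single)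

lemma ev_Y [simp]: "ev g (Y i) = g (GenY i)"
  by (simp add: Y_def ev_single)

lemma ev_1 [simp]: "ev g 1 = 1"
  using ev_const[of g 1] by (simp add: const_def)

lemma hom_eq_ev:
  assumes "\<And>a b. h (a + b) = h a + h b" "\<And>a b. h (a * b) = h a * h b" "\<And>c. h (const c) = \<kappa> c"
    and "\<And>i. h (X i) = g (GenX i)" "\<And>i. h (Y i) = g (GenY i)"
  shows "h a = ev g a"
proof (induction a rule: free_alg_induct)
  case (single w c)
  have one: "h (Poly_Mapping.single (Word l) 1) = prod_list (map g l)" for l
  proof (induction l)
    case Nil
    then show ?case using assms(3)[of 1] by (simp add: const_def zero_word_def)
  next
    case (Cons x l)
    have "h (Poly_Mapping.single (Word [x]) 1) = g x"
      using assms(4,5) by (cases x) (simp_all add: X_def Y_def)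
    moreover have "Poly_Mapping.single (Word (x # l)) (1::'k) = Poly_Mapping.single (Word [x]) 1 * Poly_Mapping.single (Word l) 1"
      by (simp add: mult_single plus_word_def)
    ultimately show ?case using Cons by (simp add: assms(2))
  qed
  have "Poly_Mapping.single w c = const c * Poly_Mapping.single w 1"
    by (simp add: const_def mult_single)
  then have "h (Poly_Mapping.single w c) = \<kappa> c * prod_list (map g (letters w))"
    using one[of "letters w"] by (simp add: assms(2,3))
  then show ?case by (simp add: ev_single scale_def)
next
  case (add a b)
  then show ?case by (simp add: assms(1) ev_add)
qed

lemma ev_in:
  assumes "subalg B" "range g \<subseteq> B"
  shows "ev g a \<in> B"
proof -
  have words: "prod_list (map g l) \<in> B" for l
  proof (induction l)
    case Nil
    then show ?case using subalgD(6)[OF assms(1)] by simp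
  next
    case (Cons x l)
    have "g x \<in> B" using assms(2) by blast
    from subalgD(4)[OF assms(1) this Cons] show ?case by simp
  qed
  show ?thesis
    unfolding ev_def by (intro additive_subgroup_sum[OF subalg_additive[OF assms(1)]] subalgD(5)[OF assms(1)] words)
qed

end

lemma const_central: "const c * a = a * const c"
proof (induction a rule: free_alg_induct)
  case (single w d)
  show ?case by (simp add: const_def mult_single mult.commute)
qed (simp add: distrib_left distrib_right)

lemma const_hom: "const (c + d) = const c + const d" "const (c * d) = const c * const d" "const 1 = 1" "const 0 = 0"
  by (simp_all add: const_def single_add mult_single)

lemma kalgebra_const: "kalgebra const"
  by unfold_locales (rule const_hom const_central)+

subsection \<open>The defining ideal\<close>

lemma type_ring_simps [simp]:
  "carrier type_ring = UNIV" "mult type_ring = (*)" "one type_ring = 1" "zero type_ring = 0" "add type_ring = (+)"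
  by (simp_all add: type_ring_def)

lemma ideal_qspace: "ideal (qspace_ideal qs) type_ring"
  unfolding qspace_ideal_def by (rule ring.genideal_ideal[OF ring_type_ring]) simp

lemma relations_in_ideal: "qspace_relations qs \<subseteq> qspace_ideal qs"
  unfolding qspace_ideal_def by (rule ring.genideal_self[OF ring_type_ring]) simp

lemma ideal_type_ringI:
  fixes I :: "'a::ring_1 set"
  assumes "0 \<in> I" "\<And>a b. a \<in> I \<Longrightarrow> b \<in> I \<Longrightarrow> a + b \<in> I" "\<And>a. a \<in> I \<Longrightarrow> - a \<in> I"
    and "\<And>a x. a \<in> I \<Longrightarrow> x * a \<in> I" "\<And>a x. a \<in> I \<Longrightarrow> a * x \<in> I"
  shows "ideal I type_ring"
proof (rule idealI[OF ring_type_ring])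
  interpret ring "type_ring :: 'a ring" by (rule ring_type_ring)
  have inv: "inv\<^bsub>add_monoid type_ring\<^esub> a = - a" for a :: 'a
    by (rule group.inv_equality[OF a_group]) simp_all
  show "subgroup I (add_monoid type_ring)"
  proof (rule group.subgroupI[OF a_group])
    show "inv\<^bsub>add_monoid type_ring\<^esub> a \<in> I" if "a \<in> I" for a
      unfolding inv using that by (rule assms(3))
  qed (use assms in auto)
qed (use assms in auto)

lemma ideal_qspace_minimal:
  assumes "ideal I type_ring" "qspace_relations qs \<subseteq> I"
  shows "qspace_ideal qs \<subseteq> I"
  unfolding qspace_ideal_def by (rule ring.genideal_minimal[OF ring_type_ring assms])

context
  fixes qs :: "'n \<Rightarrow> 'k::field"
begin

lemma qclass_eq_iff: "qclass qs a = qclass qs b \<longleftrightarrow> a - b \<in> qspace_ideal qs"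
proof -
  interpret ring "type_ring :: ('n, 'k) free_alg ring" by (rule ring_type_ring)
  have "inv\<^bsub>add_monoid type_ring\<^esub> b = - b" for b :: "('n, 'k) free_alg"
    by (rule group.inv_equality[OF a_group]) simp_all
  then have "a \<ominus>\<^bsub>type_ring\<^esub> b = a - b"
    by (simp add: a_minus_def a_inv_def)
  then show ?thesis
    using quotient_eq_iff_same_a_r_cos[OF ideal_qspace, of a b] by (simp add: qclass_def)
qed

lemma carrier_qspace: "carrier (qspace qs) = range (qclass qs)"
  unfolding qspace_def FactRing_def qclass_def by (auto simp: A_RCOSETS_def')

lemma qclass_add: "qclass qs a \<oplus>\<^bsub>qspace qs\<^esub> qclass qs b = qclass qs (a + b)"
  using ideal.a_rcos_sum[OF ideal_qspace, of a b] by (simp add: qspace_def FactRing_def qclass_def)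

lemma qclass_mult: "qclass qs a \<otimes>\<^bsub>qspace qs\<^esub> qclass qs b = qclass qs (a * b)"
  using ideal.rcoset_mult_add[OF ideal_qspace, of a b] by (simp add: qspace_def FactRing_def qclass_def)

lemma qclass_1: "\<one>\<^bsub>qspace qs\<^esub> = qclass qs 1"
  by (simp add: qspace_def FactRing_def qclass_def)

lemma qclass_0: "\<zero>\<^bsub>qspace qs\<^esub> = qclass qs 0"
proof -
  have "0 \<in> qspace_ideal qs"
    using additive_subgroup.zero_closed[OF ideal.axioms(1)[OF ideal_qspace], of qs] by simp
  then show ?thesis
    using ring.a_rcos_zero[OF ring_type_ring ideal_qspace, of 0 qs] by (simp add: qspace_def FactRing_def qclass_def)
qed

end

definition (in kalgebra) qspace_rel :: "('n \<Rightarrow> 'k) \<Rightarrow> ('n gen \<Rightarrow> 'a) \<Rightarrow> bool"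
  where "qspace_rel qs g \<longleftrightarrow> (\<forall>i j. g (GenX i) * g (GenX j) = g (GenX j) * g (GenX i) \<and>
    g (GenY i) * g (GenY j) = g (GenY j) * g (GenY i) \<and>
    g (GenY i) * g (GenX j) = (if i = j then qs i else 1) \<odot> (g (GenX j) * g (GenY i)))"

lemma (in kalgebra) ev_ideal:
  assumes "qspace_rel qs g" "a \<in> qspace_ideal qs"
  shows "ev g a = 0"
proof -
  have "ideal {a. ev g a = 0} type_ring"
    by (rule ideal_type_ringI) (auto simp: ev_add ev_minus ev_mult)
  moreover have "qspace_relations qs \<subseteq> {a. ev g a = 0}"
  proof
    fix r assume "r \<in> qspace_relations qs"
    then consider i j where "r = Y i * X j - const (if i = j then qs i else 1) * (X j * Y i)"
      | i j where "r = X i * X j - X j * X i" | i j where "r = Y i * Y j - Y j * Y i"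
      unfolding qspace_relations_def by blast
    then have "ev g r = 0"
    proof cases
      case 1
      have "g (GenY i) * g (GenX j) = (if i = j then qs i else 1) \<odot> (g (GenX j) * g (GenY i))"
        using assms(1) unfolding qspace_rel_def by blast
      then show ?thesis unfolding 1 ev_diff ev_mult ev_const ev_X ev_Y by (simp add: scale_def)
    next
      case 2
      have "g (GenX i) * g (GenX j) = g (GenX j) * g (GenX i)"
        using assms(1) unfolding qspace_rel_def by blast
      then show ?thesis unfolding 2 ev_diff ev_mult ev_X by simp
    next
      case 3
      have "g (GenY i) * g (GenY j) = g (GenY j) * g (GenY i)"
        using assms(1) unfolding qspace_rel_def by blast
      then show ?thesis unfolding 3 ev_diff ev_mult ev_Y by simp
    qed
    then show "r \<in> {a. ev g a = 0}" by simp
  qed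
  ultimately show ?thesis using ideal_qspace_minimal[of "{a. ev g a = 0}" qs] assms(2) by blast
qed

subsection \<open>Ordered monomials are independent\<close>

text \<open>
  The scalar by which the generators \<open>g\<close> and \<open>h\<close> commute. The normal form of a word is the
  product of these scalars over its inversions; it vanishes on the ideal, hence separates the
  ordered monomials.
\<close>

fun qscalar :: "('n \<Rightarrow> 'k::field) \<Rightarrow> 'n gen \<Rightarrow> 'n gen \<Rightarrow> 'k"
  where "qscalar qs (GenY i) (GenX j) = (if i = j then qs i else 1)"
  | "qscalar qs (GenX i) (GenY j) = (if i = j then inverse (qs i) else 1)"
  | "qscalar qs _ _ = 1"

lemma passing_upd:
  assumes "distinct ls" "g \<in> set ls" "g \<noteq> h"
  shows "passing \<mu> g ls (e(h := Suc (e h))) = (if h \<in> set (takeWhile (\<lambda>i. i \<noteq> g) ls) then \<mu> g h else 1) * passing \<mu> g ls e"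
  using assms
proof (induction ls)
  case (Cons i ls)
  have "h \<notin> set (takeWhile (\<lambda>i. i \<noteq> g) ls)" if "i = h" using that Cons.prems by (auto dest: set_takeWhileD)
  then show ?case using Cons by (auto simp: mult.assoc mult.left_commute)
qed simp

lemma takeWhile_before:
  assumes "distinct ls" "g \<in> set ls" "h \<in> set ls" "g \<noteq> h"
  shows "h \<in> set (takeWhile (\<lambda>i. i \<noteq> g) ls) \<longleftrightarrow> g \<notin> set (takeWhile (\<lambda>i. i \<noteq> h) ls)"
  using assms by (induction ls) (auto dest: set_takeWhileD)

lemma word_coeff_swap:
  assumes "distinct enum" "set enum = UNIV" "\<mu> g h * \<mu> h g = 1" "g \<noteq> h"
  shows "word_coeff \<mu> enum (u @ g # h # v) = \<mu> g h * word_coeff \<mu> enum (u @ h # g # v)"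
proof (induction u)
  case Nil
  have c: "count_list (g # v) = (count_list v)(g := Suc (count_list v g))" for g and v :: "'a list" by auto
  let ?h = "h \<in> set (takeWhile (\<lambda>i. i \<noteq> g) enum)" and ?g = "g \<in> set (takeWhile (\<lambda>i. i \<noteq> h) enum)"
  let ?p = "\<lambda>g. passing \<mu> g enum (count_list v)" and ?w = "word_coeff \<mu> enum v"
  have before: "?h \<longleftrightarrow> \<not> ?g"
    by (rule takeWhile_before) (use assms in auto)
  have "passing \<mu> g enum (count_list (h # v)) = (if ?h then \<mu> g h else 1) * ?p g"
    unfolding c by (rule passing_upd) (use assms in auto)
  then have gh: "word_coeff \<mu> enum (g # h # v) = ?w * ?p h * ((if ?h then \<mu> g h else 1) * ?p g)"
    by (simp only: word_coeff.simps)
  have "passing \<mu> h enum (count_list (g # v)) = (if ?g then \<mu> h g else 1) * ?p h"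
    unfolding c by (rule passing_upd) (use assms in auto)
  then have hg: "word_coeff \<mu> enum (h # g # v) = ?w * ?p g * ((if ?g then \<mu> h g else 1) * ?p h)"
    by (simp only: word_coeff.simps)
  have "word_coeff \<mu> enum (g # h # v) = \<mu> g h * word_coeff \<mu> enum (h # g # v)"
  proof (cases ?h)
    case True
    then show ?thesis using before unfolding gh hg by (simp add: mult_ac)
  next
    case False
    have "\<mu> g h * (?w * ?p g * (\<mu> h g * ?p h)) = (\<mu> g h * \<mu> h g) * (?w * ?p h * ?p g)"
      by (simp only: mult_ac)
    then show ?thesis using False before unfolding gh hg by (simp add: assms(3) mult_ac)
  qed
  then show ?case by (simp only: append_Nil)
next
  case (Cons x u)
  have "count_list (u @ g # h # v) = count_list (u @ h # g # v)" by auto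
  then show ?case using Cons by (simp add: mult.assoc)
qed

definition normal_coeff :: "('n \<Rightarrow> 'k::field) \<Rightarrow> 'n gen list \<Rightarrow> ('n, 'k) free_alg \<Rightarrow> ('n gen \<Rightarrow> nat) \<Rightarrow> 'k"
  where "normal_coeff qs enum a e = (\<Sum>w\<in>Poly_Mapping.keys a.
    (if count_list (letters w) = e then Poly_Mapping.lookup a w * word_coeff (qscalar qs) enum (letters w) else 0))"

lemma normal_coeff_add: "normal_coeff qs enum (a + b) e = normal_coeff qs enum a e + normal_coeff qs enum b e"
  unfolding normal_coeff_def by (rule sum_keys_add) (simp add: distrib_right)

lemma normal_coeff_single: "normal_coeff qs enum (Poly_Mapping.single w c) e
    = (if count_list (letters w) = e then c * word_coeff (qscalar qs) enum (letters w) else 0)"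
  by (cases "c = 0") (simp_all add: normal_coeff_def)

lemma normal_coeff_0: "normal_coeff qs enum 0 e = 0"
  by (simp add: normal_coeff_def)

lemma normal_coeff_minus: "normal_coeff qs enum (- a) e = - normal_coeff qs enum a e"
  using normal_coeff_add[of qs enum a "- a" e] by (simp add: normal_coeff_0 eq_neg_iff_add_eq_0 add.commute)

lemma normal_coeff_ideal:
  assumes enum: "distinct enum" "set enum = UNIV" and qs: "\<And>i. qs i \<noteq> 0" and a: "a \<in> qspace_ideal qs"
  shows "normal_coeff qs enum a e = 0"
proof -
  let ?J = "{a. \<forall>u v e. normal_coeff qs enum (u * a * v) e = 0}"
  have "ideal ?J type_ring"
  proof (rule ideal_type_ringI)
    fix a x assume a: "a \<in> ?J"
    have "u * (x * a) * v = (u * x) * a * v" "u * (a * x) * v = u * a * (x * v)" for u v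
      by (simp_all add: mult.assoc)
    then show "x * a \<in> ?J" "a * x \<in> ?J" using a by simp_all
  qed (auto simp: distrib_left distrib_right normal_coeff_add normal_coeff_minus normal_coeff_0)
  moreover have "qspace_relations qs \<subseteq> ?J"
  proof
    fix r assume "r \<in> qspace_relations qs"
    then obtain g h where gh: "g \<noteq> h \<or> r = 0"
      "r = Poly_Mapping.single (Word [g, h]) 1 - Poly_Mapping.single (Word [h, g]) (qscalar qs g h)"
    proof -
      have *: "const c * (X j * Y i) = Poly_Mapping.single (Word [GenX j, GenY i]) c"
        "Y i * X j = Poly_Mapping.single (Word [GenY i, GenX j]) 1"
        "X i * X j = Poly_Mapping.single (Word [GenX i, GenX j]) 1"
        "Y i * Y j = Poly_Mapping.single (Word [GenY i, GenY j]) 1" for c :: 'b and i j :: 'a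
        by (simp_all add: const_def X_def Y_def mult_single plus_word_def zero_word_def)
      let ?d = "\<lambda>g h. Poly_Mapping.single (Word [g, h]) 1 - Poly_Mapping.single (Word [h, g]) (qscalar qs g h)"
      from \<open>r \<in> qspace_relations qs\<close>
      consider i j where "r = ?d (GenY i) (GenX j)" | i j where "r = ?d (GenX i) (GenX j)" | i j where "r = ?d (GenY i) (GenY j)"
        unfolding qspace_relations_def * qscalar.simps by blast
      then show thesis
      proof cases
        case 1
        show thesis by (rule that[of "GenY i" "GenX j"]) (simp_all add: 1)
      next
        case 2
        show thesis by (rule that[of "GenX i" "GenX j"]) (auto simp: 2)
      next
        case 3
        show thesis by (rule that[of "GenY i" "GenY j"]) (auto simp: 3)
      qed
    qed
    have "normal_coeff qs enum (u * r * v) e = 0" for u v e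
    proof (cases "r = 0")
      case True
      then show ?thesis by (simp add: normal_coeff_0)
    next
      case False
      then have "g \<noteq> h" using gh(1) by simp
      have inv: "qscalar qs g h * qscalar qs h g = 1" using qs by (cases g; cases h) auto
      show ?thesis
      proof (induction u rule: free_alg_induct)
        case (single w c)
        show ?case
        proof (induction v rule: free_alg_induct)
          case (single w' d)
          let ?s = "\<lambda>g h c'. Poly_Mapping.single (Word (letters w @ g # h # letters w')) c'"
          have "Poly_Mapping.single w c * r * Poly_Mapping.single w' d = ?s g h (c * d) + ?s h g (- (c * qscalar qs g h * d))"
            by (simp add: gh(2) right_diff_distrib left_diff_distrib mult_single plus_word_def single_uminus)
          moreover have "count_list (letters w @ g # h # letters w') = count_list (letters w @ h # g # letters w')" by auto
          ultimately show ?case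
            using word_coeff_swap[OF enum, of "qscalar qs" g h "letters w" "letters w'"] inv \<open>g \<noteq> h\<close>
            by (simp add: normal_coeff_add normal_coeff_single mult_ac)
        next
          case (add a b)
          then show ?case by (simp add: distrib_left normal_coeff_add)
        qed
      next
        case (add a b)
        then show ?case by (simp add: distrib_right normal_coeff_add)
      qed
    qed
    then show "r \<in> ?J" by blast
  qed
  ultimately have "a \<in> ?J" using ideal_qspace_minimal a by blast
  then have "normal_coeff qs enum (1 * a * 1) e = 0" by blast
  then show ?thesis by simp
qed

context kalgebra
begin

lemma free_familyD:
  assumes "free_family f" "finite E" "(\<Sum>e\<in>E. r e \<odot> f e) = 0" "e \<in> E"
  shows "r e = 0"
  using assms unfolding free_family_def by blast

lemma qfamily_gens:
  assumes "qspace_rel qs g" "distinct enum" "set enum = UNIV" "\<And>i. qs i \<noteq> 0"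
  shows "qfamily \<kappa> g (qscalar qs) enum"
proof
  fix a b
  show "g a * g b = qscalar qs a b \<odot> (g b * g a)"
    using assms(1,4) unfolding qspace_rel_def by (cases a; cases b) auto
qed (use assms in auto)

lemma ev_normal_form:
  assumes "qspace_rel qs g" "distinct enum" "set enum = UNIV" "\<And>i. qs i \<noteq> 0"
  shows "ev g a = (\<Sum>e\<in>(\<lambda>w. count_list (letters w)) ` Poly_Mapping.keys a. normal_coeff qs enum a e \<odot> qmono g enum e)"
proof -
  interpret qfamily \<kappa> g "qscalar qs" enum by (rule qfamily_gens[OF assms])
  let ?c = "\<lambda>w. Poly_Mapping.lookup a w * word_coeff (qscalar qs) enum (letters w)"
  let ?e = "\<lambda>w. count_list (letters w)"
  have "ev g a = (\<Sum>w\<in>Poly_Mapping.keys a. ?c w \<odot> qmono g enum (?e w))"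
    unfolding ev_def by (simp add: word_normal_form)
  also have "\<dots> = (\<Sum>e\<in>?e ` Poly_Mapping.keys a. \<Sum>w\<in>{w \<in> Poly_Mapping.keys a. ?e w = e}. ?c w \<odot> qmono g enum (?e w))"
    by (rule sum.image_gen) simp
  also have "\<dots> = (\<Sum>e\<in>?e ` Poly_Mapping.keys a. normal_coeff qs enum a e \<odot> qmono g enum e)"
  proof (rule sum.cong[OF refl])
    fix e
    have "(\<Sum>w\<in>{w \<in> Poly_Mapping.keys a. ?e w = e}. ?c w \<odot> qmono g enum (?e w)) = (\<Sum>w\<in>{w \<in> Poly_Mapping.keys a. ?e w = e}. ?c w) \<odot> qmono g enum e"
      by (simp add: scale_sum_left)
    also have "(\<Sum>w\<in>{w \<in> Poly_Mapping.keys a. ?e w = e}. ?c w) = normal_coeff qs enum a e"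
      unfolding normal_coeff_def by (rule sum.inter_filter) simp
    finally show "(\<Sum>w\<in>{w \<in> Poly_Mapping.keys a. ?e w = e}. ?c w \<odot> qmono g enum (?e w)) = normal_coeff qs enum a e \<odot> qmono g enum e" .
  qed
  finally show ?thesis .
qed

lemma normal_coeff_eq_0:
  assumes "qspace_rel qs g" "distinct enum" "set enum = UNIV" "\<And>i. qs i \<noteq> 0"
    and "free_family (qmono g enum)" "ev g a = 0"
  shows "normal_coeff qs enum a e = 0"
proof (cases "e \<in> (\<lambda>w. count_list (letters w)) ` Poly_Mapping.keys a")
  case True
  then show ?thesis
    using free_familyD[OF assms(5) _ _ True, of "normal_coeff qs enum a"] assms(6)
    by (simp add: ev_normal_form[OF assms(1-4)])
next
  case False
  then show ?thesis unfolding normal_coeff_def by (intro sum.neutral) auto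
qed

lemma free_family_qspace:
  assumes rel: "qspace_rel qs g" and enum: "distinct enum" "set enum = UNIV" and qs: "\<And>i. qs i \<noteq> 0"
    and ker: "\<And>a. ev g a = 0 \<Longrightarrow> a \<in> qspace_ideal qs"
  shows "free_family (qmono g enum)"
  unfolding free_family_def
proof (intro allI impI)
  fix E :: "('b gen \<Rightarrow> nat) set" and r
  assume E: "finite E" and s: "(\<Sum>e\<in>E. r e \<odot> qmono g enum e) = 0"
  let ?a = "\<Sum>e\<in>E. Poly_Mapping.single (Word (expand enum e)) (r e)"
  have "ev g ?a = 0" using s by (simp add: ev_sum ev_single mono_expand)
  then have "?a \<in> qspace_ideal qs" by (rule ker)
  then have z: "normal_coeff qs enum ?a e = 0" for e by (rule normal_coeff_ideal[OF enum qs])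
  have cnt: "count_list (expand enum e) = e" for e
    using count_expand[of enum _ e] enum by auto
  have ns: "normal_coeff qs enum (\<Sum>e\<in>F. Poly_Mapping.single (Word (expand enum e)) (r e)) e'
     = (\<Sum>e\<in>F. if e = e' then r e * word_coeff (qscalar qs) enum (expand enum e) else 0)" for F e'
    by (induction F rule: infinite_finite_induct)
       (auto simp: normal_coeff_0 normal_coeff_add normal_coeff_single cnt)
  show "\<forall>e\<in>E. r e = 0"
  proof
    fix e assume "e \<in> E"
    then have "r e * word_coeff (qscalar qs) enum (expand enum e) = 0"
      using z[of e] E unfolding ns by simp
    moreover interpret qfamily \<kappa> g "qscalar qs" enum by (rule qfamily_gens[OF rel enum qs])
    have "qscalar qs i j \<noteq> 0" for i j using qs by (cases i; cases j) auto
    then have "word_coeff (qscalar qs) enum (expand enum e) \<noteq> 0" by (rule word_coeff_nonzero)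
    ultimately show "r e = 0" by simp
  qed
qed

end

subsection \<open>Extension to skew fields of fractions\<close>

lemma fraction_extension:
  fixes R :: "'f::division_ring set" and h :: "'f \<Rightarrow> 'g::division_ring"
  assumes R: "1 \<in> R" "\<And>a b. a \<in> R \<Longrightarrow> b \<in> R \<Longrightarrow> a + b \<in> R" "\<And>a b. a \<in> R \<Longrightarrow> b \<in> R \<Longrightarrow> a * b \<in> R"
    and frac: "\<And>f. \<exists>a\<in>R. \<exists>s\<in>R. s \<noteq> 0 \<and> f = a * inverse s"
    and h: "h 1 = 1" "\<And>a b. a \<in> R \<Longrightarrow> b \<in> R \<Longrightarrow> h (a + b) = h a + h b"
      "\<And>a b. a \<in> R \<Longrightarrow> b \<in> R \<Longrightarrow> h (a * b) = h a * h b" "\<And>a. a \<in> R \<Longrightarrow> h a = 0 \<Longrightarrow> a = 0"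
  obtains H where "\<And>a b. H (a + b) = H a + H b" "\<And>a b. H (a * b) = H a * H b"
    "\<And>a. a \<in> R \<Longrightarrow> H a = h a" "\<And>f. H f = 0 \<Longrightarrow> f = 0"
proof -
  obtain A S where AS: "\<And>f. A f \<in> R" "\<And>f. S f \<in> R" "\<And>f. S f \<noteq> 0" "\<And>f. f = A f * inverse (S f)"
    using frac by metis
  define H where "H f = h (A f) * inverse (h (S f))" for f
  have hn: "h a \<noteq> 0" if "a \<in> R" "a \<noteq> 0" for a using h(4) that by blast
  have ore: "\<exists>c\<in>R. \<exists>d\<in>R. d \<noteq> 0 \<and> a * d = s * c" if "a \<in> R" "s \<in> R" "s \<noteq> 0" for a s
  proof -
    obtain c d where cd: "c \<in> R" "d \<in> R" "d \<noteq> 0" "inverse s * a = c * inverse d" using frac by metis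
    have "a * d = s * (inverse s * a) * d" using that(3) by (simp flip: mult.assoc)
    also have "\<dots> = s * c" unfolding cd(4) using cd(3) by (simp add: mult.assoc)
    finally show ?thesis using cd by blast
  qed
  have key: "H f = h a * inverse (h s)" if as: "a \<in> R" "s \<in> R" "s \<noteq> 0" "f = a * inverse s" for f a s
  proof -
    obtain c d where cd: "c \<in> R" "d \<in> R" "d \<noteq> 0" "s * d = S f * c" using ore[OF as(2) AS(2,3)] by blast
    have c0: "c \<noteq> 0" using cd(3,4) as(3) by auto
    have "a = f * s" "A f = f * S f" using as AS[of f] by (simp_all add: mult.assoc) (metis mult.assoc AS(3,4) left_inverse mult.right_neutral)
    then have "a * d = A f * c" using cd(4) by (simp add: mult.assoc)
    then have 1: "h a * h d = h (A f) * h c" using h(3) as(1) cd AS(1) by metis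
    have 2: "h s * h d = h (S f) * h c" using h(3) as(2) cd AS(2) by metis
    have nz: "h d \<noteq> 0" "h c \<noteq> 0" "h s \<noteq> 0" "h (S f) \<noteq> 0" using hn cd c0 as AS by blast+
    have "h a * inverse (h s) = (h a * h d) * inverse (h s * h d)"
      using nz by (simp add: nonzero_inverse_mult_distrib mult.assoc flip: mult.assoc[of "h d"])
    also have "\<dots> = h (A f) * inverse (h (S f))"
      unfolding 1 2 using nz by (simp add: nonzero_inverse_mult_distrib mult.assoc flip: mult.assoc[of "h c"])
    finally show ?thesis by (simp add: H_def)
  qed
  have "H (f + g) = H f + H g" for f g
  proof -
    let ?a = "A f" and ?s = "S f" and ?b = "A g" and ?t = "S g"
    obtain c d where cd: "c \<in> R" "d \<in> R" "d \<noteq> 0" "?t * d = ?s * c" using ore[OF AS(2) AS(2,3)] by blast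
    have c0: "c \<noteq> 0" using cd(3,4) AS(3)[of g] by auto
    let ?m = "?s * c"
    have m: "?m \<in> R" "?m \<noteq> 0" using R(3)[OF AS(2) cd(1)] AS(3) c0 by auto
    have ac: "?a * c \<in> R" and bd: "?b * d \<in> R" using R(3) AS(1) cd by blast+
    have "?a * c * inverse ?m = f"
      using AS(3)[of f] AS(4)[of f] c0 by (simp add: nonzero_inverse_mult_distrib mult.assoc flip: mult.assoc[of c])
    moreover have "?b * d * inverse ?m = g"
      unfolding cd(4)[symmetric] using AS(3)[of g] AS(4)[of g] cd(3) by (simp add: nonzero_inverse_mult_distrib mult.assoc flip: mult.assoc[of d])
    ultimately have f: "f = ?a * c * inverse ?m" "g = ?b * d * inverse ?m" by simp_all
    then have "f + g = (?a * c + ?b * d) * inverse ?m" by (metis distrib_right)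
    then have "H (f + g) = (h (?a * c) + h (?b * d)) * inverse (h ?m)"
      using key[OF R(2)[OF ac bd] m] h(2)[OF ac bd] by simp
    then show ?thesis using key[OF ac m f(1)] key[OF bd m f(2)] by (simp add: distrib_right)
  qed
  moreover have "H (f * g) = H f * H g" for f g
  proof -
    let ?a = "A f" and ?s = "S f" and ?b = "A g" and ?t = "S g"
    obtain c d where cd: "c \<in> R" "d \<in> R" "d \<noteq> 0" "?b * d = ?s * c" using ore[OF AS(1) AS(2,3)] by blast
    have td: "?t * d \<in> R" "?t * d \<noteq> 0" using R(3)[OF AS(2) cd(2)] AS(3) cd(3) by auto
    have ac: "?a * c \<in> R" using R(3) AS(1) cd by blast
    have "?a * c * inverse (?t * d) = ?a * inverse ?s * (?s * c) * inverse d * inverse ?t"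
      using AS(3) cd(3) by (simp add: nonzero_inverse_mult_distrib mult.assoc flip: mult.assoc[of "inverse ?s"])
    also have "\<dots> = f * g"
      unfolding cd(4)[symmetric] using AS(4)[of f] AS(4)[of g] cd(3) by (simp add: mult.assoc flip: mult.assoc[of d])
    finally have "H (f * g) = h (?a * c) * inverse (h (?t * d))" using key[OF ac td] by simp
    also have "\<dots> = h ?a * h c * inverse (h d) * inverse (h ?t)"
      using h(3) AS cd hn by (simp add: nonzero_inverse_mult_distrib mult.assoc)
    also have "h ?a * h c = h ?a * inverse (h ?s) * (h ?s * h c)"
      using hn[OF AS(2,3)] by (simp add: mult.assoc flip: mult.assoc[of "inverse (h ?s)"])
    also have "h ?s * h c = h ?b * h d" using h(3) AS cd by metis
    finally show ?thesis using hn[OF cd(2,3)] by (simp add: H_def mult.assoc flip: mult.assoc[of "h d"])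
  qed
  moreover have "H a = h a" if "a \<in> R" for a using key[OF that R(1)] h(1) by simp
  moreover have "f = 0" if "H f = 0" for f
  proof -
    have "h (A f) = 0" using that hn[OF AS(2,3)] by (simp add: H_def)
    then have "A f = 0" using h(4) AS(1) by blast
    then show ?thesis using AS(4)[of f] by simp
  qed
  ultimately show thesis using that by blast
qed


lemma UNIV_gen: "(UNIV :: 'a gen set) = range GenX \<union> range GenY"
proof (rule Set.set_eqI)
  fix g :: "'a gen"
  show "g \<in> UNIV \<longleftrightarrow> g \<in> range GenX \<union> range GenY" by (cases g) auto
qed

instance gen :: (finite) finite
proof
  show "finite (UNIV :: 'a gen set)" unfolding UNIV_gen by simp
qed

lemma card_gen: "card (UNIV :: 'n::finite gen set) = 2 * card (UNIV :: 'n set)"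
proof -
  have "range (GenX :: 'n \<Rightarrow> _) \<inter> range GenY = {}" by auto
  then have "card (UNIV :: 'n gen set) = card (range (GenX :: 'n \<Rightarrow> _)) + card (range (GenY :: 'n \<Rightarrow> _))"
    unfolding UNIV_gen by (intro card_Un_disjoint) auto
  moreover have "card (range (GenX :: 'n \<Rightarrow> _)) = card (UNIV :: 'n set)" "card (range (GenY :: 'n \<Rightarrow> _)) = card (UNIV :: 'n set)"
    by (auto intro!: card_image simp: inj_on_def)
  ultimately show ?thesis by simp
qed

locale embedded_qspace =
  fixes qs :: "'n::finite \<Rightarrow> 'k::field_char_0" and \<iota> :: "('n, 'k) free_alg set \<Rightarrow> 'f::division_ring"
  assumes qs_nonzero: "qs i \<noteq> 0"
    and fractions: "skew_field_of_fractions (qspace qs) \<iota>"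
begin

definition E :: "('n, 'k) free_alg \<Rightarrow> 'f"
  where "E a = \<iota> (qclass qs a)"

definition emb :: "'k \<Rightarrow> 'f"
  where "emb c = E (const c)"

definition gens :: "'n gen \<Rightarrow> 'f"
  where "gens g = (case g of GenX i \<Rightarrow> E (X i) | GenY i \<Rightarrow> E (Y i))"

lemma in_carrier: "qclass qs a \<in> carrier (qspace qs)"
  by (simp add: carrier_qspace)

lemma \<iota>_hom: "\<iota> \<in> ring_hom (qspace qs) type_ring"
  and \<iota>_inj: "inj_on \<iota> (carrier (qspace qs))"
  using fractions by (simp_all add: skew_field_of_fractions_def)

lemma E_add: "E (a + b) = E a + E b"
  using ring_hom_add[OF \<iota>_hom in_carrier in_carrier, of a b] by (simp add: E_def qclass_add)

lemma E_mult: "E (a * b) = E a * E b"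
  using ring_hom_mult[OF \<iota>_hom in_carrier in_carrier, of a b] by (simp add: E_def qclass_mult)

lemma E_1: "E 1 = 1"
  using ring_hom_one[OF \<iota>_hom] by (simp add: E_def qclass_1)

lemma E_eq_iff: "E a = E b \<longleftrightarrow> qclass qs a = qclass qs b"
  unfolding E_def by (rule inj_on_eq_iff[OF \<iota>_inj in_carrier in_carrier])

lemma E_0: "E 0 = 0"
  using E_add[of 0 0] by simp

lemma E_eq_0_iff: "E a = 0 \<longleftrightarrow> a \<in> qspace_ideal qs"
  using E_eq_iff[of a 0] qclass_eq_iff[of qs a 0] by (simp add: E_0)

sublocale skew_kalgebra emb
proof
  fix c d :: 'k and a :: 'f
  show "emb (c + d) = emb c + emb d" "emb (c * d) = emb c * emb d" "emb 1 = 1"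
    by (simp_all add: emb_def const_hom E_add E_mult E_1)
  obtain r s where rs: "r \<in> carrier (qspace qs)" "s \<in> carrier (qspace qs)" "s \<noteq> \<zero>\<^bsub>qspace qs\<^esub>" "a = \<iota> r * inverse (\<iota> s)"
    using fractions unfolding skew_field_of_fractions_def by blast
  then obtain a' s' where as: "r = qclass qs a'" "s = qclass qs s'" by (auto simp: carrier_qspace)
  have "emb c * E b = E b * emb c" for b
    by (simp add: emb_def const_central flip: E_mult)
  moreover from this[of s'] have "emb c * inverse (E s') = inverse (E s') * emb c"
  proof (cases "E s' = 0")
    case False
    have "emb c * inverse (E s') = inverse (E s') * (E s' * emb c) * inverse (E s')"
      using False by (simp flip: mult.assoc)
    also have "\<dots> = inverse (E s') * (emb c * E s') * inverse (E s')"
      by (simp only: \<open>emb c * E s' = E s' * emb c\<close>)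
    also have "\<dots> = inverse (E s') * emb c" using False by (simp add: mult.assoc)
    finally show ?thesis .
  qed simp
  ultimately show "emb c * a = a * emb c"
    unfolding rs(4) as by (metis E_def mult.assoc)
qed

notation scale (infixr "\<odot>" 75)

lemma E_ev: "E a = ev gens a"
  by (rule hom_eq_ev) (simp_all add: E_add E_mult emb_def gens_def)

lemma fraction: "\<exists>a s. f = E a * inverse (E s) \<and> E s \<noteq> 0"
proof -
  obtain r s where rs: "r \<in> carrier (qspace qs)" "s \<in> carrier (qspace qs)" "s \<noteq> \<zero>\<^bsub>qspace qs\<^esub>" "f = \<iota> r * inverse (\<iota> s)"
    using fractions unfolding skew_field_of_fractions_def by blast
  then obtain a' s' where as: "r = qclass qs a'" "s = qclass qs s'" by (auto simp: carrier_qspace)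
  have "E s' \<noteq> 0" using rs(3) E_eq_iff[of s' 0] by (simp add: as qclass_0 E_0)
  then show ?thesis using rs(4) unfolding as E_def by blast
qed

lemma E_relations: "qspace_rel qs gens"
proof -
  have r: "r \<in> qspace_relations qs \<Longrightarrow> E r = 0" for r
    using relations_in_ideal[of qs] by (auto simp: E_eq_0_iff)
  have d: "E (a - b) = E a - E b" for a b by (simp add: E_ev ev_diff)
  have "E (Y i) * E (X j) = (if i = j then qs i else 1) \<odot> (E (X j) * E (Y i))" for i j
  proof -
    have "E (Y i * X j - const (if i = j then qs i else 1) * (X j * Y i)) = 0"
      by (rule r) (unfold qspace_relations_def, blast)
    then show ?thesis unfolding d E_mult scale_def emb_def by simp
  qed
  moreover have "E (X i) * E (X j) = E (X j) * E (X i)" for i j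
  proof -
    have "E (X i * X j - X j * X i) = 0" by (rule r) (unfold qspace_relations_def, blast)
    then show ?thesis unfolding d E_mult by simp
  qed
  moreover have "E (Y i) * E (Y j) = E (Y j) * E (Y i)" for i j
  proof -
    have "E (Y i * Y j - Y j * Y i) = 0" by (rule r) (unfold qspace_relations_def, blast)
    then show ?thesis unfolding d E_mult by simp
  qed
  ultimately show ?thesis unfolding qspace_rel_def gens_def by simp
qed

lemma free_gens:
  assumes "distinct enum" "set enum = UNIV"
  shows "free_family (qmono gens enum)"
  by (rule free_family_qspace[OF E_relations assms qs_nonzero]) (simp add: E_eq_0_iff flip: E_ev)

lemma range_E_subalg: "subalg (range E)"
  unfolding subalg_def
proof (intro conjI ballI)
  show "range emb \<subseteq> range E" by (auto simp: emb_def)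
  fix a b assume "a \<in> range E" "b \<in> range E"
  then obtain a' b' where "a = E a'" "b = E b'" by blast
  moreover have "E (a' - b') = E a' - E b'" by (simp add: E_ev ev_diff)
  ultimately show "a + b \<in> range E" "a - b \<in> range E" "a * b \<in> range E"
    by (metis E_add rangeI, metis rangeI, metis E_mult rangeI)
qed

text \<open>Homomorphisms out of the skew field are determined by, and extend from, the quantum space.\<close>

lemma extension_unique:
  fixes H H' :: "'f \<Rightarrow> 'g::division_ring"
  assumes H: "\<And>a b. H (a * b) = H a * H b" "\<And>a b. H' (a * b) = H' a * H' b"
    and one: "H 1 = 1" and eq: "\<And>a. H (E a) = H' (E a)"
  shows "H f = H' f"
proof -
  obtain a s where as: "f = E a * inverse (E s)" "E s \<noteq> 0" using fraction by blast
  have "H (E s) * H (inverse (E s)) = 1" using as(2) by (simp add: one flip: H)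
  then have nz: "H (E s) \<noteq> 0" by auto
  have fs: "f * E s = E a" using as by (simp add: mult.assoc)
  have "H f * H (E s) = H (E a)" by (simp only: fs flip: H(1))
  also have "\<dots> = H' f * H' (E s)" by (simp only: eq fs flip: H(2))
  finally have "H f * H (E s) = H' f * H (E s)" by (simp only: eq)
  then show ?thesis by (rule mult_right_cancel[OF nz, THEN iffD1])
qed

lemma extension_exists:
  fixes \<kappa>' :: "'k \<Rightarrow> 'g::division_ring" and g :: "'n gen \<Rightarrow> 'g"
  assumes K: "skew_kalgebra \<kappa>'" and rel: "kalgebra.qspace_rel \<kappa>' qs g"
    and inj: "\<And>a. kalgebra.ev \<kappa>' g a = 0 \<Longrightarrow> E a = 0"
  obtains H where "\<And>a b. H (a + b) = H a + H b" "\<And>a b. H (a * b) = H a * H b"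
    "\<And>a. H (E a) = kalgebra.ev \<kappa>' g a" "\<And>f. H f = 0 \<Longrightarrow> f = 0"
proof -
  interpret K: skew_kalgebra \<kappa>' by (rule K)
  define h where "h r = K.ev g (SOME a. E a = r)" for r
  have hE: "h (E a) = K.ev g a" for a
  proof -
    define b where "b = (SOME b. E b = E a)"
    have "E b = E a" unfolding b_def by (rule someI[of _ a]) simp
    then have "b - a \<in> qspace_ideal qs" by (simp add: E_eq_iff qclass_eq_iff)
    then have "K.ev g (b - a) = 0" by (rule K.ev_ideal[OF rel])
    then show ?thesis by (simp add: h_def K.ev_diff flip: b_def)
  qed
  note sub = subalgD[OF range_E_subalg]
  obtain H where H: "\<And>a b. H (a + b) = H a + H b" "\<And>a b. H (a * b) = H a * H b"
    "\<And>a. a \<in> range E \<Longrightarrow> H a = h a" "\<And>f. H f = 0 \<Longrightarrow> f = 0"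
  proof (rule fraction_extension[of "range E" h])
    show "\<exists>a\<in>range E. \<exists>s\<in>range E. s \<noteq> 0 \<and> f = a * inverse s" for f using fraction[of f] by blast
    show "h 1 = 1" using hE[of 1] by (simp add: E_1)
    show "h (a + b) = h a + h b" if "a \<in> range E" "b \<in> range E" for a b
      using that by (auto simp: hE K.ev_add simp flip: E_add)
    show "h (a * b) = h a * h b" if "a \<in> range E" "b \<in> range E" for a b
      using that by (auto simp: hE K.ev_mult simp flip: E_mult)
    show "a = 0" if "a \<in> range E" "h a = 0" for a using that inj by (auto simp: hE)
  qed (use sub in auto)
  show thesis using that[of H] H hE by simp
qed

end

subsection \<open>The action of the Weyl groups\<close>

lemma weyl_sign_square: "weyl_sign \<alpha> i * weyl_sign \<alpha> i = 1"
  by (simp add: weyl_sign_def)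

lemma weyl_sign_nonzero: "weyl_sign \<alpha> i \<noteq> (0 :: 'k::field)"
  by (simp add: weyl_sign_def)

lemma weyl_sign_add: "weyl_sign (\<lambda>i. \<alpha> i + \<beta> i) i = weyl_sign \<alpha> i * weyl_sign \<beta> i"
  by (cases "\<alpha> i"; cases "\<beta> i") (simp_all add: weyl_sign_def)

locale weyl_setting = embedded_qspace "\<lambda>_. q" \<iota>
  for q :: "'k::field_char_0" and \<iota> :: "('n::finite, 'k) free_alg set \<Rightarrow> 'f::division_ring"
begin

notation scale (infixr "\<odot>" 75)

definition twisted :: "('n \<Rightarrow> 'n) \<Rightarrow> ('n \<Rightarrow> bit) \<Rightarrow> 'n gen \<Rightarrow> 'f"
  where "twisted \<zeta> \<alpha> g = (case g of GenX i \<Rightarrow> weyl_sign \<alpha> i \<odot> gens (GenX (\<zeta> i)) | GenY i \<Rightarrow> weyl_sign \<alpha> i \<odot> gens (GenY (\<zeta> i)))"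

abbreviation twist :: "('n \<Rightarrow> 'n) \<Rightarrow> ('n \<Rightarrow> bit) \<Rightarrow> ('n, 'k) free_alg \<Rightarrow> 'f"
  where "twist \<zeta> \<alpha> \<equiv> ev (twisted \<zeta> \<alpha>)"

definition acts :: "('n \<Rightarrow> 'n) \<Rightarrow> ('n \<Rightarrow> bit) \<Rightarrow> ('f \<Rightarrow> 'f) \<Rightarrow> bool"
  where "acts \<zeta> \<alpha> H \<longleftrightarrow> (\<forall>a b. H (a + b) = H a + H b) \<and> (\<forall>a b. H (a * b) = H a * H b) \<and> (\<forall>a. H (E a) = twist \<zeta> \<alpha> a)"

lemma gens_rel:
  "gens (GenX i) * gens (GenX j) = gens (GenX j) * gens (GenX i)"
  "gens (GenY i) * gens (GenY j) = gens (GenY j) * gens (GenY i)"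
  "gens (GenY i) * gens (GenX j) = (if i = j then q else 1) \<odot> (gens (GenX j) * gens (GenY i))"
  using E_relations unfolding qspace_rel_def by blast+

lemma twisted_rel:
  assumes "inj \<zeta>"
  shows "qspace_rel (\<lambda>_. q) (twisted \<zeta> \<alpha>)"
proof -
  have s: "(a \<odot> b) * (c \<odot> d) = (a * c) \<odot> (b * d)" for a c :: 'k and b d
    by (simp add: scale_algebra)
  have "\<zeta> i = \<zeta> j \<longleftrightarrow> i = j" for i j using assms by (auto dest: injD)
  then show ?thesis
    unfolding qspace_rel_def twisted_def gen.case s
    by (intro allI conjI) (simp_all add: gens_rel(1)[of "\<zeta> _" "\<zeta> _"] gens_rel(2)[of "\<zeta> _" "\<zeta> _"] gens_rel(3)[of "\<zeta> _" "\<zeta> _"] mult.commute mult.left_commute)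
qed

lemma twist_range: "twist \<zeta> \<alpha> a \<in> range E"
proof (rule ev_in[OF range_E_subalg])
  have "gens g \<in> range E" for g by (cases g) (auto simp: gens_def)
  then show "range (twisted \<zeta> \<alpha>) \<subseteq> range E"
    unfolding twisted_def using subalgD(5)[OF range_E_subalg] by (auto split: gen.split)
qed

lemma twist_twist:
  assumes S: "\<And>a. S (E a) = twist \<zeta> \<alpha> a"
  shows "S (twist \<tau> \<beta> a) = twist (\<zeta> \<circ> \<tau>) (\<lambda>i. \<alpha> (\<tau> i) + \<beta> i) a"
proof (rule hom_eq_ev)
  fix a b
  obtain a' where a': "twist \<tau> \<beta> a = E a'" using twist_range[of \<tau> \<beta> a] by blast
  obtain b' where b': "twist \<tau> \<beta> b = E b'" using twist_range[of \<tau> \<beta> b] by blast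
  have "S (twist \<tau> \<beta> (a + b)) = S (E (a' + b'))" by (simp only: ev_add a' b' E_add)
  then show "S (twist \<tau> \<beta> (a + b)) = S (twist \<tau> \<beta> a) + S (twist \<tau> \<beta> b)"
    by (simp only: S ev_add a' b')
  have "S (twist \<tau> \<beta> (a * b)) = S (E (a' * b'))" by (simp only: ev_mult a' b' E_mult)
  then show "S (twist \<tau> \<beta> (a * b)) = S (twist \<tau> \<beta> a) * S (twist \<tau> \<beta> b)"
    by (simp only: S ev_mult a' b')
next
  fix c
  show "S (twist \<tau> \<beta> (const c)) = emb c" using S[of "const c"] by (simp add: emb_def[symmetric])
next
  fix i
  have "twist \<tau> \<beta> (X i) = E (const (weyl_sign \<beta> i) * X (\<tau> i))"
    by (simp add: twisted_def gens_def E_mult emb_def[symmetric] scale_def)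
  then show "S (twist \<tau> \<beta> (X i)) = twisted (\<zeta> \<circ> \<tau>) (\<lambda>i. \<alpha> (\<tau> i) + \<beta> i) (GenX i)"
    by (simp add: S ev_mult twisted_def weyl_sign_def scale_def[symmetric] scale_scale split: if_splits)
  have "twist \<tau> \<beta> (Y i) = E (const (weyl_sign \<beta> i) * Y (\<tau> i))"
    by (simp add: twisted_def gens_def E_mult emb_def[symmetric] scale_def)
  then show "S (twist \<tau> \<beta> (Y i)) = twisted (\<zeta> \<circ> \<tau>) (\<lambda>i. \<alpha> (\<tau> i) + \<beta> i) (GenY i)"
    by (simp add: S ev_mult twisted_def weyl_sign_def scale_def[symmetric] scale_scale split: if_splits)
qed

lemma twist_id: "twist id (\<lambda>_. 0) a = E a"
proof -
  have "twisted id (\<lambda>_. 0) = gens" by (auto simp: twisted_def weyl_sign_def fun_eq_iff split: gen.split)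
  then show ?thesis by (simp add: E_ev)
qed

lemma weyl_inverse:
  assumes "\<zeta> permutes UNIV"
  shows "inv_into UNIV \<zeta> permutes UNIV" "inv_into UNIV \<zeta> \<circ> \<zeta> = id" "\<zeta> \<circ> inv_into UNIV \<zeta> = id"
    "(\<lambda>i. (\<alpha> \<circ> inv_into UNIV \<zeta>) (\<zeta> i) + \<alpha> i) = (\<lambda>_. 0 :: bit)" "(\<lambda>i. \<alpha> (inv_into UNIV \<zeta> i) + (\<alpha> \<circ> inv_into UNIV \<zeta>) i) = (\<lambda>_. 0 :: bit)"
  using permutes_inv[OF assms] permutes_inv_o[OF assms] permutes_inverses[OF assms] by auto

lemma acts_exists:
  assumes \<zeta>: "\<zeta> permutes UNIV"
  shows "\<exists>H. acts \<zeta> \<alpha> H"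
proof -
  let ?\<tau> = "inv_into UNIV \<zeta>" and ?\<beta> = "\<alpha> \<circ> inv_into UNIV \<zeta>"
  note \<tau> = weyl_inverse[OF \<zeta>]
  define S where "S r = twist ?\<tau> ?\<beta> (SOME b. E b = r)" for r
  have S: "S (E a) = twist ?\<tau> ?\<beta> a" for a
  proof -
    define b where "b = (SOME b. E b = E a)"
    have "E b = E a" unfolding b_def by (rule someI[of _ a]) simp
    then have "b - a \<in> qspace_ideal (\<lambda>_. q)" by (simp add: E_eq_iff qclass_eq_iff)
    then have "twist ?\<tau> ?\<beta> (b - a) = 0"
      by (rule ev_ideal[OF twisted_rel[OF permutes_inj[OF \<tau>(1)]]])
    then show ?thesis by (simp add: S_def ev_diff flip: b_def)
  qed
  have "E a = 0" if "twist \<zeta> \<alpha> a = 0" for a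
  proof -
    have "S (twist \<zeta> \<alpha> a) = E a"
      using twist_twist[of S ?\<tau> ?\<beta> \<zeta> \<alpha> a, OF S] by (simp only: \<tau>(2,4) twist_id)
    then have "E a = S (E 0)" using that by (simp add: E_0)
    then show ?thesis by (simp add: S)
  qed
  from extension_exists[OF skew_kalgebra_axioms twisted_rel[OF permutes_inj[OF \<zeta>]] this]
  obtain H where "\<And>a b. H (a + b) = H a + H b" "\<And>a b. H (a * b) = H a * H b" "\<And>a. H (E a) = twist \<zeta> \<alpha> a"
    by metis
  then show ?thesis unfolding acts_def by blast
qed

lemma actsD:
  assumes "acts \<zeta> \<alpha> H"
  shows "H (a + b) = H a + H b" "H (a * b) = H a * H b" "H (E c) = twist \<zeta> \<alpha> c" "H (emb e) = emb e" "H 1 = 1" "H 0 = 0"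
proof -
  show *: "H (a + b) = H a + H b" "H (a * b) = H a * H b" "H (E c) = twist \<zeta> \<alpha> c" for a b c
    using assms unfolding acts_def by blast+
  show "H (emb e) = emb e" using *(3)[of "const e"] by (simp add: emb_def[symmetric])
  show "H 1 = 1" using *(3)[of 1] by (simp add: E_1)
  show "H 0 = 0" using *(1)[of 0 0] by simp
qed

lemma acts_unique:
  assumes "acts \<zeta> \<alpha> H" "\<And>a b. H' (a * b) = H' a * H' b" "\<And>a. H' (E a) = twist \<zeta> \<alpha> a"
  shows "H = H'"
proof
  fix f
  show "H f = H' f"
    by (rule extension_unique) (use actsD[OF assms(1)] assms(2,3) in simp_all)
qed

lemma acts_comp:
  assumes "acts \<zeta> \<alpha> H" "acts \<tau> \<beta> H'" "acts (\<zeta> \<circ> \<tau>) (\<lambda>i. \<alpha> (\<tau> i) + \<beta> i) H''"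
  shows "H (H' f) = H'' f"
proof -
  have "H'' = (\<lambda>f. H (H' f))"
    by (rule acts_unique[OF assms(3)])
       (simp_all add: actsD[OF assms(1)] actsD[OF assms(2)] twist_twist[OF actsD(3)[OF assms(1)]])
  then show ?thesis by simp
qed

lemma acts_id: 
  assumes "acts id (\<lambda>_. 0) H"
  shows "H f = f"
  using acts_unique[OF assms, of id] by (simp add: twist_id)

lemma acts_bij:
  assumes \<zeta>: "\<zeta> permutes UNIV" and H: "acts \<zeta> \<alpha> H"
  shows "bij H"
proof -
  note \<tau> = weyl_inverse[OF \<zeta>]
  obtain H' where H': "acts (inv_into UNIV \<zeta>) (\<alpha> \<circ> inv_into UNIV \<zeta>) H'" using acts_exists[OF \<tau>(1)] by blast
  obtain I where I: "acts id (\<lambda>_. 0) I" using acts_exists[OF permutes_id] by blast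
  have "H' (H f) = f" for f
    using acts_comp[OF H' H, of I f] I acts_id[OF I] by (simp only: \<tau>)
  moreover have "H (H' f) = f" for f
    using acts_comp[OF H H', of I f] I acts_id[OF I] by (simp only: \<tau>)
  ultimately show ?thesis by (metis bijI')
qed

lemma weyl_qspace_eq:
  assumes \<zeta>: "\<zeta> permutes UNIV" and H: "acts \<zeta> \<alpha> H" and C: "C \<in> carrier (qspace (\<lambda>_. q))"
  shows "\<iota> (weyl_qspace q (\<zeta>, \<alpha>) C) = H (\<iota> C)"
proof -
  let ?A = "qspace (\<lambda>_::'n. q)" and ?cl = "qclass (\<lambda>_::'n. q)"
  note \<tau> = weyl_inverse[OF \<zeta>]
  define f where "f C = (if C \<in> carrier ?A then inv_into (carrier ?A) \<iota> (H (\<iota> C)) else undefined)" for C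
  have f: "f C \<in> carrier ?A" "\<iota> (f C) = H (\<iota> C)" if "C \<in> carrier ?A" for C
  proof -
    obtain a where "C = ?cl a" using \<open>C \<in> carrier ?A\<close> by (auto simp: carrier_qspace)
    then have "H (\<iota> C) = twist \<zeta> \<alpha> a" using actsD(3)[OF H, of a] by (simp add: E_def)
    then obtain b where "H (\<iota> C) = \<iota> (?cl b)" using twist_range by (metis E_def rangeE)
    then have im: "H (\<iota> C) \<in> \<iota> ` carrier ?A" using in_carrier by simp
    show "f C \<in> carrier ?A" "\<iota> (f C) = H (\<iota> C)"
      using that inv_into_into[OF im] f_inv_into_f[OF im] by (simp_all add: f_def)
  qed
  have inj: "C = D" if "C \<in> carrier ?A" "D \<in> carrier ?A" "\<iota> C = \<iota> D" for C D
    using \<iota>_inj that by (meson inj_onD)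
  interpret Q: ring ?A unfolding qspace_def by (rule ideal.quotient_is_ring[OF ideal_qspace])
  have hom: "f \<in> ring_hom ?A ?A"
  proof (rule ring_hom_memI)
    fix C D assume CD: "C \<in> carrier ?A" "D \<in> carrier ?A"
    show "f (C \<otimes>\<^bsub>?A\<^esub> D) = f C \<otimes>\<^bsub>?A\<^esub> f D"
      by (rule inj) (use f CD ring_hom_mult[OF \<iota>_hom] actsD[OF H] in simp_all)
    show "f (C \<oplus>\<^bsub>?A\<^esub> D) = f C \<oplus>\<^bsub>?A\<^esub> f D"
      by (rule inj) (use f CD ring_hom_add[OF \<iota>_hom] actsD[OF H] in simp_all)
  next
    show "f \<one>\<^bsub>?A\<^esub> = \<one>\<^bsub>?A\<^esub>"
      by (rule inj) (use f ring_hom_one[OF \<iota>_hom] actsD[OF H] in simp_all)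
  qed (rule f)
  have bij: "bij_betw f (carrier ?A) (carrier ?A)"
  proof (rule bij_betw_imageI)
    show "inj_on f (carrier ?A)"
    proof (rule inj_onI)
      fix C D assume CD: "C \<in> carrier ?A" "D \<in> carrier ?A" "f C = f D"
      then have "H (\<iota> C) = H (\<iota> D)" using f(2) by metis
      then have "\<iota> C = \<iota> D" using acts_bij[OF \<zeta> H] by (meson bij_is_inj injD)
      then show "C = D" using inj CD by blast
    qed
    show "f ` carrier ?A = carrier ?A"
    proof
      show "f ` carrier ?A \<subseteq> carrier ?A" using f(1) by blast
      show "carrier ?A \<subseteq> f ` carrier ?A"
      proof
        fix C assume C: "C \<in> carrier ?A"
        obtain H' where H': "acts (inv_into UNIV \<zeta>) (\<alpha> \<circ> inv_into UNIV \<zeta>) H'" using acts_exists[OF \<tau>(1)] by blast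
        obtain I where I: "acts id (\<lambda>_. 0) I" using acts_exists[OF permutes_id] by blast
        have HH': "H (H' r) = r" for r
          using acts_comp[OF H H', of I r] I acts_id[OF I] by (simp only: \<tau>)
        obtain b where b: "C = ?cl b" using C by (auto simp: carrier_qspace)
        obtain a where a: "H' (\<iota> C) = \<iota> (?cl a)"
          using actsD(3)[OF H', of b] twist_range unfolding b E_def by (metis E_def rangeE)
        have "f (?cl a) = C"
          by (rule inj) (use f[OF in_carrier, of a] C HH'[of "\<iota> C"] a in simp_all)
        then show "C \<in> f ` carrier ?A" using in_carrier by blast
      qed
    qed
  qed
  have clE: "f (?cl a) = ?cl b" if "twist \<zeta> \<alpha> a = E b" for a b
    by (rule inj) (use f[OF in_carrier, of a] in_carrier actsD(3)[OF H, of a] that in \<open>simp_all add: E_def\<close>)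
  let ?P = "\<lambda>f. f \<in> ring_iso ?A ?A \<and> f \<in> extensional (carrier ?A) \<and>
      (\<forall>c. f (?cl (const c)) = ?cl (const c)) \<and>
      (\<forall>i. f (?cl (X i)) = ?cl (const (weyl_sign \<alpha> i) * X (\<zeta> i))) \<and>
      (\<forall>i. f (?cl (Y i)) = ?cl (const (weyl_sign \<alpha> i) * Y (\<zeta> i)))"
  have "?P f"
  proof (intro conjI allI)
    show "f \<in> ring_iso ?A ?A" using hom bij by (simp add: ring_iso_def)
    show "f \<in> extensional (carrier ?A)" by (simp add: extensional_def f_def)
    show "f (?cl (const c)) = ?cl (const c)" for c by (rule clE) (simp add: emb_def)
    show "f (?cl (X i)) = ?cl (const (weyl_sign \<alpha> i) * X (\<zeta> i))" for i
      by (rule clE) (simp add: twisted_def gens_def E_mult emb_def[symmetric] scale_def)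
    show "f (?cl (Y i)) = ?cl (const (weyl_sign \<alpha> i) * Y (\<zeta> i))" for i
      by (rule clE) (simp add: twisted_def gens_def E_mult emb_def[symmetric] scale_def)
  qed
  moreover have "f' = f" if P: "?P f'" for f'
  proof
    fix C
    show "f' C = f C"
    proof (cases "C \<in> carrier ?A")
      case True
      have f'h: "f' \<in> ring_hom ?A ?A" using P by (simp add: ring_iso_def)
      have f'c: "f' (?cl a) \<in> carrier ?A" for a by (rule ring_hom_closed[OF f'h in_carrier])
      have "\<iota> (f' (?cl a)) = twist \<zeta> \<alpha> a" for a
      proof (rule hom_eq_ev)
        fix a b
        show "\<iota> (f' (?cl (a + b))) = \<iota> (f' (?cl a)) + \<iota> (f' (?cl b))"
          using ring_hom_add[OF f'h in_carrier in_carrier, of a b] ring_hom_add[OF \<iota>_hom f'c f'c, of a b]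
          by (simp add: qclass_add)
        show "\<iota> (f' (?cl (a * b))) = \<iota> (f' (?cl a)) * \<iota> (f' (?cl b))"
          using ring_hom_mult[OF f'h in_carrier in_carrier, of a b] ring_hom_mult[OF \<iota>_hom f'c f'c, of a b]
          by (simp add: qclass_mult)
      next
        fix c show "\<iota> (f' (?cl (const c))) = emb c" using P by (simp add: emb_def E_def)
      next
        fix i
        have 1: "\<iota> (?cl a) = E a" for a by (simp add: E_def)
        show "\<iota> (f' (?cl (X i))) = twisted \<zeta> \<alpha> (GenX i)" "\<iota> (f' (?cl (Y i))) = twisted \<zeta> \<alpha> (GenY i)"
          using P by (simp_all add: 1 twisted_def gens_def E_mult emb_def[symmetric] scale_def)
      qed
      moreover obtain a where "C = ?cl a" using True by (auto simp: carrier_qspace)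
      ultimately show ?thesis
        using inj[OF f'c f(1)[OF in_carrier], of a a] f(2)[OF in_carrier, of a] actsD(3)[OF H, of a] by (simp add: E_def)
    next
      case False
      then show ?thesis using P by (simp add: extensional_def f_def)
    qed
  qed
  ultimately have "weyl_qspace q (\<zeta>, \<alpha>) = f"
    unfolding weyl_qspace_def Let_def prod.case by (rule the_equality)
  then show ?thesis using f(2)[OF C] by simp
qed

lemma weyl_frac_acts:
  assumes \<zeta>: "\<zeta> permutes UNIV"
  shows "acts \<zeta> \<alpha> (weyl_frac q \<iota> (\<zeta>, \<alpha>))"
proof -
  obtain H where H: "acts \<zeta> \<alpha> H" using acts_exists[OF \<zeta>] by blast
  have "weyl_frac q \<iota> (\<zeta>, \<alpha>) = H"
    unfolding weyl_frac_def
  proof (rule the_equality)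
    show "H \<in> ring_iso type_ring type_ring \<and> (\<forall>a\<in>carrier (qspace (\<lambda>_. q)). H (\<iota> a) = \<iota> (weyl_qspace q (\<zeta>, \<alpha>) a))"
      using acts_bij[OF \<zeta> H] actsD[OF H] weyl_qspace_eq[OF \<zeta> H]
      by (auto simp: ring_iso_def intro!: ring_hom_memI)
  next
    fix g assume g: "g \<in> ring_iso type_ring type_ring \<and> (\<forall>a\<in>carrier (qspace (\<lambda>_. q)). g (\<iota> a) = \<iota> (weyl_qspace q (\<zeta>, \<alpha>) a))"
    then have gh: "g \<in> ring_hom type_ring type_ring" by (simp add: ring_iso_def)
    have "H = g"
    proof (rule acts_unique[OF H])
      show "g (a * b) = g a * g b" for a b using ring_hom_mult[OF gh, of a b] by simp
      show "g (E a) = twist \<zeta> \<alpha> a" for a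
        using g weyl_qspace_eq[OF \<zeta> H in_carrier, of a] actsD(3)[OF H, of a] in_carrier[of a] by (simp add: E_def)
    qed
    then show "g = H" by simp
  qed
  then show ?thesis using H by simp
qed

end


section \<open>Invariants of the Weyl groups\<close>

lemma (in skew_kalgebra) separates_exists:
  assumes "exchange_pair q n P Q" "q \<noteq> 0"
  shows "\<exists>u v. separates q n P Q u v"
  using separates_exists_peel separates_exists_commutative assms by (cases "q = 1") auto

lemma qmono_single:
  assumes "distinct ls" "g \<in> set ls"
  shows "qmono z ls (\<lambda>j. if j = g then k else 0) = z g ^ k"
proof -
  have "qmono z ls (\<lambda>j. if j = g then k else 0) = (if g \<in> set ls then z g ^ k else 1)" if "distinct ls" for ls
    using that by (induction ls) (auto simp: qmono_def)
  then show ?thesis using assms by simp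
qed

lemma sum_bit_insert: "(a :: bit) + b = 0 \<longleftrightarrow> a = b"
  by (cases a; cases b) simp_all

locale weyl_points = weyl_setting q \<iota>
  for q :: "'k::field_char_0" and \<iota> :: "('n::finite, 'k) free_alg set \<Rightarrow> 'f::division_ring" +
  fixes d :: nat
  assumes d: "d = 1 \<or> d = 2"
begin

notation scale (infixr "\<odot>" 75)

definition xx :: "'n \<Rightarrow> 'f"
  where "xx i = gens (GenX i)"

definition yy :: "'n \<Rightarrow> 'f"
  where "yy i = gens (GenY i)"

definition Xd :: "'n \<Rightarrow> 'f"
  where "Xd i = xx i ^ d"

definition Yd :: "'n \<Rightarrow> 'f"
  where "Yd i = inverse (xx i) ^ (d - 1) * yy i"

definition enum :: "'n gen list"
  where "enum = (SOME l. distinct l \<and> set l = UNIV)"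

lemma enum: "distinct enum" "set enum = UNIV"
proof -
  have "\<exists>l. distinct l \<and> set l = (UNIV :: 'n gen set)" using finite_distinct_list[OF finite] by blast
  then have "distinct enum \<and> set enum = UNIV" unfolding enum_def by (rule someI_ex)
  then show "distinct enum" "set enum = UNIV" by simp_all
qed

lemma q0: "q \<noteq> 0"
  using qs_nonzero .

lemma xx_comm: "xx i * xx j = xx j * xx i"
  and yy_comm: "yy i * yy j = yy j * yy i"
  and yx: "yy i * xx j = (if i = j then q else 1) \<odot> (xx j * yy i)"
  unfolding xx_def yy_def by (rule gens_rel)+

lemma gens_power_independent:
  assumes "g \<noteq> h" "0 < k"
  shows "gens g ^ k \<noteq> c \<odot> gens h ^ k"
proof
  assume eq: "gens g ^ k = c \<odot> gens h ^ k"
  let ?e = "\<lambda>g j. if j = g then k else 0"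
  have ne: "?e g \<noteq> ?e h" using assms by (metis less_irrefl)
  have m: "qmono gens enum (?e g) = gens g ^ k" for g
    by (rule qmono_single) (simp_all add: enum)
  have "(\<Sum>e\<in>{?e g, ?e h}. (if e = ?e g then 1 else - c) \<odot> qmono gens enum e) = 0"
    using ne by (simp add: m eq)
  from free_familyD[OF free_gens[OF enum] _ this, of "?e g"] show False by simp
qed

lemma gens_nonzero: "gens g \<noteq> 0"
proof
  assume eq: "gens g = 0"
  let ?e = "\<lambda>j. if j = g then 1 else 0"
  have "qmono gens enum ?e = gens g ^ 1"
    by (rule qmono_single) (simp_all add: enum)
  then have "(\<Sum>e\<in>{?e}. 1 \<odot> qmono gens enum e) = 0" using eq by simp
  from free_familyD[OF free_gens[OF enum] _ this, of ?e] show False by simp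
qed

lemma yx_power: "yy i * xx j ^ k = ((if i = j then q else 1) ^ k) \<odot> (xx j ^ k * yy i)"
proof (induction k)
  case (Suc k)
  have "yy i * xx j ^ Suc k = (yy i * xx j) * xx j ^ k" by (simp add: mult.assoc)
  also have "\<dots> = (if i = j then q else 1) \<odot> (xx j * (yy i * xx j ^ k))"
    by (simp only: yx mult_scale_left mult.assoc)
  also have "\<dots> = ((if i = j then q else 1) ^ Suc k) \<odot> (xx j ^ Suc k * yy i)"
    by (simp only: Suc mult_scale_right scale_scale power_Suc mult.assoc)
  finally show ?case .
qed simp

lemma xx_inverse_comm: "inverse (xx i) ^ k * xx j = xx j * inverse (xx i) ^ k"
  using power_commuting_commutes[OF inverse_commutes[OF xx_comm[of i j]], of k] .

lemma yy_inverse_comm: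
  assumes "i \<noteq> j"
  shows "inverse (xx j) ^ k * yy i = yy i * inverse (xx j) ^ k"
  using power_commuting_commutes[OF inverse_commutes[of "xx j" "yy i"], of k] yx[of i j] assms by simp

sublocale pts: quantum_points emb "q ^ d" Xd Yd
proof
  show "q ^ d \<noteq> 0" using q0 by simp
  show "Xd i * Xd j = Xd j * Xd i" for i j
    unfolding Xd_def by (rule powers_commute[OF xx_comm])
  show "Yd i * Yd j = Yd j * Yd i" for i j
  proof (cases "i = j")
    case False
    let ?a = "\<lambda>i. inverse (xx i) ^ (d - 1)"
    have a: "?a i * ?a j = ?a j * ?a i"
    proof (rule powers_commute)
      have "inverse (xx j) * xx i = xx i * inverse (xx j)" by (rule inverse_commutes[OF xx_comm])
      from inverse_commutes[OF this[symmetric]] show "inverse (xx i) * inverse (xx j) = inverse (xx j) * inverse (xx i)" .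
    qed
    have "Yd i * Yd j = ?a i * (yy i * ?a j) * yy j" by (simp add: Yd_def mult.assoc)
    also have "\<dots> = (?a i * ?a j) * (yy i * yy j)"
      by (simp only: yy_inverse_comm[OF False, symmetric] mult.assoc)
    also have "\<dots> = ?a j * (?a i * yy j) * yy i" by (simp only: a yy_comm[of i j] mult.assoc)
    also have "\<dots> = Yd j * Yd i"
    proof -
      have "?a i * yy j = yy j * ?a i" using yy_inverse_comm[of j i] False by simp
      then have "?a i * (yy j * w) = yy j * (?a i * w)" for w by (simp only: mult.assoc[symmetric])
      then show ?thesis by (simp only: Yd_def mult.assoc)
    qed
    finally show ?thesis .
  qed simp
  show "Yd i * Xd j = (if i = j then q ^ d else 1) \<odot> (Xd j * Yd i)" for i j
  proof -
    have a: "inverse (xx i) ^ (d - 1) * xx j ^ d = xx j ^ d * inverse (xx i) ^ (d - 1)"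
      using power_commuting_commutes[OF xx_inverse_comm[of i "d - 1" j, symmetric], of d] by simp
    have "Yd i * Xd j = inverse (xx i) ^ (d - 1) * (yy i * xx j ^ d)"
      by (simp only: Yd_def Xd_def mult.assoc)
    also have "\<dots> = ((if i = j then q else 1) ^ d) \<odot> ((inverse (xx i) ^ (d - 1) * xx j ^ d) * yy i)"
      by (simp only: yx_power mult_scale_right mult.assoc)
    also have "\<dots> = (if i = j then q ^ d else 1) \<odot> (Xd j * Yd i)"
      unfolding a by (simp add: Xd_def Yd_def mult.assoc)
    finally show ?thesis .
  qed
  show "Xd i \<noteq> 0" for i unfolding Xd_def xx_def using gens_nonzero by simp
  show "Yd i \<noteq> 0" for i unfolding Yd_def xx_def yy_def using gens_nonzero by simp
  show "Xd i \<noteq> c \<odot> Xd j" if "i \<noteq> j" for i j c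
    unfolding Xd_def xx_def using d that by (intro gens_power_independent) auto
qed

lemma acts_gens:
  assumes "acts \<zeta> \<alpha> H"
  shows "H (xx i) = weyl_sign \<alpha> i \<odot> xx (\<zeta> i)" "H (yy i) = weyl_sign \<alpha> i \<odot> yy (\<zeta> i)"
  using actsD(3)[OF assms, of "X i"] actsD(3)[OF assms, of "Y i"]
  by (simp_all add: xx_def yy_def twisted_def) (simp_all add: gens_def)

lemma acts_power:
  assumes "acts \<zeta> \<alpha> H"
  shows "H (a ^ n) = H a ^ n"
  by (induction n) (simp_all add: actsD[OF assms])

lemma acts_inverse:
  assumes "acts \<zeta> \<alpha> H"
  shows "H (inverse a) = inverse (H a)"
proof (cases "a = 0")
  case False
  then have "H a * H (inverse a) = 1" by (simp add: actsD(5)[OF assms] flip: actsD(2)[OF assms])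
  then show ?thesis by (metis inverse_unique)
qed (simp add: actsD(6)[OF assms])

lemma acts_minus:
  assumes "acts \<zeta> \<alpha> H"
  shows "H (a - b) = H a - H b"
  using actsD(1)[OF assms, of "a - b" b] by (simp add: algebra_simps)

lemma acts_scale:
  assumes "acts \<zeta> \<alpha> H"
  shows "H (c \<odot> a) = c \<odot> H a"
  by (simp add: scale_def actsD[OF assms])

definition inv_set :: "('n \<Rightarrow> bit) set \<Rightarrow> 'f set"
  where "inv_set S = {f. \<forall>\<zeta> \<alpha> H. \<zeta> permutes UNIV \<longrightarrow> \<alpha> \<in> S \<longrightarrow> acts \<zeta> \<alpha> H \<longrightarrow> H f = f}"

lemma inv_setI: "(\<And>\<zeta> \<alpha> H. \<zeta> permutes UNIV \<Longrightarrow> \<alpha> \<in> S \<Longrightarrow> acts \<zeta> \<alpha> H \<Longrightarrow> H f = f) \<Longrightarrow> f \<in> inv_set S"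
  unfolding inv_set_def by blast

lemma inv_setD: "f \<in> inv_set S \<Longrightarrow> \<zeta> permutes UNIV \<Longrightarrow> \<alpha> \<in> S \<Longrightarrow> acts \<zeta> \<alpha> H \<Longrightarrow> H f = f"
  unfolding inv_set_def by blast

lemma divsub_inv_set: "divsub (inv_set S)"
  unfolding divsub_def subalg_def
proof (intro conjI ballI subsetI)
  fix a assume "a \<in> range emb"
  then show "a \<in> inv_set S" using actsD(4) by (auto intro!: inv_setI)
next
  fix a b assume "a \<in> inv_set S" "b \<in> inv_set S"
  then have fixed: "H a = a" "H b = b" if "\<zeta> permutes UNIV" "\<alpha> \<in> S" "acts \<zeta> \<alpha> H" for \<zeta> \<alpha> H
    using inv_setD that by blast+
  show "a + b \<in> inv_set S" "a - b \<in> inv_set S" "a * b \<in> inv_set S"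
    by (rule inv_setI, simp add: actsD acts_minus fixed)+
next
  fix a assume "a \<in> inv_set S"
  then have fixed: "H a = a" if "\<zeta> permutes UNIV" "\<alpha> \<in> S" "acts \<zeta> \<alpha> H" for \<zeta> \<alpha> H
    using inv_setD that by blast
  show "inverse a \<in> inv_set S"
    by (rule inv_setI, simp add: acts_inverse fixed)
qed

lemma weyl_invariants_eq:
  "carrier (weyl_invariants T q \<iota>) = inv_set (case T of Type_A \<Rightarrow> {\<lambda>_. 0} | Type_B \<Rightarrow> UNIV | Type_C \<Rightarrow> UNIV
     | Type_D \<Rightarrow> {\<alpha>. (\<Sum>i\<in>UNIV. \<alpha> i) = 0})" (is "_ = inv_set ?S")
proof -
  have "(\<forall>w\<in>carrier (weyl_group T). weyl_frac q \<iota> w f = f) \<longleftrightarrow> f \<in> inv_set ?S" for f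
  proof
    assume f: "\<forall>w\<in>carrier (weyl_group T). weyl_frac q \<iota> w f = f"
    show "f \<in> inv_set ?S"
    proof (rule inv_setI)
      fix \<zeta> \<alpha> H assume H: "\<zeta> permutes UNIV" "\<alpha> \<in> ?S" "acts \<zeta> \<alpha> H"
      have "H = weyl_frac q \<iota> (\<zeta>, \<alpha>)"
        using acts_unique[OF H(3)] actsD[OF weyl_frac_acts[OF H(1)]] by blast
      then show "H f = f" using f H by (simp add: weyl_group_def)
    qed
  next
    assume f: "f \<in> inv_set ?S"
    show "\<forall>w\<in>carrier (weyl_group T). weyl_frac q \<iota> w f = f"
    proof
      fix w :: "('n \<Rightarrow> 'n) \<times> ('n \<Rightarrow> bit)" assume w: "w \<in> carrier (weyl_group T)"
      obtain \<zeta> \<alpha> where wz: "w = (\<zeta>, \<alpha>)" by (cases w)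
      then have "\<zeta> permutes UNIV" "\<alpha> \<in> ?S" using w by (simp_all add: weyl_group_def)
      then show "weyl_frac q \<iota> w f = f" unfolding wz using inv_setD[OF f] weyl_frac_acts by blast
    qed
  qed
  then show ?thesis by (auto simp: weyl_invariants_def)
qed

definition signs :: "('n \<Rightarrow> bit) set"
  where "signs = (if d = 1 then {\<lambda>_. 0} else UNIV)"

lemma acts_points:
  assumes "\<zeta> permutes UNIV" "\<alpha> \<in> signs" "acts \<zeta> \<alpha> H"
  shows "H (Xd i) = Xd (\<zeta> i)" "H (Yd i) = Yd (\<zeta> i)"
proof -
  have s: "weyl_sign \<alpha> i = (1 :: 'k)" if "d = 1" using that assms(2) unfolding signs_def by (simp add: weyl_sign_def)
  have s2: "weyl_sign \<alpha> i * weyl_sign \<alpha> i = (1 :: 'k)" by (rule weyl_sign_square)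
  have si: "inverse (weyl_sign \<alpha> i) = (weyl_sign \<alpha> i :: 'k)" by (simp add: weyl_sign_def)
  show "H (Xd i) = Xd (\<zeta> i)"
    using d s s2 by (auto simp: Xd_def acts_power[OF assms(3)] acts_gens[OF assms(3)] power2_eq_square scale_algebra)
  have inv_scale: "inverse (c \<odot> a) = inverse c \<odot> inverse a" if "c \<noteq> 0" for c a
  proof (cases "a = 0")
    case False
    have "(c \<odot> a) * (inverse c \<odot> inverse a) = 1" using that False by (simp add: scale_algebra)
    then show ?thesis by (rule inverse_unique)
  qed simp
  show "H (Yd i) = Yd (\<zeta> i)"
    using d s s2 si
    by (auto simp: inv_scale[OF weyl_sign_nonzero] Yd_def acts_inverse[OF assms(3)] actsD(2)[OF assms(3)] acts_gens[OF assms(3)] scale_algebra actsD(5)[OF assms(3)])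
qed

lemma PQ_invariant: "pts.P z \<in> inv_set signs" "pts.Q z \<in> inv_set signs"
proof -
  have "H (pts.P z) = pts.P z \<and> H (pts.Q z) = pts.Q z" if "\<zeta> permutes UNIV" "\<alpha> \<in> signs" "acts \<zeta> \<alpha> H" for \<zeta> \<alpha> H
    using pts.equivariant[of H \<zeta> z] actsD[OF that(3)] permutes_bij[OF that(1)] acts_points[OF that] by blast
  then show "pts.P z \<in> inv_set signs" "pts.Q z \<in> inv_set signs" by (auto intro!: inv_setI)
qed

definition box_monomials :: "'f set"
  where "box_monomials = xpow xx ` box (d * card (UNIV :: 'n set) - 1)"

lemma box_monomials: "finite box_monomials" "1 \<in> box_monomials"
proof -
  show "finite box_monomials" by (simp add: box_monomials_def card_box)
  have "cprod (\<lambda>i. xx i ^ 0) A = 1" for A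
  proof -
    have "cprod (\<lambda>i. 1 :: 'f) A = 1" by (induction A rule: infinite_finite_induct) (simp_all add: cprod_insert commuting_def)
    then show ?thesis by simp
  qed
  then have "xpow xx (\<lambda>_. 0) = 1" by (simp add: xpow_def)
  then show "1 \<in> box_monomials" unfolding box_monomials_def by (force simp: box_def)
qed

text \<open>The generators act on the span of the box monomials: \<open>x\<close> by \<open>P(x\<^sup>d) = 0\<close>, \<open>y\<close> by \<open>Y = Q(X)\<close>.\<close>

lemma box_monomials_stable:
  assumes B: "subalg B" "\<And>z. pts.P z \<in> B" "\<And>z. pts.Q z \<in> B" and m: "m \<in> box_monomials"
  shows "m * gens g \<in> lspan B box_monomials"
proof -
  define n where "n = card (UNIV :: 'n set)"
  have n0: "0 < n" by (simp add: n_def)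
  have d0: "0 < d" using d by auto
  obtain p c where pc: "\<And>k. Xd k ^ n + reval n p (Xd k) = 0" "\<And>k. Yd k = reval n c (Xd k)"
    "\<And>B i. subalg B \<Longrightarrow> (\<And>z. pts.P z \<in> B) \<Longrightarrow> i < n \<Longrightarrow> p i \<in> B"
    "\<And>B i. subalg B \<Longrightarrow> (\<And>z. pts.Q z \<in> B) \<Longrightarrow> i < n \<Longrightarrow> c i \<in> B"
    unfolding n_def by (rule pts.roots_and_values) blast
  have p_comm: "p j * xx k = xx k * p j" if "j < n" for j k
  proof -
    have "pts.P z * xx k = xx k * pts.P z" for z
      unfolding pts.P_def
    proof (rule pts.lin_commute[OF pts.\<kappa>X])
      show "xx k * Xd j = Xd j * xx k" for j
        unfolding Xd_def using powers_commute[OF xx_comm, of k 1 j d] by simp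
    qed (rule \<kappa>_central)
    then have "p j \<in> {a. \<forall>g\<in>{xx k}. g * a = a * g}"
      by (intro pc(3)[OF divsubD(1)[OF divsub_centralizer] _ that]) simp
    then show ?thesis by simp
  qed
  have stable_x: "m * xx i \<in> lspan B box_monomials" if m: "m \<in> box_monomials" for m i
  proof -
    let ?b = "\<lambda>j. if d dvd j then - p (j div d) else 0"
    have "xx i ^ (d * n) = Xd i ^ n" by (simp add: Xd_def power_mult)
    also have "\<dots> = - reval n p (Xd i)" using pc(1)[of i] by (simp add: eq_neg_iff_add_eq_0)
    also have "\<dots> = (\<Sum>j<n. - p j * xx i ^ (d * j))"
      by (simp add: reval_def Xd_def power_mult sum_negf)
    also have "\<dots> = (\<Sum>j\<in>(\<lambda>j. d * j) ` {..<n}. ?b j * xx i ^ j)"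
      using d0 by (subst sum.reindex) (auto simp: inj_on_def)
    also have "\<dots> = (\<Sum>j<d * n. ?b j * xx i ^ j)"
      using d0 by (intro sum.mono_neutral_left) (auto elim!: dvdE)
    finally have root: "xx i ^ (d * n) = (\<Sum>j<d * n. ?b j * xx i ^ j)" .
    show ?thesis
      unfolding box_monomials_def n_def[symmetric]
    proof (rule xpow_stable[where x = xx and i = i and b = ?b, OF B(1) xx_comm _ root])
      show "0 < d * n" using d0 n0 by simp
      fix j assume j: "j < d * n"
      then have jd: "j div d < n" using d0 by (simp add: less_mult_imp_div_less mult.commute)
      show "?b j \<in> B" using pc(3)[OF B(1,2) jd] subalgD(7,8)[OF B(1)] by simp
      show "?b j * xx k = xx k * ?b j" for k using p_comm[OF jd] by simp
    qed (use m in \<open>simp add: box_monomials_def n_def\<close>)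
  qed
  have stable_xk: "a * xx i ^ k \<in> lspan B box_monomials" if "a \<in> lspan B box_monomials" for a i k
    using that
  proof (induction k)
    case (Suc k)
    then have "(a * xx i ^ k) * xx i \<in> lspan B box_monomials"
      by (intro lspan_mult_right[OF B(1) stable_x]) simp_all
    then show ?case by (simp add: power_Suc2 mult.assoc del: power_Suc)
  qed simp
  show ?thesis
  proof (cases g)
    case (GenX i)
    then show ?thesis using stable_x[OF m] by (simp add: xx_def)
  next
    case (GenY i)
    obtain a where a: "m = xpow xx a" using m unfolding box_monomials_def by blast
    have "\<exists>c. c \<noteq> 0 \<and> yy i * cprod (\<lambda>j. xx j ^ a j) A = c \<odot> (cprod (\<lambda>j. xx j ^ a j) A * yy i)" for A
    proof (induction A rule: infinite_finite_induct)
      case (insert j A)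
      then obtain c where c: "c \<noteq> 0" "yy i * cprod (\<lambda>j. xx j ^ a j) A = c \<odot> (cprod (\<lambda>j. xx j ^ a j) A * yy i)" by blast
      let ?e = "(if i = j then q else 1) ^ a j"
      have "yy i * (xx j ^ a j * cprod (\<lambda>j. xx j ^ a j) A) = (yy i * xx j ^ a j) * cprod (\<lambda>j. xx j ^ a j) A"
        by (simp only: mult.assoc)
      also have "\<dots> = ?e \<odot> (xx j ^ a j * (yy i * cprod (\<lambda>j. xx j ^ a j) A))"
        by (simp only: yx_power mult_scale_left mult.assoc)
      also have "\<dots> = (?e * c) \<odot> (xx j ^ a j * cprod (\<lambda>j. xx j ^ a j) A * yy i)"
        by (simp only: c(2) mult_scale_right scale_scale mult.assoc)
      finally show ?case
        using c(1) q0 by (intro exI[of _ "?e * c"]) (simp add: cprod_insert[OF commuting_xpow[OF xx_comm] insert.hyps])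
    qed (auto intro!: exI[of _ 1] simp: cprod_def)
    then obtain e where e: "e \<noteq> 0" "yy i * m = e \<odot> (m * yy i)" unfolding a xpow_def by blast
    have y: "yy i = xx i ^ (d - 1) * Yd i"
      using gens_nonzero[of "GenX i"] by (simp add: Yd_def xx_def power_inverse flip: mult.assoc)
    have xY: "xx i ^ k * Yd i = (inverse q ^ k) \<odot> (Yd i * xx i ^ k)" for k
    proof -
      have "Yd i * xx i ^ k = q ^ k \<odot> (xx i ^ k * Yd i)"
      proof -
        have "Yd i * xx i ^ k = inverse (xx i) ^ (d - 1) * (yy i * xx i ^ k)" by (simp only: Yd_def mult.assoc)
        also have "\<dots> = q ^ k \<odot> ((inverse (xx i) ^ (d - 1) * xx i ^ k) * yy i)"
          by (simp add: yx_power mult_scale_right mult.assoc)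
        also have "inverse (xx i) ^ (d - 1) * xx i ^ k = xx i ^ k * inverse (xx i) ^ (d - 1)"
          using power_commuting_commutes[OF xx_inverse_comm[of i "d - 1" i, symmetric], of k] by simp
        finally show ?thesis by (simp only: Yd_def mult.assoc)
      qed
      then show ?thesis using q0 by (simp add: power_inverse)
    qed
    have xm: "xx i ^ k * m = m * xx i ^ k" for k
    proof -
      have "m * xx i = xx i * m" unfolding a by (rule xpow_commute[OF xx_comm xx_comm])
      from power_commuting_commutes[OF this[symmetric], of k] show ?thesis by simp
    qed
    have "m * yy i = inverse e \<odot> (yy i * m)" using e by simp
    also have "yy i * m = (inverse q ^ (d - 1)) \<odot> (Yd i * (xx i ^ (d - 1) * m))"
      unfolding y by (simp only: xY mult_scale_left mult.assoc)
    also have "Yd i * (xx i ^ (d - 1) * m) = (\<Sum>j<n. c j * (m * xx i ^ (d * j + (d - 1))))"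
      unfolding pc(2) reval_def sum_distrib_right Xd_def
      by (intro sum.cong refl) (simp only: mult.assoc power_mult[symmetric] xm[symmetric], simp only: power_add mult.assoc)
    finally have "m * yy i = inverse e \<odot> ((inverse q ^ (d - 1)) \<odot> (\<Sum>j<n. c j * (m * xx i ^ (d * j + (d - 1)))))" .
    also have "\<dots> \<in> lspan B box_monomials"
      unfolding scale_def
      by (intro lspan_mult_left[OF B(1) subalgD(1)[OF B(1)]] lspan_sum[OF B(1)])
         (auto intro!: lspan_mult_left[OF B(1)] pc(4)[OF B(1,3)] stable_xk lspan_base[OF B(1) box_monomials(1) m])
    finally show ?thesis by (simp add: GenY yy_def)
  qed
qed

lemma everything_in_span:
  assumes D: "divsub D" "\<And>z. pts.P z \<in> D" "\<And>z. pts.Q z \<in> D"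
  shows "f \<in> lspan D box_monomials"
proof (rule lspan_everything[OF D(1) box_monomials, of "range gens"])
  show "m * g \<in> lspan D box_monomials" if "m \<in> box_monomials" "g \<in> range gens" for m g
    using box_monomials_stable[OF divsubD(1)[OF D(1)] D(2,3) that(1)] that(2) by blast
  show "\<exists>a s. f = a * inverse s \<and> s \<noteq> 0 \<and> (\<forall>B. subalg B \<longrightarrow> range gens \<subseteq> B \<longrightarrow> a \<in> B \<and> s \<in> B)" for f
    using fraction[of f] ev_in[of _ gens] unfolding E_ev by blast
qed

lemma invariants_in:
  assumes D: "divsub D" "\<And>z. pts.P z \<in> D" "\<And>z. pts.Q z \<in> D" and fixed: "D \<subseteq> inv_set signs"
    and f: "f \<in> inv_set signs"
  shows "f \<in> D"
proof -
  note sub = divsubD(1)[OF D(1)]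
  let ?A = "\<lambda>K. {xpow xx a | a. d = 2 \<longrightarrow> (\<forall>k\<in>K. even (a k))}"
  have A0: "?A K \<noteq> {}" for K by (rule ex_in_conv[THEN iffD1]) (auto intro!: exI[of _ "xpow xx (\<lambda>_. 0)"] exI[of _ "\<lambda>_. 0"])
  have fK: "f \<in> dspan D (?A K)" for K
    using finite[of K]
  proof (induction K rule: finite_induct)
    case empty
    obtain b where b: "\<forall>m\<in>box_monomials. b m \<in> D" "f = (\<Sum>m\<in>box_monomials. b m * m)"
      using everything_in_span[OF D, of f] unfolding lspan_def by blast
    have "b m * m \<in> dspan D (?A {})" if "m \<in> box_monomials" for m
      using b(1) that by (intro dspan.base) (auto simp: box_monomials_def)
    then show ?case unfolding b(2) by (intro dspan_sum[OF sub A0])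
  next
    case (insert k K)
    show ?case
    proof (cases "d = 2")
      case False
      then show ?thesis using insert.IH by simp
    next
      case True
      define \<delta> where "\<delta> i = (if i = k then 1 else 0 :: bit)" for i
      have \<delta>: "\<delta> \<in> signs" using True unfolding signs_def by simp
      obtain H where H: "acts id \<delta> H" using acts_exists[OF permutes_id] by blast
      have Hx: "H (xpow xx a) = (if even (a k) then xpow xx a else - xpow xx a)" for a
      proof -
        let ?r = "cprod (\<lambda>i. xx i ^ a i) (UNIV - {k})"
        have xr: "xpow xx a = xx k ^ a k * ?r"
          unfolding xpow_def by (rule cprod_remove[OF commuting_xpow[OF xx_comm]]) simp_all
        have "H ?r = cprod (\<lambda>i. H (xx i ^ a i)) (UNIV - {k})"
          by (rule cprod_hom[OF commuting_xpow[OF xx_comm]]) (simp_all add: actsD[OF H])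
        also have "\<dots> = ?r"
        proof (rule cprod_cong[symmetric, OF commuting_xpow[OF xx_comm]])
          show "xx i ^ a i = H (xx i ^ a i)" if "i \<in> UNIV - {k}" for i
            using that by (simp add: acts_power[OF H] acts_gens[OF H] \<delta>_def weyl_sign_def)
        qed simp
        finally have "H ?r = ?r" .
        moreover have "H (xx k) = - xx k"
          by (simp add: acts_gens[OF H] \<delta>_def weyl_sign_def)
        then have "H (xx k ^ a k) = (if even (a k) then xx k ^ a k else - (xx k ^ a k))"
          by (simp add: acts_power[OF H])
        ultimately show ?thesis unfolding xr by (simp add: actsD(2)[OF H])
      qed
      have "inverse 2 \<odot> (h + H h) \<in> dspan D (?A (insert k K))" if "h \<in> dspan D (?A K)" for h
        using that
      proof induction
        case (base b m)
        then obtain a where a: "m = xpow xx a" "\<forall>k\<in>K. even (a k)" using True by blast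
        have Hb: "H b = b" using fixed base(1) inv_setD[OF _ permutes_id \<delta> H] by blast
        show ?case
        proof (cases "even (a k)")
          case True
          then have "inverse 2 \<odot> (b * m + H (b * m)) = (inverse 2 * (1 + 1)) \<odot> (b * m)"
            by (simp only: actsD(2)[OF H] Hb a(1) Hx if_True scale_scale[symmetric] scale_left_distrib scale_one)
          also have "inverse 2 * (1 + 1) = (1 :: 'k)" by simp
          finally have "inverse 2 \<odot> (b * m + H (b * m)) = b * m" by simp
          then show ?thesis using base(1) a True by (auto intro!: dspan.base)
        next
          case False
          then have "inverse 2 \<odot> (b * m + H (b * m)) = 0"
            by (simp add: actsD(2)[OF H] Hb a(1) Hx)
          then show ?thesis using dspan_0[OF sub A0[of "insert k K"]] by (simp only:)
        qed
      next
        case (add a b)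
        have "inverse 2 \<odot> (a + b + H (a + b)) = inverse 2 \<odot> (a + H a) + inverse 2 \<odot> (b + H b)"
          by (simp add: actsD(1)[OF H] scale_right_distrib add_ac)
        then show ?case using add.IH by (simp add: dspan.add)
      qed
      from this[OF insert.IH] have "inverse 2 \<odot> (f + f) \<in> dspan D (?A (insert k K))"
        using inv_setD[OF f permutes_id \<delta> H] by simp
      moreover have "inverse 2 \<odot> (f + f) = f"
      proof -
        have "inverse 2 \<odot> (f + f) = (inverse 2 * (1 + 1)) \<odot> f"
          by (simp only: scale_scale[symmetric] scale_left_distrib scale_one)
        then show ?thesis by simp
      qed
      ultimately show ?thesis by simp
    qed
  qed
  have "xpow xx a \<in> pts.gen_by UNIV" if "d = 2 \<longrightarrow> (\<forall>k. even (a k))" for a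
    unfolding xpow_def
  proof (rule cprod_closed[OF commuting_xpow[OF xx_comm]])
    fix i
    have "xx i ^ a i = Xd i ^ (a i div d)"
      using d that by (auto simp: Xd_def simp flip: power_mult)
    then show "xx i ^ a i \<in> pts.gen_by UNIV"
      using subalgD(9)[OF pts.subalg_gen_by pts.gen_by_X[of i UNIV]] by simp
  qed (use subalgD(4,6)[OF pts.subalg_gen_by] in auto)
  then have "?A UNIV \<subseteq> pts.gen_by UNIV" by auto
  moreover have "dspan D A \<subseteq> dspan D A'" if "A \<subseteq> A'" for A A'
  proof
    fix a assume "a \<in> dspan D A"
    then show "a \<in> dspan D A'" by induction (use that in \<open>auto intro: dspan.intros\<close>)
  qed
  ultimately have fg: "f \<in> dspan D (pts.gen_by UNIV)" using fK[of UNIV] by blast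
  have zero: "(\<lambda>_. 0) \<in> signs" by (simp add: signs_def)
  let ?g = "\<lambda>k l. weyl_frac q \<iota> (Transposition.transpose k l, \<lambda>_. 0)"
  have perm: "Transposition.transpose k l permutes (UNIV :: 'n set)" for k l by (rule permutes_swap_id) simp_all
  have g: "acts (Transposition.transpose k l) (\<lambda>_. 0) (?g k l)" for k l
    by (rule weyl_frac_acts[OF perm])
  show ?thesis
  proof (rule pts.descent[OF sub _ fg, of ?g])
    show "range pts.P \<subseteq> D" using D(2) by blast
    show "?g k l (a + b) = ?g k l a + ?g k l b" "?g k l (a * b) = ?g k l a * ?g k l b" for k l a b
      by (rule actsD[OF g])+
    show "?g k l a = a" if "a \<in> D" for k l a
      using fixed that inv_setD[OF _ perm zero g] by blast
    show "?g k l (Xd i) = Xd (if i = k then l else if i = l then k else i)" for k l i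
      using acts_points(1)[OF perm zero g] by (simp add: Transposition.transpose_def)
    show "?g k l f = f" for k l by (rule inv_setD[OF f perm zero g])
  qed
qed

end


lemma (in skew_kalgebra) separatesD:
  assumes "separates q n P Q u v"
  shows "i < n \<Longrightarrow> u i \<noteq> 0 \<and> v i \<noteq> 0"
    "i < n \<Longrightarrow> j < n \<Longrightarrow> u i * u j = u j * u i \<and> v i * v j = v j * v i \<and>
       v i * u j = (if i = j then q else 1) \<odot> (u j * v i)"
    "divsub D \<Longrightarrow> (\<And>z. P z \<in> D \<and> Q z \<in> D) \<Longrightarrow> i < n \<Longrightarrow> u i \<in> D \<and> v i \<in> D"
    "subalg B \<Longrightarrow> (\<And>i. i < n \<Longrightarrow> u i \<in> B \<and> inverse (u i) \<in> B \<and> v i \<in> B \<and> inverse (v i) \<in> B) \<Longrightarrow>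
       P z \<in> B \<and> Q z \<in> B"
    "0 < n \<Longrightarrow> u 0 = P 0"
    "c \<noteq> 0 \<Longrightarrow> (\<And>z. e * P z = P z * e) \<Longrightarrow> (\<And>z. Q z * e = c \<odot> (e * Q z)) \<Longrightarrow> i < n \<Longrightarrow>
       u i * e = e * u i \<and> v i * e = (if i = 0 then c else 1) \<odot> (e * v i)"
proof -
  note S = assms[unfolded separates_def]
  note planes = S[THEN conjunct1, unfolded qplanes_def]
  show "i < n \<Longrightarrow> u i \<noteq> 0 \<and> v i \<noteq> 0"
    by (rule planes[THEN conjunct1, rule_format])
  show "i < n \<Longrightarrow> j < n \<Longrightarrow> u i * u j = u j * u i \<and> v i * v j = v j * v i \<and>
       v i * u j = (if i = j then q else 1) \<odot> (u j * v i)"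
    by (rule planes[THEN conjunct2, rule_format])
  note S = S[THEN conjunct2]
  show "divsub D \<Longrightarrow> (\<And>z. P z \<in> D \<and> Q z \<in> D) \<Longrightarrow> i < n \<Longrightarrow> u i \<in> D \<and> v i \<in> D"
    by (rule S[THEN conjunct1, rule_format])
  note S = S[THEN conjunct2]
  show "subalg B \<Longrightarrow> (\<And>i. i < n \<Longrightarrow> u i \<in> B \<and> inverse (u i) \<in> B \<and> v i \<in> B \<and> inverse (v i) \<in> B) \<Longrightarrow>
       P z \<in> B \<and> Q z \<in> B"
    by (rule S[THEN conjunct1, rule_format])
  note S = S[THEN conjunct2]
  show "0 < n \<Longrightarrow> u 0 = P 0" by (rule S[THEN conjunct1, rule_format])
  show "c \<noteq> 0 \<Longrightarrow> (\<And>z. e * P z = P z * e) \<Longrightarrow> (\<And>z. Q z * e = c \<odot> (e * Q z)) \<Longrightarrow> i < n \<Longrightarrow>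
       u i * e = e * u i \<and> v i * e = (if i = 0 then c else 1) \<odot> (e * v i)"
    by (rule S[THEN conjunct2, rule_format])
qed

context weyl_points
begin

notation scale (infixr "\<odot>" 75)

definition \<Omega> :: 'f
  where "\<Omega> = cprod xx UNIV"

lemma commuting_xx: "commuting xx A"
  unfolding commuting_def using xx_comm by blast

lemma \<Omega>_nonzero: "\<Omega> \<noteq> 0"
  unfolding \<Omega>_def by (rule cprod_nonzero[OF commuting_xx]) (simp_all add: xx_def gens_nonzero)

lemma \<Omega>_xx: "\<Omega> * xx i = xx i * \<Omega>"
  unfolding \<Omega>_def by (rule cprod_commute[OF commuting_xx finite]) (rule xx_comm)

lemma Yd_xx: "Yd i * xx j = (if i = j then q else 1) \<odot> (xx j * Yd i)"
proof -
  have "Yd i * xx j = inverse (xx i) ^ (d - 1) * (yy i * xx j)" by (simp only: Yd_def mult.assoc)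
  also have "\<dots> = (if i = j then q else 1) \<odot> ((inverse (xx i) ^ (d - 1) * xx j) * yy i)"
    by (simp only: yx mult_scale_right mult.assoc)
  finally show ?thesis by (simp only: xx_inverse_comm Yd_def mult.assoc)
qed

lemma Yd_\<Omega>: "Yd i * \<Omega> = q \<odot> (\<Omega> * Yd i)"
proof -
  let ?R = "cprod xx (UNIV - {i})"
  have R: "?R * Yd i = Yd i * ?R"
  proof (rule cprod_commute[OF commuting_xx finite])
    show "xx j * Yd i = Yd i * xx j" if "j \<in> UNIV - {i}" for j
      using Yd_xx[of i j] that by auto
  qed
  have \<Omega>: "\<Omega> = xx i * ?R" unfolding \<Omega>_def by (rule cprod_remove[OF commuting_xx]) simp_all
  have "Yd i * \<Omega> = (Yd i * xx i) * ?R" by (simp only: \<Omega> mult.assoc)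
  also have "\<dots> = q \<odot> (xx i * (Yd i * ?R))" by (simp add: Yd_xx mult_scale_left mult.assoc)
  finally show ?thesis by (simp only: R[symmetric] \<Omega> mult.assoc)
qed

lemma acts_\<Omega>:
  assumes \<zeta>: "\<zeta> permutes UNIV" and H: "acts \<zeta> \<alpha> H"
  shows "H \<Omega> = (if (\<Sum>i\<in>UNIV. \<alpha> i) = 0 then \<Omega> else - \<Omega>)"
proof -
  have c: "commuting (\<lambda>i. xx (\<zeta> i)) A" for A unfolding commuting_def using xx_comm by blast
  have c': "commuting (\<lambda>i. weyl_sign \<alpha> i \<odot> xx (\<zeta> i)) A" for A
    unfolding commuting_def using xx_comm
    by (auto simp: mult_scale_left mult_scale_right scale_scale mult.commute)
  have "H \<Omega> = cprod (\<lambda>i. H (xx i)) UNIV"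
    unfolding \<Omega>_def by (rule cprod_hom[OF commuting_xx]) (simp_all add: actsD[OF H])
  also have "\<dots> = cprod (\<lambda>i. weyl_sign \<alpha> i \<odot> xx (\<zeta> i)) UNIV"
    by (simp only: acts_gens[OF H])
  also have "\<dots> = (if (\<Sum>i\<in>UNIV. \<alpha> i) = 0 then cprod (\<lambda>i. xx (\<zeta> i)) UNIV else - cprod (\<lambda>i. xx (\<zeta> i)) UNIV)"
    using finite[of "UNIV :: 'n set"]
  proof (induction rule: finite_induct)
    case (insert i A)
    show ?case
      unfolding cprod_insert[OF c insert.hyps] cprod_insert[OF c' insert.hyps] insert.IH
      using insert.hyps by (cases "\<alpha> i"; cases "sum \<alpha> A") (simp_all add: weyl_sign_def)
  qed simp
  also have "cprod (\<lambda>i. xx (\<zeta> i)) UNIV = cprod xx (\<zeta> ` UNIV)"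
    by (rule cprod_reindex[symmetric, OF commuting_xx finite]) (rule permutes_inj[OF \<zeta>])
  also have "\<zeta> ` UNIV = UNIV" by (rule permutes_image[OF \<zeta>])
  finally show ?thesis by (simp only: \<Omega>_def)
qed

lemma P0_\<Omega>:
  assumes "d = 2"
  shows "\<exists>c. c \<noteq> 0 \<and> pts.P 0 = c \<odot> (\<Omega> * \<Omega>)"
proof -
  have X: "Xd i = xx i * xx i" for i
    unfolding Xd_def using assms by (simp add: power2_eq_square)
  have c: "commuting (\<lambda>i. emb 0 - Xd i) A" for A
    by (rule pts.commuting_lin) simp
  have "\<exists>c. c \<noteq> 0 \<and> cprod (\<lambda>i. emb 0 - Xd i) A = c \<odot> (cprod xx A * cprod xx A)" for A
    using finite[of A]
  proof (induction A rule: finite_induct)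
    case empty
    then show ?case by (auto intro!: exI[of _ 1])
  next
    case (insert i A)
    let ?R = "cprod xx A"
    obtain c where cc: "c \<noteq> 0" "cprod (\<lambda>i. emb 0 - Xd i) A = c \<odot> (?R * ?R)" using insert.IH by blast
    have R: "?R * xx i = xx i * ?R" by (rule cprod_commute[OF commuting_xx insert.hyps(1)]) (rule xx_comm)
    have "xx i * (xx i * ?R) * ?R = xx i * (?R * xx i) * ?R" by (simp only: R)
    then have RR: "xx i * (xx i * ?R) * ?R = (xx i * ?R) * (xx i * ?R)" by (simp only: mult.assoc)
    have "(emb 0 - Xd i) * (c \<odot> (?R * ?R)) = (- c) \<odot> (xx i * (xx i * ?R) * ?R)"
      by (simp add: X mult_scale_right mult.assoc)
    then have "(emb 0 - Xd i) * (c \<odot> (?R * ?R)) = (- c) \<odot> ((xx i * ?R) * (xx i * ?R))"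
      unfolding RR .
    then show ?case
      using cc(1) unfolding cprod_insert[OF c insert.hyps] cprod_insert[OF commuting_xx insert.hyps] cc(2)
      by (intro exI[of _ "- c"] conjI) (simp only: neg_equal_0_iff_equal not_False_eq_True)
  qed
  then show ?thesis by (simp add: pts.P_def pts.lin_def \<Omega>_def)
qed

definition inv_group :: "bool \<Rightarrow> 'f set"
  where "inv_group restr = inv_set (if restr then {\<alpha>. (\<Sum>i\<in>UNIV. \<alpha> i) = 0} else signs)"

lemma quantum_planes_exist:
  assumes r: "bij_betw r (UNIV :: 'n set) {..<card (UNIV :: 'n set)}" and restr: "restr \<Longrightarrow> d = 2"
  obtains g where "qspace_rel (\<lambda>i. if restr \<and> r i = 0 then q else q ^ d) g" "\<And>h. g h \<noteq> 0"
    "\<And>B z. subalg B \<Longrightarrow> (\<And>h. g h \<in> B \<and> inverse (g h) \<in> B) \<Longrightarrow> pts.P z \<in> B \<and> pts.Q z \<in> B"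
    "\<And>D. divsub D \<Longrightarrow> (\<And>z. pts.P z \<in> D \<and> pts.Q z \<in> D) \<Longrightarrow> (restr \<Longrightarrow> \<Omega> \<in> D) \<Longrightarrow> range g \<subseteq> D"
    "restr \<Longrightarrow> \<Omega> \<in> range g"
proof -
  let ?n = "card (UNIV :: 'n set)"
  have r_inj: "r i = r j \<longleftrightarrow> i = j" for i j
    using r unfolding bij_betw_def by (auto dest: injD)
  have range: "range r = {..<?n}" using r unfolding bij_betw_def by (rule conjunct2)
  have rn: "r i < ?n" for i using rangeI[of r i] unfolding range by (rule lessThan_iff[THEN iffD1])
  have r_onto: "\<exists>i. r i = k" if "k < ?n" for k
  proof -
    have "k \<in> range r" unfolding range using that by (rule lessThan_iff[THEN iffD2])
    then show ?thesis by blast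
  qed
  have qd: "q ^ d \<noteq> 0" using q0 by simp
  obtain u v where uv: "separates (q ^ d) ?n pts.P pts.Q u v"
    using separates_exists[OF pts.exchange_pair qd] by blast
  note nz = separatesD(1)[OF uv] and rel = separatesD(2)[OF uv] and in_D = separatesD(3)[OF uv]
    and in_B = separatesD(4)[OF uv]
  have u0: "u 0 = pts.P 0" by (rule separatesD(5)[OF uv]) simp
  have \<Omega>_rel: "u i * \<Omega> = \<Omega> * u i \<and> v i * \<Omega> = (if i = 0 then q else 1) \<odot> (\<Omega> * v i)" if "i < ?n" for i
  proof -
    have X: "\<Omega> * Xd i = Xd i * \<Omega>" for i
      unfolding Xd_def using power_commuting_commutes[OF \<Omega>_xx[symmetric]] by simp
    note * = pts.skew_commuting[OF X Yd_\<Omega>]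
    show ?thesis
      by (rule separatesD(6)[OF uv q0 *]) (rule that)
  qed
  define g where "g h = (case h of GenX i \<Rightarrow> if restr \<and> r i = 0 then \<Omega> else u (r i) | GenY i \<Rightarrow> v (r i))" for h
  show thesis
  proof
    show "qspace_rel (\<lambda>i. if restr \<and> r i = 0 then q else q ^ d) g"
      unfolding qspace_rel_def g_def gen.case
    proof (intro allI conjI)
      fix i j
      note rels = rel[OF rn[of i] rn[of j]]
      show "(if restr \<and> r i = 0 then \<Omega> else u (r i)) * (if restr \<and> r j = 0 then \<Omega> else u (r j))
        = (if restr \<and> r j = 0 then \<Omega> else u (r j)) * (if restr \<and> r i = 0 then \<Omega> else u (r i))"
        using rels[THEN conjunct1] \<Omega>_rel[OF rn[of i], THEN conjunct1] \<Omega>_rel[OF rn[of j], THEN conjunct1]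
        by (simp split: if_split)
      show "v (r i) * v (r j) = v (r j) * v (r i)" using rels by simp
      have vu: "v (r i) * u (r j) = (if i = j then q ^ d else 1) \<odot> (u (r j) * v (r i))"
        using rels[THEN conjunct2, THEN conjunct2] r_inj[of i j] by simp
      show "v (r i) * (if restr \<and> r j = 0 then \<Omega> else u (r j)) = (if i = j then if restr \<and> r i = 0 then q else q ^ d else 1)
          \<odot> ((if restr \<and> r j = 0 then \<Omega> else u (r j)) * v (r i))"
      proof (cases "restr \<and> r j = 0")
        case True
        then have "r i = 0 \<longleftrightarrow> i = j" using r_inj[of i j] by simp
        then show ?thesis using True \<Omega>_rel[OF rn[of i], THEN conjunct2] by (cases "i = j") simp_all
      next
        case False
        then have "(if i = j then if restr \<and> r i = 0 then q else q ^ d else 1) = (if i = j then q ^ d else 1)" by auto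
        then show ?thesis unfolding if_not_P[OF False] vu by (simp only:)
      qed
    qed
    show "g h \<noteq> 0" for h
      using nz[OF rn] \<Omega>_nonzero by (auto simp: g_def split: gen.split)
    show "pts.P z \<in> B \<and> pts.Q z \<in> B" if B: "subalg B" "\<And>h. g h \<in> B \<and> inverse (g h) \<in> B" for B z
    proof (rule in_B[OF B(1)])
      fix k assume "k < ?n"
      then obtain i where i: "k = r i" using r_onto by blast
      have "u k \<in> B \<and> inverse (u k) \<in> B"
      proof (cases "restr \<and> r i = 0")
        case True
        then obtain c where c: "c \<noteq> 0" "u k = c \<odot> (\<Omega> * \<Omega>)" using P0_\<Omega>[OF restr] u0 i by auto
        have "inverse (u k) = inverse c \<odot> (inverse \<Omega> * inverse \<Omega>)"
        proof (rule inverse_unique)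
          have "\<Omega> * \<Omega> * (inverse \<Omega> * inverse \<Omega>) = \<Omega> * (\<Omega> * inverse \<Omega>) * inverse \<Omega>" by (simp only: mult.assoc)
          then show "u k * (inverse c \<odot> (inverse \<Omega> * inverse \<Omega>)) = 1"
            unfolding c(2) using c(1) \<Omega>_nonzero by (simp add: scale_algebra)
        qed
        moreover have "\<Omega> \<in> B" "inverse \<Omega> \<in> B" using B(2)[of "GenX i"] True by (simp_all add: g_def)
        ultimately show ?thesis unfolding c(2) using subalgD(4,5)[OF B(1)] by simp
      next
        case False
        then show ?thesis using B(2)[of "GenX i"] i by (auto simp: g_def)
      qed
      then show "u k \<in> B \<and> inverse (u k) \<in> B \<and> v k \<in> B \<and> inverse (v k) \<in> B"
        using B(2)[of "GenY i"] i by (simp add: g_def)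
    qed
    show "range g \<subseteq> D" if D: "divsub D" "\<And>z. pts.P z \<in> D \<and> pts.Q z \<in> D" "restr \<Longrightarrow> \<Omega> \<in> D" for D
      using in_D[OF D(1,2) rn] D(3) by (auto simp: g_def split: gen.split)
    show "\<Omega> \<in> range g" if restr
    proof -
      have "0 < ?n" by simp
      then obtain i where "r i = 0" using r_onto by blast
      then have "g (GenX i) = \<Omega>" using that by (simp add: g_def)
      then show ?thesis by (metis rangeI)
    qed
  qed
qed

lemma free_quantum_planes:
  assumes rel: "qspace_rel qs g" and qs: "\<And>i. qs i \<noteq> 0" and nz: "\<And>h. g h \<noteq> 0"
    and PQ: "\<And>B z. subalg B \<Longrightarrow> (\<And>h. g h \<in> B \<and> inverse (g h) \<in> B) \<Longrightarrow> pts.P z \<in> B \<and> pts.Q z \<in> B"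
  shows "free_family (qmono g enum)"
proof -
  interpret T: qtorus emb g "qscalar qs" enum
    by (intro qtorus.intro skew_kalgebra_axioms qfamily_gens[OF rel enum qs] qtorus_axioms.intro nz)
  have PQ': "pts.P z \<in> T.laurent" "pts.Q z \<in> T.laurent" for z
    using PQ[OF T.subalg_laurent] T.z_laurent by blast+
  show ?thesis
  proof (rule T.free_by_growth[OF free_gens[OF enum] refl enum box_monomials])
    fix m h assume "m \<in> box_monomials"
    from box_monomials_stable[OF T.subalg_laurent PQ' this, of h]
    show "\<exists>b. (\<forall>m'\<in>box_monomials. b m' \<in> T.laurent) \<and> m * gens h = (\<Sum>m'\<in>box_monomials. b m' * m')"
      unfolding lspan_def by blast
  qed
qed

lemma even_invariants_in:
  assumes d2: "d = 2" and D: "divsub D" "\<And>z. pts.P z \<in> D \<and> pts.Q z \<in> D" "\<Omega> \<in> D"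
    and fixed: "D \<subseteq> inv_set {\<alpha>. (\<Sum>i\<in>UNIV. \<alpha> i) = 0}" and f: "f \<in> inv_set {\<alpha>. (\<Sum>i\<in>UNIV. \<alpha> i) = 0}"
  shows "f \<in> D"
proof -
  have signs: "signs = UNIV" unfolding signs_def using d2 by simp
  have all_in: "h \<in> D" if h: "h \<in> inv_set UNIV" for h
  proof -
    have "h \<in> D \<inter> inv_set signs"
    proof (rule invariants_in)
      show "divsub (D \<inter> inv_set signs)"
        using D(1) divsub_inv_set[of signs] unfolding divsub_def subalg_def by blast
    qed (use D(2) PQ_invariant h signs in auto)
    then show ?thesis by blast
  qed
  obtain i0 :: 'n where True by simp
  define \<delta> where "\<delta> i = (if i = i0 then 1 else 0 :: bit)" for i
  have \<delta>_sum: "(\<Sum>i\<in>UNIV. \<delta> i) = 1" by (simp add: \<delta>_def)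
  obtain \<tau> where \<tau>: "acts id \<delta> \<tau>" using acts_exists[OF permutes_id] by blast
  have Hf: "H f = (if (\<Sum>i\<in>UNIV. \<alpha> i) = 0 then f else \<tau> f)" if \<zeta>: "\<zeta> permutes UNIV" and H: "acts \<zeta> \<alpha> H" for \<zeta> \<alpha> H
  proof (cases "(\<Sum>i\<in>UNIV. \<alpha> i) = 0")
    case True
    then show ?thesis using inv_setD[OF f \<zeta> _ H] by simp
  next
    case False
    define \<beta> where "\<beta> i = \<delta> (\<zeta> i) + \<alpha> i" for i
    have "(\<Sum>i\<in>UNIV. \<delta> (\<zeta> i)) = 1" using sum_permutes_UNIV[OF \<zeta>, of \<delta>] \<delta>_sum by simp
    then have \<beta>: "(\<Sum>i\<in>UNIV. \<beta> i) = 0"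
      unfolding \<beta>_def sum.distrib using False by (cases "\<Sum>i\<in>UNIV. \<alpha> i") simp_all
    obtain H' where H': "acts \<zeta> \<beta> H'" using acts_exists[OF \<zeta>] by blast
    have "b + (b + a) = a" for a b :: bit by (cases a; cases b) simp_all
    then have "(\<lambda>i. \<delta> (\<zeta> i) + \<beta> i) = \<alpha>" by (simp only: \<beta>_def)
    then have "\<tau> (H' f) = H f" using acts_comp[OF \<tau> H', of H f] H by simp
    moreover have "H' f = f" using inv_setD[OF f \<zeta> _ H'] \<beta> by simp
    ultimately show ?thesis using False by simp
  qed
  have H\<tau>f: "H (\<tau> f) = (if (\<Sum>i\<in>UNIV. \<alpha> i) = 0 then \<tau> f else f)" if \<zeta>: "\<zeta> permutes UNIV" and H: "acts \<zeta> \<alpha> H" for \<zeta> \<alpha> H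
  proof -
    obtain K where K: "acts \<zeta> (\<lambda>i. \<alpha> i + \<delta> i) K" using acts_exists[OF \<zeta>] by blast
    have "H (\<tau> f) = K f" using acts_comp[OF H \<tau>, of K f] K by simp
    moreover have "(\<Sum>i\<in>UNIV. \<alpha> i + \<delta> i) = 0 \<longleftrightarrow> (\<Sum>i\<in>UNIV. \<alpha> i) \<noteq> 0"
      unfolding sum.distrib \<delta>_sum by (cases "\<Sum>i\<in>UNIV. \<alpha> i") simp_all
    ultimately show ?thesis using Hf[OF \<zeta> K] by simp
  qed
  have "f + \<tau> f \<in> inv_set UNIV"
    by (rule inv_setI) (simp add: actsD(1) Hf H\<tau>f add.commute)
  moreover have "inverse \<Omega> * (f - \<tau> f) \<in> inv_set UNIV"
  proof (rule inv_setI)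
    fix \<zeta> \<alpha> H assume \<zeta>: "\<zeta> permutes UNIV" and H: "acts \<zeta> \<alpha> H"
    show "H (inverse \<Omega> * (f - \<tau> f)) = inverse \<Omega> * (f - \<tau> f)"
      by (simp add: actsD(2)[OF H] acts_minus[OF H] acts_inverse[OF H] acts_\<Omega>[OF \<zeta> H] Hf[OF \<zeta> H] H\<tau>f[OF \<zeta> H]
          algebra_simps)
  qed
  ultimately have "(f + \<tau> f) + \<Omega> * (inverse \<Omega> * (f - \<tau> f)) \<in> D"
    using all_in D(3) subalgD(2,4)[OF divsubD(1)[OF D(1)]] by blast
  then have "inverse 2 \<odot> ((f + \<tau> f) + \<Omega> * (inverse \<Omega> * (f - \<tau> f))) \<in> D"
    by (rule subalgD(5)[OF divsubD(1)[OF D(1)]])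
  also have "\<Omega> * (inverse \<Omega> * (f - \<tau> f)) = f - \<tau> f" using \<Omega>_nonzero by (simp flip: mult.assoc)
  also have "inverse 2 \<odot> ((f + \<tau> f) + (f - \<tau> f)) = (inverse 2 * (1 + 1)) \<odot> f"
    by (simp only: scale_scale[symmetric] scale_left_distrib scale_one) simp
  finally show ?thesis by simp
qed

lemma invariants_generated:
  assumes r: "bij_betw r (UNIV :: 'n set) {..<card (UNIV :: 'n set)}" and restr: "restr \<Longrightarrow> d = 2"
  obtains g where "qspace_rel (\<lambda>i. if restr \<and> r i = 0 then q else q ^ d) g" "free_family (qmono g enum)"
    "range g \<subseteq> inv_group restr"
    "\<And>D. divsub D \<Longrightarrow> range g \<subseteq> D \<Longrightarrow> D \<subseteq> inv_group restr \<Longrightarrow> inv_group restr \<subseteq> D"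
proof -
  obtain g where g: "qspace_rel (\<lambda>i. if restr \<and> r i = 0 then q else q ^ d) g" "\<And>h. g h \<noteq> 0"
    and PQ: "\<And>B z. subalg B \<Longrightarrow> (\<And>h. g h \<in> B \<and> inverse (g h) \<in> B) \<Longrightarrow> pts.P z \<in> B \<and> pts.Q z \<in> B"
    and sub: "\<And>D. divsub D \<Longrightarrow> (\<And>z. pts.P z \<in> D \<and> pts.Q z \<in> D) \<Longrightarrow> (restr \<Longrightarrow> \<Omega> \<in> D) \<Longrightarrow> range g \<subseteq> D"
    and \<Omega>: "restr \<Longrightarrow> \<Omega> \<in> range g"
    using quantum_planes_exist[OF r restr] by blast
  show thesis
  proof (rule that[OF g(1)])
    show "free_family (qmono g enum)"
      by (rule free_quantum_planes[OF g(1) _ g(2) PQ]) (simp_all add: q0)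
    show "range g \<subseteq> inv_group restr"
    proof (rule sub)
      show "divsub (inv_group restr)" unfolding inv_group_def by (rule divsub_inv_set)
      have "inv_set signs \<subseteq> inv_group restr"
        using restr unfolding inv_group_def inv_set_def signs_def by auto
      then show "pts.P z \<in> inv_group restr \<and> pts.Q z \<in> inv_group restr" for z using PQ_invariant by blast
      show "\<Omega> \<in> inv_group restr" if restr
      proof -
        have "\<Omega> \<in> inv_set {\<alpha>. (\<Sum>i\<in>UNIV. \<alpha> i) = 0}"
          by (rule inv_setI) (use acts_\<Omega> in force)
        then show ?thesis unfolding inv_group_def using that by simp
      qed
    qed
    show "inv_group restr \<subseteq> D" if D: "divsub D" "range g \<subseteq> D" "D \<subseteq> inv_group restr" for D
    proof
      fix f assume f: "f \<in> inv_group restr"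
      have PQD: "pts.P z \<in> D \<and> pts.Q z \<in> D" for z
        by (rule PQ[OF divsubD(1)[OF D(1)]]) (use D(2) divsubD(2)[OF D(1)] in blast)
      show "f \<in> D"
      proof (cases restr)
        case True
        then show ?thesis using even_invariants_in[OF restr D(1) PQD] \<Omega> D(2,3) f by (auto simp: inv_group_def)
      next
        case False
        then show ?thesis using invariants_in[OF D(1)] PQD D(3) f by (simp add: inv_group_def)
      qed
    qed
  qed
qed

end

lemma bij_rank: "bij_betw (\<lambda>i. card {..<i}) (UNIV :: 'n::{finite, linorder} set) {..<card (UNIV :: 'n set)}"
proof -
  have less: "card {..<i} < card {..<j}" if "i < j" for i j :: 'n
    using that by (intro psubset_card_mono) auto
  have inj: "inj (\<lambda>i :: 'n. card {..<i})"
  proof (rule injI)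
    fix i j :: 'n assume "card {..<i} = card {..<j}"
    then show "i = j" using less[of i j] less[of j i] by (cases i j rule: linorder_cases) simp_all
  qed
  have "range (\<lambda>i :: 'n. card {..<i}) \<subseteq> {..<card (UNIV :: 'n set)}"
    by (auto intro!: psubset_card_mono)
  then have "range (\<lambda>i :: 'n. card {..<i}) = {..<card (UNIV :: 'n set)}"
    by (intro card_subset_eq) (simp_all add: card_image[OF inj])
  then show ?thesis using inj by (simp add: bij_betw_def)
qed

theorem mainTheorem2:
  fixes q :: "'k::field_char_0"
    and T :: classical_type
    and \<iota> :: "('n::{finite, linorder}, 'k) free_alg set \<Rightarrow> 'f::division_ring"
    and \<iota>' :: "('n, 'k) free_alg set \<Rightarrow> 'g::division_ring"
  assumes "q \<noteq> 0"
    and "skew_field_of_fractions (qspace (\<lambda>_. q)) \<iota>"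
    and "skew_field_of_fractions (qspace (noether_params T q)) \<iota>'"
  shows "(\<forall>i::'n. \<exists>k::int. noether_params T q i = q powi k) \<and>
    (\<exists>\<phi> \<in> ring_iso (weyl_invariants T q \<iota>) type_ring.
       \<forall>c. \<phi> (\<iota> (qclass (\<lambda>_. q) (const c))) = \<iota>' (qclass (noether_params T q) (const c)))"
proof
  show "\<forall>i::'n. \<exists>k::int. noether_params T q i = q powi k"
  proof
    fix i :: 'n
    have "noether_params T q i = q powi (if T = Type_A \<or> T = Type_D \<and> i = Min UNIV then 1 else 2)"
      by (cases T) (simp_all add: noether_params_def)
    then show "\<exists>k::int. noether_params T q i = q powi k" ..
  qed
  define d :: nat where "d = (if T = Type_A then 1 else 2)"
  interpret W: weyl_points q \<iota> d
    by unfold_locales (use assms in \<open>auto simp: d_def\<close>)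
  interpret G: embedded_qspace "noether_params T q" \<iota>'
    by unfold_locales (use assms in \<open>auto simp: noether_params_def split: classical_type.split\<close>)
  define r where "r i = card {..<i}" for i :: 'n
  have r0: "r i = 0 \<longleftrightarrow> i = Min UNIV" for i
  proof -
    have "r i = 0 \<longleftrightarrow> {..<i} = {}" by (simp add: r_def)
    also have "\<dots> \<longleftrightarrow> (\<forall>j. i \<le> j)" by (auto simp: set_eq_iff not_less)
    also have "\<dots> \<longleftrightarrow> i = Min UNIV" by (auto intro: Min_eqI[symmetric])
    finally show ?thesis .
  qed
  have params: "(\<lambda>i. if T = Type_D \<and> r i = 0 then q else q ^ d) = noether_params T q"
    by (cases T) (auto simp: r0 d_def noether_params_def)
  have r: "bij_betw r UNIV {..<card (UNIV :: 'n set)}"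
    using bij_rank unfolding r_def .
  have inv: "carrier (weyl_invariants T q \<iota>) = W.inv_group (T = Type_D)"
    unfolding W.weyl_invariants_eq W.inv_group_def W.signs_def by (cases T) (simp_all add: d_def)
  have d2: "d = 2" if "T = Type_D" using that by (simp add: d_def)
  let ?I = "W.inv_group (T = Type_D)"
  obtain g where g: "W.qspace_rel (noether_params T q) g" "W.free_family (qmono g W.enum)" "range g \<subseteq> ?I"
    and least: "\<And>D. W.divsub D \<Longrightarrow> range g \<subseteq> D \<Longrightarrow> D \<subseteq> ?I \<Longrightarrow> ?I \<subseteq> D"
    by (rule W.invariants_generated[where restr = "T = Type_D", OF r d2, unfolded params]) (assumption, rule that)
  have ker: "G.E a = 0" if "W.ev g a = 0" for a
    unfolding G.E_ev G.ev_normal_form[OF G.E_relations W.enum G.qs_nonzero]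
    by (simp add: W.normal_coeff_eq_0[OF g(1) W.enum G.qs_nonzero g(2) that])
  obtain H where H: "\<And>a b. H (a + b) = H a + H b" "\<And>a b. H (a * b) = H a * H b"
    "\<And>a. H (G.E a) = W.ev g a" "\<And>f. H f = 0 \<Longrightarrow> f = 0"
    using G.extension_exists[OF W.skew_kalgebra_axioms g(1) ker] by metis
  have H1: "H 1 = 1" using H(3)[of 1] by (simp add: G.E_1)
  have Hd: "H (a - b) = H a - H b" for a b using H(1)[of "a - b" b] by (simp add: algebra_simps)
  have H0: "H 0 = 0" using Hd[of 0 0] by simp
  have Hi: "H (inverse a) = inverse (H a)" for a
  proof (cases "a = 0")
    case False
    then have "H a * H (inverse a) = 1" by (simp add: H1 flip: H(2))
    then show ?thesis by (metis inverse_unique)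
  qed (simp add: H0)
  have Hc: "H (G.emb c) = W.emb c" for c by (simp add: G.emb_def H(3))
  have inj: "inj H"
  proof (rule injI)
    fix a b assume "H a = H b"
    then have "H (a - b) = 0" by (simp add: Hd)
    then show "a = b" using H(4) by fastforce
  qed
  have I: "W.divsub ?I" unfolding W.inv_group_def by (rule W.divsub_inv_set)
  have range: "range H = ?I"
  proof
    have evI: "W.ev g a \<in> ?I" for a by (rule W.ev_in[OF W.divsubD(1)[OF I] g(3)])
    show le: "range H \<subseteq> ?I"
    proof clarify
      fix f
      obtain a s where "f = G.E a * inverse (G.E s)" using G.fraction by blast
      then have "H f = W.ev g a * inverse (W.ev g s)" by (simp add: H(2,3) Hi)
      then show "H f \<in> ?I"
        using W.subalgD(4)[OF W.divsubD(1)[OF I] evI W.divsubD(2)[OF I evI]] by simp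
    qed
    show "?I \<subseteq> range H"
    proof (rule least[OF _ _ le])
      show "W.divsub (range H)"
        unfolding W.divsub_def W.subalg_def
      proof (intro conjI ballI)
        show "range W.emb \<subseteq> range H" using Hc by (metis image_subsetI rangeI)
        fix a b assume "a \<in> range H" "b \<in> range H"
        then show "a + b \<in> range H" "a - b \<in> range H" "a * b \<in> range H"
          by (auto simp flip: H(1,2) Hd)
      next
        fix a assume "a \<in> range H"
        then show "inverse a \<in> range H" by (auto simp flip: Hi)
      qed
      show "range g \<subseteq> range H"
      proof clarify
        fix h
        show "g h \<in> range H"
        proof (cases h)
          case (GenX i)
          then have "g h = H (G.E (X i))" by (simp add: H(3))
          then show ?thesis by simp
        next
          case (GenY i)
          then have "g h = H (G.E (Y i))" by (simp add: H(3))
          then show ?thesis by simp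
        qed
      qed
    qed
  qed
  define \<phi> where "\<phi> = inv_into UNIV H"
  have \<phi>H: "\<phi> (H a) = a" for a unfolding \<phi>_def by (rule inv_into_f_f[OF inj]) simp
  show "\<exists>\<phi> \<in> ring_iso (weyl_invariants T q \<iota>) type_ring.
       \<forall>c. \<phi> (\<iota> (qclass (\<lambda>_. q) (const c))) = \<iota>' (qclass (noether_params T q) (const c))"
  proof (intro bexI allI)
    show "\<phi> (\<iota> (qclass (\<lambda>_. q) (const c))) = \<iota>' (qclass (noether_params T q) (const c))" for c
      using \<phi>H[of "G.emb c"] unfolding Hc by (simp add: G.emb_def W.emb_def G.E_def W.E_def)
    have ops: "mult (weyl_invariants T q \<iota>) = (*)" "add (weyl_invariants T q \<iota>) = (+)" "one (weyl_invariants T q \<iota>) = 1"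
      by (simp_all add: weyl_invariants_def)
    have "\<phi> \<in> ring_hom (weyl_invariants T q \<iota>) type_ring"
    proof (rule ring_hom_memI)
      fix a b assume "a \<in> carrier (weyl_invariants T q \<iota>)" "b \<in> carrier (weyl_invariants T q \<iota>)"
      then obtain a' b' where "a = H a'" "b = H b'" unfolding inv range[symmetric] by blast
      then show "\<phi> (a \<otimes>\<^bsub>weyl_invariants T q \<iota>\<^esub> b) = \<phi> a \<otimes>\<^bsub>type_ring\<^esub> \<phi> b"
        "\<phi> (a \<oplus>\<^bsub>weyl_invariants T q \<iota>\<^esub> b) = \<phi> a \<oplus>\<^bsub>type_ring\<^esub> \<phi> b"
        unfolding ops by (simp_all add: \<phi>H flip: H(1,2))
    qed (use \<phi>H[of 1] H1 in \<open>simp_all add: ops\<close>)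
    moreover have "bij_betw \<phi> (carrier (weyl_invariants T q \<iota>)) (carrier type_ring)"
      unfolding inv range[symmetric] \<phi>_def type_ring_simps
      by (rule bij_betw_inv_into) (use inj in \<open>simp add: bij_betw_def\<close>)
    ultimately show "\<phi> \<in> ring_iso (weyl_invariants T q \<iota>) type_ring" by (simp add: ring_iso_def)
  qed
qed

end
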